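(* Let $\Omega\subset\mathbb{R}^n$ ($n\ge 2$) be a bounded open domain, let $p\ge 1$, and let $F,G:[0,\infty)\to\mathbb{R}$ be locally Lipschitz functions such that: (1) $F(0)=0$; (2) $-\infty<\liminf_{s\to 0^+}\frac{F(s)}{s^2}$ and $\limsup_{s\to 0^+}\frac{F(s)}{s^2}=+\infty$; (3) $l_0:=\liminf_{s\to 0^+}\frac{\max\{\xi:\xi\in\partial F(s)\}}{s}<0$ (the value $-\infty$ is allowed); (4) $G(0)=0$; (5) there are $\underline c,\overline c\in\mathbb{R}$ such that $$\underline c=\liminf_{s\to 0^+}\frac{\min\{\xi:\xi\in\partial G(s)\}}{s^p}\le\limsup_{s\to 0^+}\frac{\max\{\xi:\xi\in\partial G(s)\}}{s^p}=\overline c .$$ Suppose that either (i) $p=1$, $\lambda\ge 0$ and $\lambda\overline c<-l_0$; or (ii) $p>1$ and $\lambda\ge 0$ is arbitrary. Then the differential inclusion problem $$-\Delta u(x)\in\partial F(u(x))+\lambda\,\partial G(u(x))\ \text{ in }\Omega,\qquad u\ge 0\ \text{ in }\Omega,\qquad u=0\ \text{ on }\partial\Omega$$ admits a sequence $\{u_i\}_i\subset H_0^1(\Omega)$ of distinct weak solutions such that $$\lim_{i\to\infty}\|u_i\|_{H_0^1}=\lim_{i\to\infty}\|u_i\|_{L^\infty}=0 .$$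
   Context: For a locally Lipschitz function $f$ on $\mathbb{R}$, $\partial f(s)$ denotes the Clarke generalized gradient: $\partial f(s)=\{\xi\in\mathbb{R}:\ \xi v\le f^\circ(s;v)\ \text{for all } v\in\mathbb{R}\}$, where $f^\circ(s;v)=\limsup_{z\to s,\ \tau\to 0^+}\frac{f(z+\tau v)-f(z)}{\tau}$; it is a nonempty compact interval. Functions defined on $[0,\infty)$ and vanishing at $0$ are extended by $0$ to $(-\infty,0)$, which gives meaning to the generalized gradient at $0$. $\|u\|_{H_0^1}^2=\int_\Omega|\nabla u|^2dx$. A weak solution of the inclusion problem is a function $u\in H_0^1(\Omega)$ with $u\ge 0$ a.e. in $\Omega$ for which there is a measurable function $\xi:\Omega\to\mathbb{R}$ with $\xi(x)\in\partial F(u(x))+\lambda\,\partial G(u(x))$ for a.e. $x\in\Omega$ and $\int_\Omega\nabla u\cdot\nabla v\,dx=\int_\Omega \xi v\,dx$ for all $v\in H_0^1(\Omega)$. *)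

theory Defs
  imports "HOL-Analysis.Analysis" "HOL-Probability.Essential_Supremum"
begin

section \<open>Clarke's generalized gradient on the real line\<close>

definition locally_lipschitz_on :: "real set \<Rightarrow> (real \<Rightarrow> real) \<Rightarrow> bool" where
  "locally_lipschitz_on S f \<longleftrightarrow>
     (\<forall>x\<in>S. \<exists>r>0. \<exists>L. L-lipschitz_on (cball x r \<inter> S) f)"

text \<open>
  A function on \<open>[0, \<infinity>)\<close> is represented by a total function whose values at negative
  arguments are irrelevant: they are always overwritten by \<open>zero_extension\<close>.
\<close>

definition zero_extension :: "(real \<Rightarrow> real) \<Rightarrow> real \<Rightarrow> real" where
  "zero_extension f s = (if s < 0 then 0 else f s)"

text \<open>As usual for Clarke's derivative, the base point \<open>z = s\<close> is included in the upper limit.\<close>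

definition clarke_derivative :: "(real \<Rightarrow> real) \<Rightarrow> real \<Rightarrow> real \<Rightarrow> ereal" where
  "clarke_derivative f s v =
     Limsup (nhds s \<times>\<^sub>F at_right 0) (\<lambda>(z, t). ereal ((f (z + t * v) - f z) / t))"

definition clarke_gradient :: "(real \<Rightarrow> real) \<Rightarrow> real \<Rightarrow> real set" where
  "clarke_gradient f s = {\<xi>. \<forall>v. ereal (\<xi> * v) \<le> clarke_derivative f s v}"

text \<open>
  \<open>Max\<close> and \<open>Min\<close> are only meaningful for finite sets, hence the order-theoretic greatest and
  least elements; they exist because the Clarke gradient of a locally Lipschitz function is
  a nonempty compact interval.
\<close>

definition clarke_max :: "(real \<Rightarrow> real) \<Rightarrow> real \<Rightarrow> real" where
  "clarke_max f s = (GREATEST \<xi>. \<xi> \<in> clarke_gradient f s)"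

definition clarke_min :: "(real \<Rightarrow> real) \<Rightarrow> real \<Rightarrow> real" where
  "clarke_min f s = (LEAST \<xi>. \<xi> \<in> clarke_gradient f s)"

section \<open>The Sobolev space of functions vanishing on the boundary\<close>

definition gradient :: "(real^'n \<Rightarrow> real) \<Rightarrow> real^'n \<Rightarrow> real^'n" where
  "gradient f x = (\<chi> i. frechet_derivative f (at x) (axis i 1))"

primrec C_k :: "nat \<Rightarrow> (real^'n \<Rightarrow> real) \<Rightarrow> bool" where
  "C_k 0 f \<longleftrightarrow> continuous_on UNIV f"
| "C_k (Suc k) f \<longleftrightarrow> (\<forall>x. f differentiable (at x)) \<and> (\<forall>i. C_k k (\<lambda>x. gradient f x $ i))"

definition test_function :: "(real^'n) set \<Rightarrow> (real^'n \<Rightarrow> real) \<Rightarrow> bool" where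
  "test_function \<Omega> \<phi> \<longleftrightarrow>
     (\<forall>k. C_k k \<phi>) \<and> compact (closure {x. \<phi> x \<noteq> 0}) \<and> closure {x. \<phi> x \<noteq> 0} \<subseteq> \<Omega>"

definition square_integrable :: "(real^'n) set \<Rightarrow> (real^'n \<Rightarrow> 'b::euclidean_space) \<Rightarrow> bool" where
  "square_integrable \<Omega> f \<longleftrightarrow>
     f \<in> borel_measurable (lebesgue_on \<Omega>) \<and> integrable (lebesgue_on \<Omega>) (\<lambda>x. (norm (f x))\<^sup>2)"

text \<open>Both integrals exist because \<open>u\<close> and \<open>g\<close> are square integrable.\<close>

definition has_weak_gradient ::
    "(real^'n) set \<Rightarrow> (real^'n \<Rightarrow> real) \<Rightarrow> (real^'n \<Rightarrow> real^'n) \<Rightarrow> bool" where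
  "has_weak_gradient \<Omega> u g \<longleftrightarrow>
     square_integrable \<Omega> u \<and> square_integrable \<Omega> g \<and>
     (\<forall>\<phi>. test_function \<Omega> \<phi> \<longrightarrow>
        (LINT x|lebesgue_on \<Omega>. u x *\<^sub>R gradient \<phi> x) = - (LINT x|lebesgue_on \<Omega>. \<phi> x *\<^sub>R g x))"

text \<open>
  Elements of the Sobolev spaces are functions rather than classes of functions modulo equality
  almost everywhere on \<open>\<Omega>\<close>; accordingly the weak gradient is chosen among its versions.
\<close>

definition weak_gradient :: "(real^'n) set \<Rightarrow> (real^'n \<Rightarrow> real) \<Rightarrow> real^'n \<Rightarrow> real^'n" where
  "weak_gradient \<Omega> u = (SOME g. has_weak_gradient \<Omega> u g)"

definition H1 :: "(real^'n) set \<Rightarrow> (real^'n \<Rightarrow> real) set" where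
  "H1 \<Omega> = {u. \<exists>g. has_weak_gradient \<Omega> u g}"

definition H1_norm :: "(real^'n) set \<Rightarrow> (real^'n \<Rightarrow> real) \<Rightarrow> real" where
  "H1_norm \<Omega> u =
     sqrt ((LINT x|lebesgue_on \<Omega>. (u x)\<^sup>2) + (LINT x|lebesgue_on \<Omega>. (norm (weak_gradient \<Omega> u x))\<^sup>2))"

text \<open>The closure of the test functions in \<open>H1 \<Omega>\<close>.\<close>

definition H01 :: "(real^'n) set \<Rightarrow> (real^'n \<Rightarrow> real) set" where
  "H01 \<Omega> = {u \<in> H1 \<Omega>. \<exists>\<phi>. (\<forall>k::nat. test_function \<Omega> (\<phi> k)) \<and>
                      (\<lambda>k. H1_norm \<Omega> (\<lambda>x. \<phi> k x - u x)) \<longlonglongrightarrow> 0}"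

definition H01_norm :: "(real^'n) set \<Rightarrow> (real^'n \<Rightarrow> real) \<Rightarrow> real" where
  "H01_norm \<Omega> u = sqrt (LINT x|lebesgue_on \<Omega>. (norm (weak_gradient \<Omega> u x))\<^sup>2)"

definition Linf_norm :: "(real^'n) set \<Rightarrow> (real^'n \<Rightarrow> real) \<Rightarrow> ereal" where
  "Linf_norm \<Omega> u = esssup (lebesgue_on \<Omega>) (\<lambda>x. ereal \<bar>u x\<bar>)"

section \<open>The differential inclusion\<close>

text \<open>
  Integrability of \<open>\<xi> v\<close> is part of the weak formulation; it has to be stated because the
  library integral of a non-integrable function is 0. The condition \<open>u = 0\<close> on the boundary is
  membership in \<open>H01 \<Omega>\<close>.
\<close>

definition weak_solution ::
    "(real^'n) set \<Rightarrow> (real \<Rightarrow> real) \<Rightarrow> (real \<Rightarrow> real) \<Rightarrow> real \<Rightarrow> (real^'n \<Rightarrow> real) \<Rightarrow> bool" where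
  "weak_solution \<Omega> F G l u \<longleftrightarrow>
     u \<in> H01 \<Omega> \<and> (AE x in lebesgue_on \<Omega>. u x \<ge> 0) \<and>
     (\<exists>\<xi> \<in> borel_measurable (lebesgue_on \<Omega>).
        (AE x in lebesgue_on \<Omega>.
           \<xi> x \<in> {a + l * b | a b. a \<in> clarke_gradient (zero_extension F) (u x) \<and>
                                  b \<in> clarke_gradient (zero_extension G) (u x)}) \<and>
        (\<forall>v \<in> H01 \<Omega>.
           integrable (lebesgue_on \<Omega>) (\<lambda>x. \<xi> x * v x) \<and>
           (LINT x|lebesgue_on \<Omega>. weak_gradient \<Omega> u x \<bullet> weak_gradient \<Omega> v x)
             = (LINT x|lebesgue_on \<Omega>. \<xi> x * v x)))"

end

theory Submission
  imports Defs "HOL-Complex_Analysis.Great_Picard" "HOL-Real_Asymp.Real_Asymp"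
begin

text \<open>
  Condition (3) provides points \<open>a\<close> arbitrarily close to 0 at which \<open>\<partial>F + \<lambda>\<partial>G\<close> is negative, so that
  the potential \<open>F + \<lambda>G\<close> decreases on an interval \<open>[\<delta>, a]\<close>. Freezing it beyond \<open>a\<close> gives a globally
  Lipschitz potential whose energy does not increase when a function is truncated to \<open>[0, \<delta>]\<close>.
  Minimizing among test functions, every minimizing sequence may be replaced by a smoothly
  truncated one (differences of softplus functions are smooth, 1-Lipschitz and uniformly close to the
  truncation), so no chain rule in the Sobolev space is needed. Averages over cubes give compactness in
  \<open>L\<^sup>1\<close>; the parallelogram identity then makes the gradients converge strongly. The minimizer
  takes values in \<open>[0, \<delta>]\<close>, it is nonzero by (2), and its norms are small with \<open>a\<close>.

  Its Euler-Lagrange functional is bounded in \<open>L\<^sup>1\<close>, hence is represented by some \<open>\<xi>\<close>. Comparing energies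
  along nonnegative test functions bounds \<open>\<xi>\<close> by the local difference quotients of the potential at
  \<open>u\<close>, which is exactly the inclusion, because in one dimension the Clarke gradient is the interval
  between the lower and upper limits of difference quotients.
\<close>

section \<open>Smooth functions\<close>

text \<open>All comparisons are made on test functions and passed to the limit. This works because a
  Lipschitz potential contributes a term that is continuous in \<open>L^1\<close>; in the
  parallelogram identity that term is an error of at most a constant times the \<open>L^1\<close>
  distance. The minimizer is nonzero because a bump of small height \<open>t\<close> has Dirichlet
  energy of order \<open>t^2\<close>, whereas (2) provides arbitrarily small \<open>t\<close> at
  which \<open>F t\<close> exceeds any prescribed multiple of \<open>t^2\<close>. Below its plateau
  the bump takes values between 0 and \<open>t\<close>; there (2) and (5) bound the potential below
  by \<open>- C t^2\<close>, which for \<open>G\<close> rests on \<open>p \<ge> 1\<close>. Negative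
  energy bounds the squared Dirichlet norm by \<open>2 L a\<close> times the measure of
  \<open>\<Omega>\<close>, which is small with \<open>a\<close>. Cases (i) and (ii) enter through
  the sign condition that defines \<open>a\<close>. Distinctness results from choosing each new
  \<open>a\<close> below the sup norm of the previous solution.\<close>

lemma gradient_eqI:
  assumes "(f has_derivative (\<lambda>h. d \<bullet> h)) (at x)"
  shows "gradient f x = d"
proof -
  have "frechet_derivative f (at x) = (\<bullet>) d"
    using frechet_derivative_at[OF assms] by simp
  then show ?thesis by (simp add: gradient_def vec_eq_iff inner_axis)
qed

lemma has_derivative_gradient:
  assumes "f differentiable (at x)"
  shows "(f has_derivative (\<lambda>h. gradient f x \<bullet> h)) (at x)"
proof -
  have *: "(f has_derivative frechet_derivative f (at x)) (at x)"
    using assms by (simp add: frechet_derivative_works)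
  then interpret bounded_linear "frechet_derivative f (at x)"
    by (rule has_derivative_bounded_linear)
  have "frechet_derivative f (at x) h = gradient f x \<bullet> h" for h
  proof -
    have "frechet_derivative f (at x) h = frechet_derivative f (at x) (\<Sum>i\<in>UNIV. h $ i *\<^sub>R axis i 1)"
      by (simp add: basis_expansion flip: scalar_mult_eq_scaleR)
    also have "\<dots> = gradient f x \<bullet> h"
      by (simp add: sum scaleR inner_vec_def gradient_def mult.commute)
    finally show ?thesis .
  qed
  then have "frechet_derivative f (at x) = (\<lambda>h. gradient f x \<bullet> h)" by blast
  with * show ?thesis by simp
qed

text \<open>A candidate gradient suffices: uniqueness of the Frechet derivative identifies
  \<open>d\<close> with \<open>gradient f\<close>, so the recursive clause of \<open>C_k\<close> can
  be checked on an explicit formula.\<close>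

lemma C_k_SucI:
  assumes "\<And>x. (f has_derivative (\<lambda>h. d x \<bullet> h)) (at x)" "\<And>i. C_k k (\<lambda>x. d x $ i)"
  shows "C_k (Suc k) f"
proof -
  have "gradient f = d" using assms(1) gradient_eqI by blast
  with assms show ?thesis by (auto simp: differentiable_def)
qed

lemma C_k_Suc_has_derivative:
  "C_k (Suc k) f \<Longrightarrow> (f has_derivative (\<lambda>h. gradient f x \<bullet> h)) (at x)"
  by (simp add: has_derivative_gradient)

lemma C_k_imp_continuous: "C_k k f \<Longrightarrow> continuous_on UNIV f"
  by (cases k) (auto simp: continuous_on_eq_continuous_at differentiable_imp_continuous_within)

text \<open>The recursion descends into the partial derivatives, so monotonicity in \<open>k\<close>
  is an induction whose base case is that differentiability implies continuity.\<close>

lemma C_k_Suc_imp: "C_k (Suc k) f \<Longrightarrow> C_k k f"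
proof (induction k arbitrary: f)
  case 0 then show ?case using C_k_imp_continuous[of "Suc 0"] by simp
next
  case (Suc k) then show ?case by (metis C_k.simps(2))
qed

lemma C_k_const [simp]: "C_k k (\<lambda>x. c)"
proof (induction k arbitrary: c)
  case (Suc k)
  show ?case
    by (rule C_k_SucI[where d="\<lambda>_. 0"]) (auto intro: derivative_eq_intros simp: Suc)
qed simp

lemma C_k_component [simp]: "C_k k (\<lambda>x. x $ j)"
proof (cases k)
  case (Suc l)
  have "((\<lambda>x. x $ j) has_derivative (\<lambda>h. axis j 1 \<bullet> h)) (at x)" for x :: "real^'a"
    using bounded_linear_imp_has_derivative[OF bounded_linear_vec_nth] by (simp add: inner_axis')
  then show ?thesis unfolding Suc by (rule C_k_SucI) simp
qed (simp add: continuous_on_component)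

lemma C_k_add: "C_k k f \<Longrightarrow> C_k k g \<Longrightarrow> C_k k (\<lambda>x. f x + g x)"
proof (induction k arbitrary: f g)
  case 0 then show ?case by (simp add: continuous_on_add)
next
  case (Suc k)
  show ?case
  proof (rule C_k_SucI[where d="\<lambda>x. gradient f x + gradient g x"])
    show "((\<lambda>x. f x + g x) has_derivative (\<lambda>h. (gradient f x + gradient g x) \<bullet> h)) (at x)" for x
      using has_derivative_add[OF Suc.prems[THEN C_k_Suc_has_derivative]] by (simp add: inner_left_distrib)
    show "C_k k (\<lambda>x. (gradient f x + gradient g x) $ i)" for i
      using Suc by simp
  qed
qed

lemma C_k_mult: "C_k k f \<Longrightarrow> C_k k g \<Longrightarrow> C_k k (\<lambda>x. f x * g x)"
proof (induction k arbitrary: f g)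
  case 0 then show ?case by (simp add: continuous_on_mult)
next
  case (Suc k)
  show ?case
  proof (rule C_k_SucI[where d="\<lambda>x. f x *\<^sub>R gradient g x + g x *\<^sub>R gradient f x"])
    show "((\<lambda>x. f x * g x) has_derivative (\<lambda>h. (f x *\<^sub>R gradient g x + g x *\<^sub>R gradient f x) \<bullet> h)) (at x)" for x
      using has_derivative_mult[OF Suc.prems[THEN C_k_Suc_has_derivative]]
      by (simp add: inner_left_distrib mult.commute)
    show "C_k k (\<lambda>x. (f x *\<^sub>R gradient g x + g x *\<^sub>R gradient f x) $ i)" for i
      using Suc.IH Suc.prems Suc.prems[THEN C_k_Suc_imp]
      by (simp add: C_k_add)
  qed
qed

lemma C_k_cmult: "C_k k f \<Longrightarrow> C_k k (\<lambda>x. c * f x)"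
  by (rule C_k_mult) simp_all

lemma C_k_diff: "C_k k f \<Longrightarrow> C_k k g \<Longrightarrow> C_k k (\<lambda>x. f x - g x)"
  using C_k_add[OF _ C_k_cmult[where c="-1"]] by simp

lemma C_k_prod: "(\<And>i. i \<in> A \<Longrightarrow> C_k k (f i)) \<Longrightarrow> C_k k (\<lambda>x. \<Prod>i\<in>A. f i x)"
  by (induction A rule: infinite_finite_induct) (auto intro: C_k_mult)

text \<open>The whole sequence of successive derivatives is the parameter because the chain rule
  replaces \<open>D n\<close> by \<open>D (Suc n)\<close>; the induction on \<open>k\<close>
  therefore runs for all \<open>n\<close> at once.\<close>

lemma C_k_compose:
  assumes "\<And>n t. (D n has_real_derivative D (Suc n) t) (at t)" "C_k k f"
  shows "C_k k (\<lambda>x. D n (f x))"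
  using assms(2)
proof (induction k arbitrary: n)
  case 0
  have "continuous_on UNIV (D n)"
    using assms(1) by (meson DERIV_continuous continuous_at_imp_continuous_on)
  with 0 show ?case using continuous_on_compose2[OF _ _ subset_UNIV] by simp
next
  case (Suc k)
  show ?case
  proof (rule C_k_SucI[where d="\<lambda>x. D (Suc n) (f x) *\<^sub>R gradient f x"])
    show "((\<lambda>x. D n (f x)) has_derivative (\<lambda>h. (D (Suc n) (f x) *\<^sub>R gradient f x) \<bullet> h)) (at x)" for x
      using has_derivative_compose[OF C_k_Suc_has_derivative[OF Suc.prems] assms(1)[unfolded has_field_derivative_def]]
      by simp
    show "C_k k (\<lambda>x. (D (Suc n) (f x) *\<^sub>R gradient f x) $ i)" for i
      using Suc.IH Suc.prems C_k_Suc_imp[OF Suc.prems] by (simp add: C_k_mult)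
  qed
qed

lemma C_k_exp: "C_k k f \<Longrightarrow> C_k k (\<lambda>x. exp (f x))"
  by (rule C_k_compose[where D="\<lambda>_. exp"]) (auto intro: DERIV_exp)

text \<open>One chain rule step, for outer functions whose derivative is an expression in functions
  already known one level lower. For \<open>sigmoid\<close> and \<open>flat_exp\<close> that
  knowledge is the induction hypothesis on \<open>k\<close>, because their derivatives are built
  from the same family.\<close>

lemma C_k_Suc_real_compose:
  assumes "\<And>t. (h has_real_derivative h' t) (at t)" "C_k (Suc k) f" "C_k k (\<lambda>x. h' (f x))"
  shows "C_k (Suc k) (\<lambda>x. h (f x))"
proof (rule C_k_SucI[where d="\<lambda>x. h' (f x) *\<^sub>R gradient f x"])
  show "((\<lambda>x. h (f x)) has_derivative (\<lambda>v. (h' (f x) *\<^sub>R gradient f x) \<bullet> v)) (at x)" for x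
    using has_derivative_compose[OF C_k_Suc_has_derivative[OF assms(2)] assms(1)[unfolded has_field_derivative_def]]
    by simp
  show "C_k k (\<lambda>x. (h' (f x) *\<^sub>R gradient f x) $ i)" for i
    using assms by (simp add: C_k_mult)
qed

section \<open>Logistic function and softplus\<close>

definition sigmoid :: "real \<Rightarrow> real" where "sigmoid t = 1 / (1 + exp (- t))"

lemma sigmoid_bounds: "0 < sigmoid t" "sigmoid t < 1"
  by (simp_all add: sigmoid_def add_pos_pos)

lemma sigmoid_mono: "s \<le> t \<Longrightarrow> sigmoid s \<le> sigmoid t"
  by (simp add: sigmoid_def frac_le add_pos_pos)

lemma DERIV_sigmoid: "(sigmoid has_real_derivative sigmoid t * (1 - sigmoid t)) (at t)"
proof -
  have "1 + exp (-t) > 0" by (simp add: add_pos_pos)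
  then have "1 + exp (-t) \<noteq> 0" by simp
  then show ?thesis unfolding sigmoid_def
    by (auto intro!: derivative_eq_intros simp: field_simps power2_eq_square)
qed

lemma C_k_sigmoid: "C_k k f \<Longrightarrow> C_k k (\<lambda>x. sigmoid (f x))"
proof (induction k)
  case 0
  have "continuous_on UNIV sigmoid"
    using DERIV_sigmoid by (meson DERIV_continuous continuous_at_imp_continuous_on)
  with 0 show ?case using continuous_on_compose2[OF _ _ subset_UNIV] by simp
next
  case (Suc k)
  show ?case
    by (rule C_k_Suc_real_compose[OF DERIV_sigmoid Suc.prems])
      (intro C_k_mult C_k_diff C_k_const Suc.IH C_k_Suc_imp[OF Suc.prems])
qed

definition softplus :: "real \<Rightarrow> real" where "softplus t = ln (1 + exp t)"

lemma DERIV_softplus: "(softplus has_real_derivative sigmoid t) (at t)"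
proof -
  have "1 + exp t > 0" by (simp add: add_pos_pos)
  then show ?thesis unfolding softplus_def sigmoid_def
    by (auto intro!: derivative_eq_intros simp: field_simps exp_minus)
qed

text \<open>\<open>1 + exp t\<close> lies between \<open>exp (max t 0)\<close> and twice that
  number, so softplus is the positive part up to an error of \<open>ln 2\<close>. Rescaling the
  argument makes the error arbitrarily small.\<close>

lemma softplus_bounds: "max t 0 \<le> softplus t" "softplus t \<le> max t 0 + ln 2"
proof -
  have *: "exp (max t 0) \<le> 1 + exp t" "1 + exp t \<le> exp (max t 0) * 2"
    using exp_gt_zero[of t] by (cases "t \<le> 0"; simp add: max_def; fail)+
  have p: "0 < exp (max t 0)" "0 < 1 + exp t" "0 < exp (max t 0) * 2"
    by (simp_all add: add_pos_pos)
  have "ln (exp (max t 0)) \<le> ln (1 + exp t)" "ln (1 + exp t) \<le> ln (exp (max t 0) * 2)"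
    by (rule iffD2[OF ln_le_cancel_iff[OF p(1,2)] *(1)], rule iffD2[OF ln_le_cancel_iff[OF p(2,3)] *(2)])
  then show "max t 0 \<le> softplus t" "softplus t \<le> max t 0 + ln 2"
    unfolding softplus_def by (simp_all add: ln_mult)
qed

lemma C_k_softplus: "C_k k f \<Longrightarrow> C_k k (\<lambda>x. softplus (f x))"
proof (cases k)
  case 0
  assume "C_k k f"
  moreover have "continuous_on UNIV softplus"
    using DERIV_softplus by (meson DERIV_continuous continuous_at_imp_continuous_on)
  ultimately show ?thesis using 0 continuous_on_compose2[OF _ _ subset_UNIV] by simp
next
  case (Suc l)
  assume "C_k k f"
  then have f: "C_k (Suc l) f" by (simp only: Suc)
  show ?thesis
    unfolding Suc by (rule C_k_Suc_real_compose[OF DERIV_softplus f C_k_sigmoid[OF C_k_Suc_imp[OF f]]])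
qed

section \<open>Test functions\<close>

lemma closed_subset_compact:
  fixes K :: "'a::t2_space set"
  shows "compact K \<Longrightarrow> closed C \<Longrightarrow> C \<subseteq> K \<Longrightarrow> compact C"
  using compact_Int_closed[of K C] by (simp add: inf.absorb2)

text \<open>A function that vanishes wherever \<open>\<phi>\<close> does has its support inside that
  of \<open>\<phi>\<close>, so only smoothness remains to be checked. This covers products,
  multiples and compositions with functions fixing 0.\<close>

lemma test_function_support:
  assumes "test_function \<Omega> \<phi>" "\<And>k. C_k k \<psi>" "\<And>x. \<phi> x = 0 \<Longrightarrow> \<psi> x = 0"
  shows "test_function \<Omega> \<psi>"
proof -
  have "closure {x. \<psi> x \<noteq> 0} \<subseteq> closure {x. \<phi> x \<noteq> 0}"
    using assms(3) by (intro closure_mono) auto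
  then have "compact (closure {x. \<psi> x \<noteq> 0})"
    using assms(1) closed_subset_compact[OF _ closed_closure] unfolding test_function_def by blast
  with \<open>closure _ \<subseteq> _\<close> assms(1,2) show ?thesis unfolding test_function_def by auto
qed

lemma test_function_add:
  assumes "test_function \<Omega> \<phi>" "test_function \<Omega> \<psi>"
  shows "test_function \<Omega> (\<lambda>x. \<phi> x + \<psi> x)"
proof -
  have sub: "closure {x. \<phi> x + \<psi> x \<noteq> 0} \<subseteq> closure {x. \<phi> x \<noteq> 0} \<union> closure {x. \<psi> x \<noteq> 0}"
    unfolding closure_Un[symmetric] by (intro closure_mono) auto
  moreover have "compact (closure {x. \<phi> x \<noteq> 0} \<union> closure {x. \<psi> x \<noteq> 0})"
    using assms by (intro compact_Un) (auto simp: test_function_def)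
  ultimately have "compact (closure {x. \<phi> x + \<psi> x \<noteq> 0})"
    using closed_subset_compact[OF _ closed_closure] by blast
  with sub assms show ?thesis unfolding test_function_def by (auto intro: C_k_add)
qed

lemma test_function_mult:
  "test_function \<Omega> \<phi> \<Longrightarrow> (\<And>k. C_k k \<psi>) \<Longrightarrow> test_function \<Omega> (\<lambda>x. \<phi> x * \<psi> x)"
  by (rule test_function_support, assumption) (auto intro: C_k_mult simp: test_function_def)

lemma test_function_cmult: "test_function \<Omega> \<phi> \<Longrightarrow> test_function \<Omega> (\<lambda>x. c * \<phi> x)"
  by (rule test_function_support, assumption) (auto intro: C_k_cmult simp: test_function_def)

lemma test_function_0 [simp]: "test_function \<Omega> (\<lambda>x. 0)"
  by (simp add: test_function_def)

lemma test_function_sum: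
  "(\<And>i. i \<in> A \<Longrightarrow> test_function \<Omega> (\<phi> i)) \<Longrightarrow> test_function \<Omega> (\<lambda>x. \<Sum>i\<in>A. \<phi> i x)"
  by (induction A rule: infinite_finite_induct) (auto intro: test_function_add)

lemma test_function_mono: "test_function \<Omega> \<phi> \<Longrightarrow> \<Omega> \<subseteq> \<Omega>' \<Longrightarrow> test_function \<Omega>' \<phi>"
  by (auto simp: test_function_def)

lemma test_function_has_derivative:
  "test_function \<Omega> \<phi> \<Longrightarrow> (\<phi> has_derivative (\<lambda>h. gradient \<phi> x \<bullet> h)) (at x)"
  unfolding test_function_def by (metis C_k_Suc_has_derivative)

lemma test_function_continuous: "test_function \<Omega> \<phi> \<Longrightarrow> continuous_on S \<phi>"
  unfolding test_function_def using C_k_imp_continuous continuous_on_subset by blast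

lemma test_function_gradient_continuous: "test_function \<Omega> \<phi> \<Longrightarrow> continuous_on S (gradient \<phi>)"
proof -
  assume "test_function \<Omega> \<phi>"
  then have "C_k 1 \<phi>" unfolding test_function_def by blast
  then have "continuous_on UNIV (gradient \<phi>)"
    using continuous_on_vec_lambda[of UNIV "\<lambda>i x. gradient \<phi> x $ i"] by simp
  then show ?thesis using continuous_on_subset by blast
qed

lemma test_function_eq_0: "test_function \<Omega> \<phi> \<Longrightarrow> x \<notin> \<Omega> \<Longrightarrow> \<phi> x = 0"
  unfolding test_function_def using closure_subset[of "{x. \<phi> x \<noteq> 0}"] by blast

lemma gradient_add:
  "test_function \<Omega> \<phi> \<Longrightarrow> test_function \<Omega> \<psi> \<Longrightarrow> gradient (\<lambda>x. \<phi> x + \<psi> x) x = gradient \<phi> x + gradient \<psi> x"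
  by (intro gradient_eqI) (simp add: inner_left_distrib has_derivative_add[OF test_function_has_derivative test_function_has_derivative])

lemma gradient_cmult:
  "test_function \<Omega> \<phi> \<Longrightarrow> gradient (\<lambda>x. c * \<phi> x) x = c *\<^sub>R gradient \<phi> x"
  by (intro gradient_eqI) (simp add: has_derivative_mult_right test_function_has_derivative)

lemma gradient_mult:
  "test_function \<Omega> \<phi> \<Longrightarrow> test_function \<Omega> \<psi> \<Longrightarrow>
    gradient (\<lambda>x. \<phi> x * \<psi> x) x = \<phi> x *\<^sub>R gradient \<psi> x + \<psi> x *\<^sub>R gradient \<phi> x"
  using has_derivative_mult[OF test_function_has_derivative test_function_has_derivative]
  by (intro gradient_eqI) (simp add: inner_left_distrib mult.commute)

lemma gradient_eq_0:
  assumes "test_function \<Omega> \<phi>" "x \<notin> closure {x. \<phi> x \<noteq> 0}"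
  shows "gradient \<phi> x = 0"
proof (rule gradient_eqI)
  let ?U = "- closure {x. \<phi> x \<noteq> 0}"
  have "((\<lambda>_. 0) has_derivative (\<lambda>h. 0 \<bullet> h)) (at x)" by simp
  then show "(\<phi> has_derivative (\<lambda>h. 0 \<bullet> h)) (at x)"
    by (rule has_derivative_transform_within_open[where s="?U"])
      (use assms(2) closure_subset[of "{x. \<phi> x \<noteq> 0}"] in auto)
qed

lemma gradient_eq_0_outside: "test_function \<Omega> \<phi> \<Longrightarrow> x \<notin> \<Omega> \<Longrightarrow> gradient \<phi> x = 0"
  using gradient_eq_0 unfolding test_function_def by blast

lemma test_function_bounded:
  assumes "test_function \<Omega> \<phi>"
  shows "\<exists>B>0. \<forall>x. \<bar>\<phi> x\<bar> \<le> B \<and> norm (gradient \<phi> x) \<le> B"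
proof -
  let ?K = "closure {x. \<phi> x \<noteq> 0}"
  have K: "compact ?K" using assms by (simp add: test_function_def)
  have "bounded (\<phi> ` ?K)" "bounded (gradient \<phi> ` ?K)"
    using K assms by (simp_all add: compact_continuous_image compact_imp_bounded
      test_function_continuous test_function_gradient_continuous)
  then obtain B1 B2 where B: "\<And>x. x \<in> ?K \<Longrightarrow> norm (\<phi> x) \<le> B1" "\<And>x. x \<in> ?K \<Longrightarrow> norm (gradient \<phi> x) \<le> B2"
    by (auto simp: bounded_iff)
  show ?thesis
  proof (intro exI[of _ "max 1 (max B1 B2)"] conjI allI)
    fix x
    show "\<bar>\<phi> x\<bar> \<le> max 1 (max B1 B2)"
      using B(1)[of x] closure_subset[of "{x. \<phi> x \<noteq> 0}"] by (cases "\<phi> x = 0") force+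
    show "norm (gradient \<phi> x) \<le> max 1 (max B1 B2)"
      using B(2)[of x] gradient_eq_0[OF assms, of x] by (cases "x \<in> ?K") auto
  qed auto
qed

section \<open>Smooth truncation of test functions\<close>

definition clip :: "real \<Rightarrow> real \<Rightarrow> real" where "clip \<eta> s = max 0 (min s \<eta>)"

text \<open>\<open>m * clip \<eta> s\<close> is the difference of the positive parts of
  \<open>m * s\<close> and \<open>m * s - m * \<eta>\<close>; replacing both by softplus gives a
  smooth function. Its derivative is a difference of two values of the increasing function
  \<open>sigmoid\<close>, hence lies between 0 and 1, so gradients do not grow.\<close>

lemma soft_clip:
  assumes \<phi>: "test_function \<Omega> \<phi>" and "\<epsilon> > 0" "\<eta> > 0"
  shows "\<exists>\<psi>. test_function \<Omega> \<psi> \<and> (\<forall>x. norm (gradient \<psi> x) \<le> norm (gradient \<phi> x)) \<and>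
    (\<forall>x. \<bar>\<psi> x - clip \<eta> (\<phi> x)\<bar> \<le> \<epsilon>)"
proof -
  define m where "m = 2 / \<epsilon>"
  have m: "m > 0" using assms by (simp add: m_def)
  \<comment> \<open>Subtracting \<open>c\<close> gives \<open>f 0 = 0\<close>, so the composition
    with \<open>\<phi>\<close> keeps its compact support.\<close>
  define c where "c = softplus 0 - softplus (- m * \<eta>)"
  define f where "f s = (1/m) * (softplus (m * s) - softplus (m * s - m * \<eta>) - c)" for s
  have f0: "f 0 = 0" by (simp add: f_def c_def)
  define f' where "f' s = sigmoid (m * s) - sigmoid (m * s - m * \<eta>)" for s
  have der: "(f has_real_derivative f' s) (at s)" for s
    unfolding f_def f'_def
    by (rule derivative_eq_intros DERIV_chain2[OF DERIV_softplus] refl)+ (use m in \<open>simp add: field_simps\<close>)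
  have f': "\<bar>f' s\<bar> \<le> 1" for s
  proof -
    have "sigmoid (m * s - m * \<eta>) \<le> sigmoid (m * s)" using m assms by (intro sigmoid_mono) simp
    then show ?thesis using sigmoid_bounds[of "m * s"] sigmoid_bounds[of "m * s - m * \<eta>"] by (simp add: f'_def)
  qed
  have close: "\<bar>f s - clip \<eta> s\<bar> \<le> \<epsilon>" for s
  proof -
    have ln2: "ln 2 \<le> (1::real)" using ln_le_minus_one[of 2] by simp
    have "m * clip \<eta> s = max (m * s) 0 - max (m * s - m * \<eta>) 0"
    proof -
      have "m * s \<le> m * \<eta> \<longleftrightarrow> s \<le> \<eta>" "m * s \<le> 0 \<longleftrightarrow> s \<le> 0"
        using m by (auto simp: mult_le_0_iff)
      then show ?thesis using assms m by (auto simp: clip_def max_def min_def)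
    qed
    moreover have "m * f s = softplus (m * s) - softplus (m * s - m * \<eta>) - c"
      using m by (simp add: f_def)
    moreover have "softplus 0 = ln 2" by (simp add: softplus_def)
    moreover have "max (- m * \<eta>) 0 = 0" using assms m by simp
    \<comment> \<open>Both softplus errors and the constant \<open>c\<close> lie between 0 and
      \<open>ln 2\<close>; two of them enter with a minus sign and one with a plus sign, so the
      total is at most \<open>2 * ln 2\<close> in absolute value. This is why \<open>m\<close> is
      \<open>2 / \<epsilon>\<close>.\<close>
    ultimately have "\<bar>m * f s - m * clip \<eta> s\<bar> \<le> 2"
      unfolding c_def
      using softplus_bounds[of "m * s"] softplus_bounds[of "m * s - m * \<eta>"] softplus_bounds[of "- m * \<eta>"] ln2
      by linarith
    then have "\<bar>m\<bar> * \<bar>f s - clip \<eta> s\<bar> \<le> 2"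
      by (simp only: right_diff_distrib flip: abs_mult)
    then have "m * \<bar>f s - clip \<eta> s\<bar> \<le> m * \<epsilon>"
      using m assms(2) by (simp add: m_def)
    then show ?thesis using m by simp
  qed
  show ?thesis
  proof (intro exI[of _ "\<lambda>x. f (\<phi> x)"] conjI allI)
    show "test_function \<Omega> (\<lambda>x. f (\<phi> x))"
    proof (rule test_function_support[OF \<phi>])
      show "C_k k (\<lambda>x. f (\<phi> x))" for k
        unfolding f_def using \<phi>
        by (intro C_k_cmult C_k_diff C_k_softplus C_k_const) (auto simp: test_function_def)
    qed (simp add: f0)
    fix x
    have "gradient (\<lambda>x. f (\<phi> x)) x = f' (\<phi> x) *\<^sub>R gradient \<phi> x"
      using has_derivative_compose[OF test_function_has_derivative[OF \<phi>] der[unfolded has_field_derivative_def]]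
      by (intro gradient_eqI) simp
    then show "norm (gradient (\<lambda>x. f (\<phi> x)) x) \<le> norm (gradient \<phi> x)"
      using f' by (simp add: mult_left_le_one_le)
  qed (rule close)
qed

section \<open>Bump functions and approximation of open sets\<close>

text \<open>
  The family is closed under differentiation, and includes the standard smooth function
  vanishing on the negative half-line as its member with index 0.
\<close>

definition flat_exp :: "nat \<Rightarrow> real \<Rightarrow> real" where
  "flat_exp j t = (if t \<le> 0 then 0 else exp (- inverse t) * inverse t ^ j)"

lemma flat_exp_tendsto_0: "(flat_exp j \<longlongrightarrow> 0) (at_right 0)"
proof -
  have "((\<lambda>t::real. inverse t ^ j / exp (inverse t)) \<longlongrightarrow> 0) (at_right 0)"
    using filterlim_compose[OF tendsto_power_div_exp_0 filterlim_inverse_at_top_right] by simp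
  then show ?thesis
    by (rule Lim_transform_eventually)
      (auto simp: flat_exp_def eventually_at_right_field exp_minus divide_inverse mult.commute intro!: exI[of _ 1])
qed

text \<open>The delicate point is \<open>t = 0\<close>: from the right the difference quotient of
  member \<open>j\<close> is member \<open>Suc j\<close>, which tends to 0, and from the left it
  vanishes.\<close>

lemma DERIV_flat_exp: "(flat_exp j has_real_derivative flat_exp (j + 2) t - j * flat_exp (j + 1) t) (at t)"
proof -
  consider "t < 0" | "t = 0" | "t > 0" by linarith
  then show ?thesis
  proof cases
    case 1
    then have ev: "\<forall>\<^sub>F x in nhds t. flat_exp j x = 0"
      using eventually_nhds_in_open[of "{..<0}" t] by (auto simp: flat_exp_def elim!: eventually_mono)
    have "((\<lambda>_. 0) has_real_derivative flat_exp (j + 2) t - j * flat_exp (j + 1) t) (at t)"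
      using 1 by (simp add: flat_exp_def)
    then show ?thesis using DERIV_cong_ev[OF refl ev refl] by simp
  next
    case 3
    have ev: "\<forall>\<^sub>F x in nhds t. flat_exp j x = exp (- inverse x) * inverse x ^ j"
      using eventually_nhds_in_open[of "{0<..}" t] 3
      by (auto simp: flat_exp_def elim!: eventually_mono)
    have "((\<lambda>x. exp (- inverse x) * inverse x ^ j) has_real_derivative
       flat_exp (j + 2) t - j * flat_exp (j + 1) t) (at t)"
    proof (cases j)
      case 0 then show ?thesis using 3
        by (auto intro!: derivative_eq_intros simp: flat_exp_def power2_eq_square)
    next
      case (Suc l)
      have inv: "(inverse has_real_derivative - (inverse t ^ 2)) (at t)"
        using DERIV_inverse[of t] 3 by (simp add: power2_eq_square)
      have "((\<lambda>x. exp (- inverse x)) has_real_derivative exp (- inverse t) * (- (- (inverse t ^ 2)))) (at t)"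
        by (intro DERIV_fun_exp DERIV_minus inv)
      from DERIV_mult[OF this DERIV_power_Suc[OF inv, of l]] show ?thesis
        using 3 Suc by (simp add: flat_exp_def algebra_simps power2_eq_square)
    qed
    then show ?thesis using DERIV_cong_ev[OF refl ev refl] by simp
  next
    case 2
    have "((\<lambda>h. flat_exp j h / h) \<longlongrightarrow> 0) (at_right 0)"
      by (rule Lim_transform_eventually[OF flat_exp_tendsto_0[of "Suc j"]])
        (auto simp: flat_exp_def eventually_at_right_field field_simps intro!: exI[of _ 1])
    moreover have "((\<lambda>h. flat_exp j h / h) \<longlongrightarrow> 0) (at_left 0)"
      by (rule Lim_transform_eventually[OF tendsto_const])
        (auto simp: flat_exp_def eventually_at_left_field intro!: exI[of _ "-1"])
    ultimately show ?thesis
      unfolding 2 DERIV_def using filterlim_at_split by (auto simp: flat_exp_def)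
  qed
qed

lemma C_k_flat_exp: "C_k k f \<Longrightarrow> C_k k (\<lambda>x. flat_exp j (f x))"
proof (induction k arbitrary: j)
  case 0
  have "continuous_on UNIV (flat_exp j)"
    using DERIV_flat_exp by (meson DERIV_continuous continuous_at_imp_continuous_on)
  with 0 show ?case using continuous_on_compose2[OF _ _ subset_UNIV] by simp
next
  case (Suc k)
  show ?case
    by (rule C_k_Suc_real_compose[OF DERIV_flat_exp Suc.prems])
      (intro C_k_diff C_k_cmult Suc.IH C_k_Suc_imp[OF Suc.prems])
qed

text \<open>A product over the coordinates of two factors each, one vanishing to the left of
  \<open>a $ i\<close> and one to the right of \<open>b $ i\<close>. The support is the closure of
  the open box, hence inside \<open>cbox a b\<close> and inside \<open>U\<close>.\<close>

lemma bump_function: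
  fixes a b :: "real^'n"
  assumes "cbox a b \<subseteq> U"
  shows "\<exists>\<phi>. test_function U \<phi> \<and> (\<forall>x. \<phi> x \<ge> 0) \<and> (\<forall>x. \<phi> x > 0 \<longleftrightarrow> x \<in> box a b)"
proof -
  define \<phi> where "\<phi> x = (\<Prod>i\<in>UNIV. flat_exp 0 (x $ i - a $ i) * flat_exp 0 (b $ i - x $ i))" for x :: "real^'n"
  have fe: "flat_exp 0 t \<ge> 0" "flat_exp 0 t > 0 \<longleftrightarrow> t > 0" for t by (auto simp: flat_exp_def)
  have ge: "\<phi> x \<ge> 0" for x unfolding \<phi>_def by (intro prod_nonneg) (simp add: fe)
  have "\<phi> x \<noteq> 0 \<longleftrightarrow> x \<in> box a b" for x
  proof -
    have "flat_exp 0 t = 0 \<longleftrightarrow> t \<le> 0" for t by (simp add: flat_exp_def)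
    then show ?thesis by (auto simp: \<phi>_def mem_box_cart not_le)
  qed
  then have pos: "\<phi> x > 0 \<longleftrightarrow> x \<in> box a b" for x using ge[of x] by (auto simp: less_le)
  have eq: "{x. \<phi> x \<noteq> 0} = box a b" using pos ge by (auto simp: less_le)
  have sub: "closure (box a b) \<subseteq> cbox a b" by (rule closure_minimal[OF box_subset_cbox closed_cbox])
  have "test_function U \<phi>"
    unfolding test_function_def eq
  proof (intro conjI allI)
    show "compact (closure (box a b))" by (simp add: bounded_box)
    show "C_k k \<phi>" for k
      unfolding \<phi>_def by (intro C_k_prod C_k_mult C_k_flat_exp C_k_diff C_k_component C_k_const)
  qed (use sub assms in auto)
  with ge pos show ?thesis by (intro exI[of _ \<phi>]) simp
qed

text \<open>Countably many boxes cover \<open>U\<close>. With \<open>S n\<close> the sum of the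
  first \<open>n\<close> bumps, \<open>1 - exp (- n * S n)\<close> stays in the unit interval and
  vanishes where \<open>S n\<close> does. At a point of \<open>U\<close> some bump is positive, and
  the factor \<open>n\<close> drives the exponential to 0.\<close>

lemma open_set_approx:
  fixes U :: "(real^'n) set"
  assumes "open U"
  shows "\<exists>w. (\<forall>n. test_function U (w n)) \<and> (\<forall>n x. 0 \<le> w n x \<and> w n x \<le> 1) \<and>
    (\<forall>x. (\<lambda>n::nat. w n x) \<longlonglongrightarrow> indicator U x)"
proof -
  define \<F> where "\<F> = {box a b | a b :: real^'n. cbox a b \<subseteq> U}"
  obtain \<F>' where \<F>': "\<F>' \<subseteq> \<F>" "countable \<F>'" "\<Union>\<F>' = \<Union>\<F>"
    by (rule Lindelof[of \<F>]) (auto simp: \<F>_def)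
  have "\<Union>\<F> = U"
  proof
    show "\<Union>\<F> \<subseteq> U" using box_subset_cbox by (fastforce simp: \<F>_def)
    show "U \<subseteq> \<Union>\<F>"
    proof
      fix x assume "x \<in> U"
      then obtain a b where "cbox a b \<subseteq> U" "x \<in> box a b"
        using open_contains_cbox[OF assms] by metis
      then show "x \<in> \<Union>\<F>" by (auto simp: \<F>_def)
    qed
  qed
  then have U: "\<Union>\<F>' = U" using \<F>' by simp
  \<comment> \<open>Inserting the empty set makes the family nonempty, so that its enumeration has
    exactly this range; an index with empty box receives the zero function.\<close>
  let ?B = "from_nat_into (insert {} \<F>')"
  have range: "range ?B = insert {} \<F>'" using \<F>' by (intro range_from_nat_into) auto
  have "\<exists>\<phi>. test_function U \<phi> \<and> (\<forall>x. \<phi> x \<ge> 0) \<and> (\<forall>x. \<phi> x > 0 \<longleftrightarrow> x \<in> ?B j)" for j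
  proof (cases "?B j = {}")
    case True then show ?thesis by (intro exI[of _ "\<lambda>_. 0"]) simp
  next
    case False
    then have "?B j \<in> \<F>" using range \<F>' by blast
    then obtain a b where ab: "?B j = box a b" "cbox a b \<subseteq> U" by (auto simp: \<F>_def)
    from bump_function[OF ab(2)] show ?thesis by (simp add: ab(1))
  qed
  then obtain \<phi> where \<phi>: "\<And>j. test_function U (\<phi> j)" "\<And>j x. \<phi> j x \<ge> 0" "\<And>j x. \<phi> j x > 0 \<longleftrightarrow> x \<in> ?B j"
    by metis
  define S where "S n x = (\<Sum>j<n. \<phi> j x)" for n x
  define w where "w n x = 1 - exp (- real n * S n x)" for n x
  have S: "test_function U (S n)" "S n x \<ge> 0" for n x
    unfolding S_def using \<phi> by (auto intro: test_function_sum sum_nonneg)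
  show ?thesis
  proof (intro exI[of _ w] conjI allI)
    show "test_function U (w n)" for n
      using S(1)[of n] unfolding w_def
      by (intro test_function_support[OF S(1)] C_k_diff C_k_exp C_k_cmult C_k_const) (auto simp: test_function_def)
    show "0 \<le> w n x" "w n x \<le> 1" for n x using S(2)[of n x] by (simp_all add: w_def)
    show "(\<lambda>n. w n x) \<longlonglongrightarrow> indicator U x" for x
    proof (cases "x \<in> U")
      case False
      then have "w n x = 0" for n using S(1) test_function_eq_0 by (fastforce simp: w_def)
      then show ?thesis using False by simp
    next
      case True
      then obtain j where j: "x \<in> ?B j" using U range by (metis UnionE imageE insertCI rangeI)
      have le: "\<phi> j x \<le> S n x" if "n > j" for n
        unfolding S_def using that \<phi>(2) by (intro member_le_sum) auto
      have pos: "\<phi> j x > 0" using j \<phi>(3) by simp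
      have "(\<lambda>n. exp (- real n * \<phi> j x)) \<longlonglongrightarrow> 0"
        using pos by real_asymp
      moreover have "\<forall>\<^sub>F n in sequentially. norm (exp (- real n * S n x)) \<le> exp (- real n * \<phi> j x)"
        using eventually_gt_at_top[of j] by eventually_elim (simp add: le mult_left_mono)
      ultimately have "(\<lambda>n. exp (- real n * S n x)) \<longlonglongrightarrow> 0"
        by (rule Lim_null_comparison[rotated])
      then have "(\<lambda>n. w n x) \<longlonglongrightarrow> 1 - 0"
        unfolding w_def by (intro tendsto_diff tendsto_const)
      with True show ?thesis by simp
    qed
  qed
qed

section \<open>The fundamental lemma of the calculus of variations\<close>

lemma continuous_measurable_lebesgue_on:
  fixes f :: "'a::euclidean_space \<Rightarrow> 'b::topological_space"
  assumes "continuous_on UNIV f"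
  shows "f \<in> borel_measurable (lebesgue_on \<Omega>)"
  using borel_measurable_continuous_onI[OF assms]
  by (intro measurable_restrict_space1 measurable_completion) simp

lemma test_function_measurable:
  "test_function U \<phi> \<Longrightarrow> \<phi> \<in> borel_measurable (lebesgue_on \<Omega>)"
  "test_function U \<phi> \<Longrightarrow> gradient \<phi> \<in> borel_measurable (lebesgue_on \<Omega>)"
  by (simp_all add: continuous_measurable_lebesgue_on test_function_continuous test_function_gradient_continuous)

lemma LIMSEQ_nonneg: "X \<longlonglongrightarrow> L \<Longrightarrow> (\<And>n. 0 \<le> X n) \<Longrightarrow> 0 \<le> (L :: real)"
  using LIMSEQ_le_const by blast

text \<open>Nonnegative test functions are exchanged for indicators, in three stages: open sets by
  \<open>open_set_approx\<close> and dominated convergence, \<open>G_delta\<close> sets as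
  decreasing limits of open ones, and measurable sets up to null sets. On the set where
  \<open>h\<close> is negative the integral of \<open>h\<close> is then both nonnegative and
  nonpositive.\<close>

lemma fundamental_nonneg:
  fixes \<Omega> :: "(real^'n) set"
  assumes "open \<Omega>" and h: "integrable (lebesgue_on \<Omega>) h"
    and test: "\<And>v. test_function \<Omega> v \<Longrightarrow> (\<And>x. 0 \<le> v x) \<Longrightarrow> 0 \<le> (LINT x|lebesgue_on \<Omega>. h x * v x)"
  shows "AE x in lebesgue_on \<Omega>. 0 \<le> (h x :: real)"
proof -
  let ?M = "lebesgue_on \<Omega>"
  have \<Omega>: "\<Omega> \<in> sets lebesgue" using assms(1) by auto
  have [measurable]: "h \<in> borel_measurable ?M" using h by auto
  have ind[measurable]: "indicator U \<in> borel_measurable ?M" if "U \<in> sets lebesgue" for U :: "(real^'n) set"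
    using that by (intro measurable_restrict_space1) simp
  have open_nonneg: "0 \<le> (LINT x|?M. h x * indicator U x)" if U: "open U" "U \<subseteq> \<Omega>" for U
  proof -
    obtain w where w: "\<And>n. test_function U (w n)" "\<And>n x. 0 \<le> w n x" "\<And>n x. w n x \<le> 1"
      "\<And>x. (\<lambda>n::nat. w n x) \<longlonglongrightarrow> indicator U x"
      using open_set_approx[OF U(1)] by metis
    have meas[measurable]: "w n \<in> borel_measurable ?M" for n
      using w(1) by (rule test_function_measurable)
    have "(\<lambda>n. LINT x|?M. h x * w n x) \<longlonglongrightarrow> (LINT x|?M. h x * indicator U x)"
    proof (rule integral_dominated_convergence[where w="\<lambda>x. \<bar>h x\<bar>"])
      show "(\<lambda>x. h x * indicator U x) \<in> borel_measurable ?M"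
        using U(1) by (intro borel_measurable_times ind) auto
      show "AE x in ?M. (\<lambda>n. h x * w n x) \<longlonglongrightarrow> h x * indicator U x"
        using w(4) by (intro AE_I2 tendsto_mult tendsto_const)
      show "AE x in ?M. norm (h x * w n x) \<le> \<bar>h x\<bar>" for n
        using w(2,3) by (intro AE_I2) (simp add: abs_mult mult_left_le)
    qed (use h in auto)
    moreover have "0 \<le> (LINT x|?M. h x * w n x)" for n
      using test_function_mono[OF w(1) U(2)] w(2) by (rule test)
    ultimately show ?thesis by (rule LIMSEQ_nonneg)
  qed
  define A where "A = {x\<in>\<Omega>. h x < 0}"
  have "A = {x\<in>space ?M. h x < 0}" by (simp add: A_def)
  also have "\<dots> \<in> sets ?M" by measurable
  finally have A: "A \<in> sets lebesgue" using \<Omega> by (simp add: sets_restrict_space_iff)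
  obtain C T where C: "gdelta C" "T \<in> null_sets lebesgue" "A \<union> T = C" "disjnt A T"
    using lebesgue_set_almost_gdelta[OF A] .
  from C(1) have "\<exists>F::nat \<Rightarrow> _. (\<forall>n. open (F n)) \<and> C = \<Inter>(range F)"
    by cases blast
  then obtain F :: "nat \<Rightarrow> _" where F: "\<And>n. open (F n)" "C = \<Inter>(range F)"
    by metis
  \<comment> \<open>Finite intersections form a decreasing sequence of open subsets of
    \<open>\<Omega>\<close>, so the indicators converge pointwise to that of
    \<open>\<Omega> \<inter> C\<close>.\<close>
  define V where "V n = \<Omega> \<inter> (\<Inter>k\<le>n. F k)" for n
  have V: "open (V n)" "V n \<subseteq> \<Omega>" for n
    using F(1) assms(1) by (auto simp: V_def intro!: open_Int open_INT)
  have lim: "(\<lambda>n. indicator (V n) x :: real) \<longlonglongrightarrow> indicator (\<Omega> \<inter> C) x" for x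
  proof (cases "x \<in> \<Omega> \<inter> C")
    case True
    then have "x \<in> V n" for n by (auto simp: V_def F)
    with True show ?thesis by simp
  next
    case False
    then obtain k where "x \<notin> \<Omega> \<or> x \<notin> F k" by (auto simp: F)
    then have "x \<notin> V n" if "n \<ge> k" for n using that by (auto simp: V_def)
    then have "\<forall>\<^sub>F n in sequentially. indicator (V n) x = (0::real)"
      by (auto simp: eventually_sequentially intro!: exI[of _ k])
    with False show ?thesis by (simp add: tendsto_eventually)
  qed
  have [measurable]: "C \<in> sets lebesgue" using F by (auto intro!: sets.countable_INT')
  have "(\<lambda>n. LINT x|?M. h x * indicator (V n) x) \<longlonglongrightarrow> (LINT x|?M. h x * indicator (\<Omega> \<inter> C) x)"
  proof (rule integral_dominated_convergence[where w="\<lambda>x. \<bar>h x\<bar>"])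
    show "AE x in ?M. (\<lambda>n. h x * indicator (V n) x) \<longlonglongrightarrow> h x * indicator (\<Omega> \<inter> C) x"
      using lim by (intro AE_I2 tendsto_mult tendsto_const)
    show "AE x in ?M. norm (h x * indicator (V n) x) \<le> \<bar>h x\<bar>" for n
      by (intro AE_I2) (simp add: indicator_def)
    show "(\<lambda>x. h x * indicator (\<Omega> \<inter> C) x) \<in> borel_measurable ?M"
      using \<Omega> by (intro borel_measurable_times ind) auto
    show "(\<lambda>x. h x * indicator (V n) x) \<in> borel_measurable ?M" for n
      using V(1)[of n] by (intro borel_measurable_times ind) auto
  qed (use h in auto)
  then have "0 \<le> (LINT x|?M. h x * indicator (\<Omega> \<inter> C) x)"
    using open_nonneg[OF V] by (rule LIMSEQ_nonneg)
  also have "\<dots> = (LINT x|?M. h x * indicator A x)"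
  proof (rule integral_cong_AE)
    have "AE x in lebesgue. x \<notin> T" using C(2) by (rule AE_not_in)
    then have "AE x in ?M. x \<notin> T" using \<Omega> by (auto simp: AE_restrict_space_iff elim: eventually_mono)
    then show "AE x in ?M. h x * indicator (\<Omega> \<inter> C) x = h x * indicator A x"
      using AE_space by eventually_elim (use C(3) in \<open>auto simp: indicator_def A_def\<close>)
    show "(\<lambda>x. h x * indicator (\<Omega> \<inter> C) x) \<in> borel_measurable ?M"
      using \<Omega> by (intro borel_measurable_times ind) auto
    show "(\<lambda>x. h x * indicator A x) \<in> borel_measurable ?M"
      using A by (intro borel_measurable_times ind) auto
  qed
  finally have ge: "0 \<le> (LINT x|?M. h x * indicator A x)" .
  have int: "integrable ?M (\<lambda>x. - (h x * indicator A x))"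
    using A by (intro integrable_minus Bochner_Integration.integrable_bound[OF h] borel_measurable_times ind)
      (auto simp: indicator_def)
  have nn: "AE x in ?M. 0 \<le> - (h x * indicator A x)"
    by (intro AE_I2) (auto simp: A_def indicator_def)
  have "(LINT x|?M. - (h x * indicator A x)) = 0"
    using integral_nonneg_AE[OF nn] ge by simp
  then have "AE x in ?M. - (h x * indicator A x) = 0"
    using integral_nonneg_eq_0_iff_AE[OF int nn] by simp
  then show ?thesis
    using AE_space by eventually_elim (auto simp: A_def indicator_def split: if_splits)
qed

lemma fundamental_eq_0:
  fixes \<Omega> :: "(real^'n) set"
  assumes "open \<Omega>" and h: "integrable (lebesgue_on \<Omega>) h"
    and "\<And>v. test_function \<Omega> v \<Longrightarrow> (LINT x|lebesgue_on \<Omega>. h x * v x) = 0"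
  shows "AE x in lebesgue_on \<Omega>. h x = (0::real)"
proof -
  have "AE x in lebesgue_on \<Omega>. 0 \<le> h x" "AE x in lebesgue_on \<Omega>. 0 \<le> - h x"
    using assms by (intro fundamental_nonneg; simp)+
  then show ?thesis by eventually_elim simp
qed

section \<open>Square integrable functions\<close>

text \<open>The measure is arbitrary, and the values are euclidean so that the same lemmas serve
  functions and their gradients.\<close>

definition L2 :: "'a measure \<Rightarrow> ('a \<Rightarrow> 'b::euclidean_space) \<Rightarrow> bool" where
  "L2 M f \<longleftrightarrow> f \<in> borel_measurable M \<and> integrable M (\<lambda>x. (norm (f x))\<^sup>2)"

lemma square_integrable_iff_L2: "square_integrable \<Omega> f \<longleftrightarrow> L2 (lebesgue_on \<Omega>) f"
  by (simp add: square_integrable_def L2_def)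

lemma L2_measurable: "L2 M f \<Longrightarrow> f \<in> borel_measurable M"
  and L2_integrable_square: "L2 M f \<Longrightarrow> integrable M (\<lambda>x. (norm (f x))\<^sup>2)"
  by (simp_all add: L2_def)

lemma norm_add_square_le:
  fixes a b :: "'a::real_normed_vector"
  shows "(norm (a + b))\<^sup>2 \<le> 2 * (norm a)\<^sup>2 + 2 * (norm b)\<^sup>2"
proof -
  have "(norm (a + b))\<^sup>2 \<le> (norm a + norm b)\<^sup>2"
    by (simp add: norm_triangle_ineq power_mono)
  also have "\<dots> \<le> 2 * (norm a)\<^sup>2 + 2 * (norm b)\<^sup>2"
    using sum_squares_bound[of "norm a" "norm b"] by (simp add: power2_sum)
  finally show ?thesis .
qed

text \<open>On a finite measure this turns square integrability into integrability, and an
  \<open>L^2\<close> bound for a gradient into an \<open>L^1\<close> bound.\<close>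

lemma norm_le_one_plus_square:
  fixes a :: "'a::real_normed_vector"
  shows "norm a \<le> 1 + (norm a)\<^sup>2"
proof -
  have "2 * norm a \<le> 1 + (norm a)\<^sup>2" using sum_squares_bound[of 1 "norm a"] by simp
  then show ?thesis using norm_ge_zero[of a] by linarith
qed

lemma L2_add: "L2 M f \<Longrightarrow> L2 M g \<Longrightarrow> L2 M (\<lambda>x. f x + g x)"
  unfolding L2_def
proof (elim conjE, intro conjI)
  assume [measurable]: "f \<in> borel_measurable M" "g \<in> borel_measurable M"
    and int: "integrable M (\<lambda>x. (norm (f x))\<^sup>2)" "integrable M (\<lambda>x. (norm (g x))\<^sup>2)"
  show "(\<lambda>x. f x + g x) \<in> borel_measurable M" by measurable
  show "integrable M (\<lambda>x. (norm (f x + g x))\<^sup>2)"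
  proof (rule Bochner_Integration.integrable_bound)
    show "integrable M (\<lambda>x. 2 * (norm (f x))\<^sup>2 + 2 * (norm (g x))\<^sup>2)" using int by simp
    show "AE x in M. norm ((norm (f x + g x))\<^sup>2) \<le> norm (2 * (norm (f x))\<^sup>2 + 2 * (norm (g x))\<^sup>2)"
      using norm_add_square_le by (intro AE_I2) auto
  qed measurable
qed

lemma L2_scaleR: "L2 M f \<Longrightarrow> L2 M (\<lambda>x. c *\<^sub>R f x)"
  by (auto simp: L2_def power_mult_distrib)

lemma L2_cmult: "L2 M f \<Longrightarrow> L2 M (\<lambda>x. c * (f x :: real))"
  using L2_scaleR[of M f c] by simp

lemma L2_diff: "L2 M f \<Longrightarrow> L2 M g \<Longrightarrow> L2 M (\<lambda>x. f x - g x)"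
  using L2_add[OF _ L2_scaleR[where c="-1"]] by fastforce

lemma L2_integrable_inner:
  assumes "L2 M f" "L2 M g"
  shows "integrable M (\<lambda>x. f x \<bullet> g x)"
proof (rule Bochner_Integration.integrable_bound[where f="\<lambda>x. (norm (f x))\<^sup>2 + (norm (g x))\<^sup>2"])
  show "AE x in M. norm (f x \<bullet> g x) \<le> norm ((norm (f x))\<^sup>2 + (norm (g x))\<^sup>2)"
  proof (intro AE_I2)
    fix x
    have "\<bar>f x \<bullet> g x\<bar> \<le> norm (f x) * norm (g x)" by (rule Cauchy_Schwarz_ineq2)
    also have "\<dots> \<le> (norm (f x))\<^sup>2 + (norm (g x))\<^sup>2"
      using sum_squares_bound[of "norm (f x)" "norm (g x)"]
        mult_nonneg_nonneg[OF norm_ge_zero[of "f x"] norm_ge_zero[of "g x"]]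
      unfolding mult.assoc by linarith
    finally show "norm (f x \<bullet> g x) \<le> norm ((norm (f x))\<^sup>2 + (norm (g x))\<^sup>2)" by simp
  qed
qed (use assms in \<open>auto simp: L2_def\<close>)

lemma L2_integrable_mult: "L2 M f \<Longrightarrow> L2 M g \<Longrightarrow> integrable M (\<lambda>x. f x * (g x :: real))"
  using L2_integrable_inner[of M f g] by simp

lemma L2_norm: "L2 M f \<Longrightarrow> L2 M (\<lambda>x. norm (f x))"
  by (auto simp: L2_def)

lemma L2_inner_const: "L2 M f \<Longrightarrow> L2 M (\<lambda>x. f x \<bullet> c)"
  unfolding L2_def
proof (intro conjI)
  assume f: "f \<in> borel_measurable M \<and> integrable M (\<lambda>x. (norm (f x))\<^sup>2)"
  then show m: "(\<lambda>x. f x \<bullet> c) \<in> borel_measurable M" by (intro borel_measurable_inner) auto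
  show "integrable M (\<lambda>x. (norm (f x \<bullet> c))\<^sup>2)"
  proof (rule Bochner_Integration.integrable_bound)
    show "integrable M (\<lambda>x. (norm (f x))\<^sup>2 * (norm c)\<^sup>2)" using f by simp
    have "(norm (f x \<bullet> c))\<^sup>2 \<le> (norm (f x) * norm c)\<^sup>2" for x
      using Cauchy_Schwarz_ineq2[of "f x" c] by (intro power_mono) auto
    then show "AE x in M. norm ((norm (f x \<bullet> c))\<^sup>2) \<le> norm ((norm (f x))\<^sup>2 * (norm c)\<^sup>2)"
      by (intro AE_I2) (simp add: power_mult_distrib)
  qed (use m in measurable)
qed

lemma L2_norm_square_add:
  assumes "L2 M f" "L2 M g"
  shows "(LINT x|M. (norm (f x + t *\<^sub>R g x))\<^sup>2) =
    (LINT x|M. (norm (f x))\<^sup>2) + 2 * t * (LINT x|M. f x \<bullet> g x) + t\<^sup>2 * (LINT x|M. (norm (g x))\<^sup>2)"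
proof -
  have "(norm (f x + t *\<^sub>R g x))\<^sup>2 = (norm (f x))\<^sup>2 + (2 * t * (f x \<bullet> g x) + t\<^sup>2 * (norm (g x))\<^sup>2)" for x
    unfolding power2_norm_eq_inner
    by (simp add: inner_add_left inner_add_right inner_commute[of "g x" "f x"] algebra_simps power2_eq_square)
  then show ?thesis
    using assms L2_integrable_inner[OF assms] by (simp add: L2_def)
qed

text \<open>The square norm of \<open>f + t * g\<close> is a quadratic polynomial in
  \<open>t\<close> that is nowhere negative; evaluating it at its minimum \<open>- b / c\<close>
  gives the inequality.\<close>

lemma L2_Cauchy_Schwarz:
  assumes "L2 M f" "L2 M g"
  shows "(LINT x|M. f x \<bullet> g x)\<^sup>2 \<le> (LINT x|M. (norm (f x))\<^sup>2) * (LINT x|M. (norm (g x))\<^sup>2)"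
proof -
  define a b c where "a = (LINT x|M. (norm (f x))\<^sup>2)" and "b = (LINT x|M. f x \<bullet> g x)"
    and "c = (LINT x|M. (norm (g x))\<^sup>2)"
  have ge: "0 \<le> a + 2 * t * b + t\<^sup>2 * c" for t
    unfolding a_def b_def c_def L2_norm_square_add[OF assms, symmetric] by simp
  have "c \<ge> 0" by (simp add: c_def)
  show ?thesis
  proof (cases "c = 0")
    case True
    have "b = 0"
    proof (rule ccontr)
      assume "b \<noteq> 0"
      \<comment> \<open>Without a quadratic term the polynomial is affine, and this value of
        \<open>t\<close> makes it equal to \<open>-1\<close>.\<close>
      then show False using ge[of "- (a + 1) / (2 * b)"] True by (simp add: field_simps)
    qed
    then show ?thesis using True by (simp flip: a_def b_def c_def)
  next
    case False
    with \<open>c \<ge> 0\<close> have "c > 0" by simp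
    have "b\<^sup>2 / c \<le> a" using ge[of "- b / c"] \<open>c > 0\<close> by (simp add: field_simps power2_eq_square)
    then show ?thesis using \<open>c > 0\<close> by (simp add: field_simps flip: a_def b_def c_def)
  qed
qed

lemma L2_tendsto_inner:
  assumes "\<And>k. L2 M (f k)" "L2 M g" "L2 M h"
    "(\<lambda>k. LINT x|M. (norm (f k x - g x))\<^sup>2) \<longlonglongrightarrow> 0"
  shows "(\<lambda>k. LINT x|M. f k x \<bullet> h x) \<longlonglongrightarrow> (LINT x|M. g x \<bullet> h x)"
proof -
  have "(\<lambda>k. sqrt ((LINT x|M. (norm (f k x - g x))\<^sup>2) * (LINT x|M. (norm (h x))\<^sup>2)))
     \<longlonglongrightarrow> sqrt (0 * (LINT x|M. (norm (h x))\<^sup>2))"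
    by (intro tendsto_intros assms)
  moreover have "\<bar>(LINT x|M. f k x \<bullet> h x) - (LINT x|M. g x \<bullet> h x)\<bar>
      \<le> sqrt ((LINT x|M. (norm (f k x - g x))\<^sup>2) * (LINT x|M. (norm (h x))\<^sup>2))" for k
  proof -
    have "(LINT x|M. f k x \<bullet> h x) - (LINT x|M. g x \<bullet> h x) = (LINT x|M. (f k x - g x) \<bullet> h x)"
      using assms by (simp add: inner_diff_left L2_integrable_inner)
    moreover have "\<bar>LINT x|M. (f k x - g x) \<bullet> h x\<bar> \<le>
        sqrt ((LINT x|M. (norm (f k x - g x))\<^sup>2) * (LINT x|M. (norm (h x))\<^sup>2))"
      using L2_Cauchy_Schwarz[OF L2_diff[OF assms(1,2)] assms(3), of k]
      by (intro real_le_rsqrt) (simp only: power2_abs)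
    ultimately show ?thesis by simp
  qed
  ultimately have "(\<lambda>k. (LINT x|M. f k x \<bullet> h x) - (LINT x|M. g x \<bullet> h x)) \<longlonglongrightarrow> 0"
    using Lim_null_comparison[OF always_eventually]
    by (metis (no_types, lifting) mult_zero_left real_norm_def real_sqrt_zero)
  then show ?thesis by (simp add: LIM_zero_iff)
qed

text \<open>The square norm of \<open>f k\<close> is that of \<open>f k - g\<close>, plus twice the
  inner product of \<open>f k\<close> with \<open>g\<close>, minus the square norm of
  \<open>g\<close>; each term has a known limit.\<close>

lemma L2_tendsto_norm_square:
  assumes "\<And>k. L2 M (f k)" "L2 M g" "(\<lambda>k. LINT x|M. (norm (f k x - g x))\<^sup>2) \<longlonglongrightarrow> 0"
  shows "(\<lambda>k. LINT x|M. (norm (f k x))\<^sup>2) \<longlonglongrightarrow> (LINT x|M. (norm (g x))\<^sup>2)"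
proof -
  have "(LINT x|M. (norm (f k x))\<^sup>2) = (LINT x|M. (norm (f k x - g x))\<^sup>2)
     + 2 * (LINT x|M. f k x \<bullet> g x) - (LINT x|M. (norm (g x))\<^sup>2)" for k
    using L2_norm_square_add[OF assms(1)[of k] assms(2), of "-1"] by simp
  moreover have "(\<lambda>k. (LINT x|M. (norm (f k x - g x))\<^sup>2)
     + 2 * (LINT x|M. f k x \<bullet> g x) - (LINT x|M. (norm (g x))\<^sup>2))
     \<longlonglongrightarrow> 0 + 2 * (LINT x|M. g x \<bullet> g x) - (LINT x|M. (norm (g x))\<^sup>2)"
    by (intro tendsto_intros assms L2_tendsto_inner)
  ultimately show ?thesis by (simp add: power2_norm_eq_inner)
qed

lemma (in finite_measure) L2_bounded:
  fixes f :: "'a \<Rightarrow> 'b::euclidean_space"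
  assumes [measurable]: "f \<in> borel_measurable M" and B: "AE x in M. norm (f x) \<le> B"
  shows "L2 M f"
  unfolding L2_def
proof (intro conjI integrable_const_bound)
  show "AE x in M. norm ((norm (f x))\<^sup>2) \<le> B\<^sup>2"
    using B by eventually_elim (simp add: power_mono)
qed measurable

lemma (in finite_measure) L2_integrable:
  assumes "L2 M f"
  shows "integrable M f"
proof (rule Bochner_Integration.integrable_bound)
  show "integrable M (\<lambda>x. 1 + (norm (f x))\<^sup>2)" using assms by (simp add: L2_def)
  show "AE x in M. norm (f x) \<le> norm (1 + (norm (f x))\<^sup>2)"
    by (rule AE_I2) (rule order_trans[OF norm_le_one_plus_square], simp)
qed (use assms in \<open>simp add: L2_def\<close>)

lemma (in finite_measure) L2_tendsto_L1:
  fixes g :: "'a \<Rightarrow> 'b::euclidean_space"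
  assumes "\<And>k. L2 M (f k)" "L2 M g" "(\<lambda>k. LINT x|M. (norm (f k x - g x))\<^sup>2) \<longlonglongrightarrow> 0"
  shows "(\<lambda>k. LINT x|M. norm (f k x - g x)) \<longlonglongrightarrow> 0"
proof -
  have "L2 M (\<lambda>x. 1::real)" by (rule L2_bounded[where B=1]) simp_all
  then have "(\<lambda>k. LINT x|M. norm (f k x - g x) \<bullet> 1) \<longlonglongrightarrow> (LINT x|M. 0 \<bullet> (1::real))"
    using assms by (intro L2_tendsto_inner L2_norm L2_diff) (simp_all add: L2_def)
  then show ?thesis by simp
qed

section \<open>Completeness of the square integrable functions\<close>

lemma summable_weighted_square:
  assumes "(\<Sum>j. ennreal (4 ^ j * (a j)\<^sup>2)) \<noteq> top" "\<And>j. 0 \<le> a j"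
  shows "summable (a :: nat \<Rightarrow> real)"
proof -
  have "summable (\<lambda>j. 4 ^ j * (a j)\<^sup>2)"
    using assms(1) by (intro summable_suminf_not_top) simp_all
  then have "Bseq (\<lambda>j. 4 ^ j * (a j)\<^sup>2)"
    by (intro convergent_imp_Bseq summable_LIMSEQ_zero[THEN convergentI])
  then obtain B where B: "B > 0" "\<And>j. norm (4 ^ j * (a j)\<^sup>2) \<le> B" by (rule BseqE) blast
  have le: "a j \<le> sqrt B * (1/2) ^ j" for j
  proof -
    have "(2 ^ j * a j)\<^sup>2 = 4 ^ j * (a j)\<^sup>2"
      by (simp add: power_mult_distrib power2_eq_square flip: power_mult_distrib[of "2::real" 2 j])
    then have "(2 ^ j * a j)\<^sup>2 \<le> B" using B(2)[of j] by simp
    then have "2 ^ j * a j \<le> sqrt B" by (rule real_le_rsqrt)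
    then show ?thesis by (simp add: power_one_over field_simps)
  qed
  show ?thesis
  proof (rule summable_comparison_test')
    show "summable (\<lambda>j. sqrt B * (1/2) ^ j)"
      by (intro summable_mult summable_geometric) simp
    show "norm (a j) \<le> sqrt B * (1/2) ^ j" if "j \<ge> 0" for j using le assms(2)[of j] by simp
  qed
qed

text \<open>With weights \<open>4 ^ j\<close> the integrals of the squared increments are still
  dominated by \<open>(1/2) ^ j\<close>, so the weighted sum of squares is finite almost everywhere.
  Its terms are then bounded, the increments decay like \<open>(1/2) ^ j\<close>, and the
  telescoping sum converges. The argument is independent of the total measure.\<close>

lemma L2_subsequence_converges_AE:
  fixes f :: "nat \<Rightarrow> 'a \<Rightarrow> 'b::euclidean_space"
  assumes L2: "\<And>k. L2 M (f k)" and small: "\<And>j. (LINT x|M. (norm (f (Suc j) x - f j x))\<^sup>2) \<le> (1/8) ^ j"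
  shows "AE x in M. convergent (\<lambda>j. f j x)"
proof -
  define d where "d j x = f (Suc j) x - f j x" for j x
  have d: "L2 M (d j)" for j unfolding d_def by (intro L2_diff L2)
  have [measurable]: "d j \<in> borel_measurable M" for j by (rule L2_measurable[OF d])
  let ?Z = "\<lambda>x. \<Sum>j. ennreal (4 ^ j * (norm (d j x))\<^sup>2)"
  have "(\<integral>\<^sup>+x. ?Z x \<partial>M) = (\<Sum>j. \<integral>\<^sup>+x. ennreal (4 ^ j * (norm (d j x))\<^sup>2) \<partial>M)"
    by (rule nn_integral_suminf) measurable
  also have "\<dots> \<le> (\<Sum>j. ennreal ((1/2) ^ j))"
  proof (rule suminf_le)
    fix j
    have "(\<integral>\<^sup>+x. ennreal (4 ^ j * (norm (d j x))\<^sup>2) \<partial>M) = ennreal (LINT x|M. 4 ^ j * (norm (d j x))\<^sup>2)"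
      using L2_integrable_square[OF d] by (intro nn_integral_eq_integral) simp_all
    also have "\<dots> \<le> ennreal ((1/2) ^ j)"
    proof (rule ennreal_leI)
      have "(LINT x|M. 4 ^ j * (norm (d j x))\<^sup>2) \<le> 4 ^ j * (1/8) ^ j"
        using small[of j] by (simp add: d_def)
      also have "\<dots> = (1/2) ^ j" by (simp flip: power_mult_distrib)
      finally show "(LINT x|M. 4 ^ j * (norm (d j x))\<^sup>2) \<le> (1/2) ^ j" .
    qed
    finally show "(\<integral>\<^sup>+x. ennreal (4 ^ j * (norm (d j x))\<^sup>2) \<partial>M) \<le> ennreal ((1/2) ^ j)" .
  qed simp_all
  also have "\<dots> < \<infinity>"
    using summable_geometric[of "1/2::real"] by (simp add: suminf_ennreal2)
  finally have fin: "(\<integral>\<^sup>+x. ?Z x \<partial>M) \<noteq> \<infinity>" by simp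
  have "?Z \<in> borel_measurable M" by measurable
  then have "AE x in M. ?Z x \<noteq> \<infinity>" using fin by (rule nn_integral_PInf_AE)
  then show ?thesis
  proof (rule eventually_mono)
    fix x assume fin: "?Z x \<noteq> \<infinity>"
    have "summable (\<lambda>j. norm (d j x))"
      using fin by (intro summable_weighted_square) (simp_all add: infinity_ennreal_def)
    then have "summable (\<lambda>j. d j x)" by (rule summable_norm_cancel)
    then have "convergent (\<lambda>n. \<Sum>j<n. d j x)" by (simp add: summable_iff_convergent)
    then have "convergent (\<lambda>n. (\<Sum>j<n. d j x) + f 0 x)" by (intro convergent_add convergent_const)
    moreover have "(\<Sum>j<n. d j x) + f 0 x = f n x" for n
      by (simp add: d_def sum_lessThan_telescope[of "\<lambda>j. f j x"])
    ultimately show "convergent (\<lambda>j. f j x)" by simp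
  qed
qed

lemma strict_mono_above:
  fixes N :: "nat \<Rightarrow> nat"
  obtains r where "strict_mono r" "\<And>j. N j \<le> r j"
proof -
  have "\<exists>r. \<forall>j. N j \<le> r j \<and> r j < r (Suc j)"
  proof (rule dependent_nat_choice)
    show "\<exists>y\<ge>N (Suc j). x < y" if "N j \<le> x" for x j
      by (intro exI[of _ "max (N (Suc j)) (Suc x)"]) simp
  qed auto
  then obtain r where r: "\<forall>j. N j \<le> r j \<and> r j < r (Suc j)" by blast
  show ?thesis by (rule that[of r]) (use r in \<open>simp_all add: strict_mono_Suc_iff\<close>)
qed

text \<open>Riesz-Fischer: a fast subsequence converges almost everywhere, and Fatou's lemma along
  it transfers the Cauchy estimate of the full sequence to the distance from the limit.\<close>

lemma L2_complete:
  fixes f :: "nat \<Rightarrow> 'a \<Rightarrow> 'b::euclidean_space"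
  assumes L2: "\<And>k. L2 M (f k)"
    and cauchy: "\<And>e. e > 0 \<Longrightarrow> \<exists>N. \<forall>k\<ge>N. \<forall>l\<ge>N. (LINT x|M. (norm (f k x - f l x))\<^sup>2) \<le> e"
  shows "\<exists>g. L2 M g \<and> (\<lambda>k. LINT x|M. (norm (f k x - g x))\<^sup>2) \<longlonglongrightarrow> 0"
proof -
  have "\<exists>N. \<forall>j. \<forall>k\<ge>N j. \<forall>l\<ge>N j. (LINT x|M. (norm (f k x - f l x))\<^sup>2) \<le> (1/8) ^ j"
    using cauchy by (intro choice allI) simp
  then obtain N where N: "\<And>j k l. k \<ge> N j \<Longrightarrow> l \<ge> N j \<Longrightarrow> (LINT x|M. (norm (f k x - f l x))\<^sup>2) \<le> (1/8) ^ j"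
    by blast
  obtain r where r: "strict_mono r" "\<And>j. N j \<le> r j" by (rule strict_mono_above[of N]) blast
  have meas[measurable]: "f k \<in> borel_measurable M" for k by (rule L2_measurable[OF L2])
  \<comment> \<open>\<open>lim\<close> is total and gives a measurable function even where the
    subsequence diverges; that happens on a null set only.\<close>
  define g where "g x = lim (\<lambda>j. f (r j) x)" for x
  have gm[measurable]: "g \<in> borel_measurable M" unfolding g_def by measurable
  have "AE x in M. convergent (\<lambda>j. f (r j) x)"
  proof (rule L2_subsequence_converges_AE)
    show "(LINT x|M. (norm (f (r (Suc j)) x - f (r j) x))\<^sup>2) \<le> (1/8) ^ j" for j
      using r(2)[of j] strict_mono_less[OF r(1), of j "Suc j"] by (intro N) auto
  qed (rule L2)
  then have lim: "AE x in M. (\<lambda>j. f (r j) x) \<longlonglongrightarrow> g x"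
    by eventually_elim (simp add: g_def convergent_LIMSEQ_iff)
  \<comment> \<open>Stated with the nonnegative integral, because square integrability of
    \<open>f k - g\<close> is itself deduced from this bound.\<close>
  have fatou: "\<exists>N. \<forall>k\<ge>N. (\<integral>\<^sup>+x. ennreal ((norm (f k x - g x))\<^sup>2) \<partial>M) \<le> ennreal e" if e: "e > 0" for e
  proof -
    obtain N where N: "\<And>k l. k \<ge> N \<Longrightarrow> l \<ge> N \<Longrightarrow> (LINT x|M. (norm (f k x - f l x))\<^sup>2) \<le> e"
      using cauchy[OF e] by blast
    have "(\<integral>\<^sup>+x. ennreal ((norm (f k x - g x))\<^sup>2) \<partial>M) \<le> ennreal e" if k: "k \<ge> N" for k
    proof -
      have "AE x in M. liminf (\<lambda>j. ennreal ((norm (f k x - f (r j) x))\<^sup>2)) = ennreal ((norm (f k x - g x))\<^sup>2)"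
        using lim by eventually_elim (intro lim_imp_Liminf tendsto_intros, simp_all)
      then have "(\<integral>\<^sup>+x. ennreal ((norm (f k x - g x))\<^sup>2) \<partial>M)
          = (\<integral>\<^sup>+x. liminf (\<lambda>j. ennreal ((norm (f k x - f (r j) x))\<^sup>2)) \<partial>M)"
        by (intro nn_integral_cong_AE) (auto elim: eventually_mono)
      also have "\<dots> \<le> liminf (\<lambda>j. \<integral>\<^sup>+x. ennreal ((norm (f k x - f (r j) x))\<^sup>2) \<partial>M)"
        by (rule nn_integral_liminf) measurable
      also have "\<dots> \<le> ennreal e"
      proof (rule Liminf_le)
        show "\<forall>\<^sub>F j in sequentially. (\<integral>\<^sup>+x. ennreal ((norm (f k x - f (r j) x))\<^sup>2) \<partial>M) \<le> ennreal e"
          using eventually_ge_at_top[of N]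
        proof eventually_elim
          fix j assume "N \<le> j"
          then have "N \<le> r j" using seq_suble[OF r(1), of j] by simp
          have "(\<integral>\<^sup>+x. ennreal ((norm (f k x - f (r j) x))\<^sup>2) \<partial>M) = ennreal (LINT x|M. (norm (f k x - f (r j) x))\<^sup>2)"
            using L2_integrable_square[OF L2_diff[OF L2 L2]] by (intro nn_integral_eq_integral) simp_all
          then show "(\<integral>\<^sup>+x. ennreal ((norm (f k x - f (r j) x))\<^sup>2) \<partial>M) \<le> ennreal e"
            using N[OF k \<open>N \<le> r j\<close>] by (simp add: ennreal_leI)
        qed
      qed simp
      finally show ?thesis .
    qed
    then show ?thesis by blast
  qed
  have L2diff: "L2 M (\<lambda>x. f k x - g x)" if "(\<integral>\<^sup>+x. ennreal ((norm (f k x - g x))\<^sup>2) \<partial>M) \<le> ennreal e" for k e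
    unfolding L2_def
  proof (intro conjI)
    show "integrable M (\<lambda>x. (norm (f k x - g x))\<^sup>2)"
      using that by (intro integrableI_nonneg) (auto simp: le_less_trans[OF _ ennreal_less_top])
  qed measurable
  \<comment> \<open>One index suffices for \<open>g\<close>, since
    \<open>g = f K - (f K - g)\<close>.\<close>
  obtain K where "(\<integral>\<^sup>+x. ennreal ((norm (f K x - g x))\<^sup>2) \<partial>M) \<le> ennreal 1" using fatou[of 1] by auto
  from L2_diff[OF L2[of K] L2diff[OF this]] have g: "L2 M g" by simp
  have "(\<lambda>k. LINT x|M. (norm (f k x - g x))\<^sup>2) \<longlonglongrightarrow> 0"
  proof (rule LIMSEQ_I)
    fix e :: real assume "e > 0"
    then obtain N where N: "\<And>k. k \<ge> N \<Longrightarrow> (\<integral>\<^sup>+x. ennreal ((norm (f k x - g x))\<^sup>2) \<partial>M) \<le> ennreal (e/2)"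
      using fatou[of "e/2"] by auto
    have "norm ((LINT x|M. (norm (f k x - g x))\<^sup>2) - 0) < e" if "k \<ge> N" for k
    proof -
      have "ennreal (LINT x|M. (norm (f k x - g x))\<^sup>2) \<le> ennreal (e/2)"
        using N[OF that] L2_integrable_square[OF L2diff[OF N[OF that]]] by (subst nn_integral_eq_integral[symmetric]) simp_all
      then show ?thesis using \<open>e > 0\<close> by simp
    qed
    then show "\<exists>no. \<forall>n\<ge>no. norm ((LINT x|M. (norm (f n x - g x))\<^sup>2) - 0) < e" by blast
  qed
  with g show ?thesis by blast
qed

section \<open>Weak gradients\<close>

lemma test_function_lipschitz:
  assumes "test_function U \<phi>" "\<And>x. norm (gradient \<phi> x) \<le> B"
  shows "\<bar>\<phi> x - \<phi> y\<bar> \<le> B * norm (x - y)"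
proof -
  have B: "B \<ge> 0" using assms(2)[of 0] norm_ge_zero[of "gradient \<phi> 0"] by linarith
  have "norm (\<phi> x - \<phi> y) \<le> B * norm (x - y)"
  proof (rule differentiable_bound[of UNIV])
    show "(\<phi> has_derivative (\<lambda>h. gradient \<phi> x \<bullet> h)) (at x within UNIV)" for x
      using test_function_has_derivative[OF assms(1)] by simp
    show "onorm (\<lambda>h. gradient \<phi> x \<bullet> h) \<le> B" for x
    proof (rule onorm_bound[OF B])
      show "norm (gradient \<phi> x \<bullet> h) \<le> B * norm h" for h
        using Cauchy_Schwarz_ineq2[of "gradient \<phi> x" h] assms(2)[of x]
          mult_right_mono[OF assms(2)[of x] norm_ge_zero[of h]] by simp
    qed
  qed simp_all
  then show ?thesis by simp
qed

lemma test_function_support_bounded: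
  fixes \<phi> :: "real^'n \<Rightarrow> real"
  assumes "test_function U \<phi>"
  obtains R where "R > 0" "\<And>x. norm x > R \<Longrightarrow> \<phi> x = 0" "\<And>x. norm x > R \<Longrightarrow> gradient \<phi> x = 0"
proof -
  have "bounded (closure {x. \<phi> x \<noteq> 0})" using assms by (simp add: test_function_def compact_imp_bounded)
  then obtain R where R: "R > 0" "\<And>x. x \<in> closure {x. \<phi> x \<noteq> 0} \<Longrightarrow> norm x \<le> R"
    unfolding bounded_pos by blast
  show ?thesis
  proof (rule that[OF R(1)])
    fix x :: "real^'n" assume "norm x > R"
    then have x: "x \<notin> closure {x. \<phi> x \<noteq> 0}" using R(2)[of x] by auto
    then show "\<phi> x = 0" using closure_subset[of "{x. \<phi> x \<noteq> 0}"] by auto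
    show "gradient \<phi> x = 0" by (rule gradient_eq_0[OF assms x])
  qed
qed

lemma integrable_compact_support:
  fixes f :: "'a::euclidean_space \<Rightarrow> 'b::{banach,second_countable_topology}"
  assumes "continuous_on UNIV f" "\<And>x. norm x > R \<Longrightarrow> f x = 0"
  shows "integrable lborel f"
proof -
  have "integrable lborel (\<lambda>x. indicator (cball 0 R) x *\<^sub>R f x)"
    by (rule borel_integrable_compact[OF compact_cball continuous_on_subset[OF assms(1)]]) simp
  moreover have "indicator (cball 0 R) x *\<^sub>R f x = f x" for x
    using assms(2)[of x] by (cases "norm x \<le> R") (auto simp: indicator_def)
  ultimately show ?thesis by simp
qed

lemma integral_lborel_translation:
  fixes f :: "'a::euclidean_space \<Rightarrow> 'b::{banach,second_countable_topology}"
  assumes "f \<in> borel_measurable borel"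
  shows "(LINT x|lborel. f (c + x)) = (LINT x|lborel. f x)"
proof -
  have "(LINT x|lborel. f x) = (LINT x|distr lborel borel ((+) c). f x)" by (simp add: lborel_distr_plus)
  also have "\<dots> = (LINT x|lborel. f (c + x))" using assms by (intro integral_distr) auto
  finally show ?thesis by simp
qed

text \<open>Difference quotients in direction \<open>e\<close> integrate to 0 by translation
  invariance, and they converge boundedly, on a common bounded set, to the partial
  derivative.\<close>

lemma integral_partial_derivative_0:
  fixes \<phi> :: "real^'n \<Rightarrow> real"
  assumes "test_function U \<phi>"
  shows "(LINT x|lborel. gradient \<phi> x $ i) = 0"
proof -
  obtain R where R: "R > 0" "\<And>x. norm x > R \<Longrightarrow> \<phi> x = 0" "\<And>x. norm x > R \<Longrightarrow> gradient \<phi> x = 0"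
    by (rule test_function_support_bounded[OF assms]) blast
  obtain B where B: "B > 0" "\<And>x. norm (gradient \<phi> x) \<le> B" using test_function_bounded[OF assms] by blast
  have int: "integrable lborel \<phi>"
    by (rule integrable_compact_support[OF test_function_continuous[OF assms] R(2)])
  have [measurable]: "\<phi> \<in> borel_measurable borel"
    by (intro borel_measurable_continuous_onI test_function_continuous[OF assms])
  have [measurable]: "gradient \<phi> \<in> borel_measurable borel"
    by (intro borel_measurable_continuous_onI test_function_gradient_continuous[OF assms])
  define e :: "real^'n" where "e = axis i 1"
  have e: "norm e = 1" by (simp add: e_def)
  define h where "h n = inverse (real (Suc n))" for n
  have h: "0 < h n" "h n \<le> 1" for n by (simp_all add: h_def field_simps)
  have h0: "h \<longlonglongrightarrow> 0" unfolding h_def by (rule LIMSEQ_inverse_real_of_nat)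
  define D where "D n x = (\<phi> (h n *\<^sub>R e + x) - \<phi> x) / h n" for n x
  have "(LINT x|lborel. D n x) = 0" for n
  proof -
    have "integrable lborel (\<lambda>x. \<phi> (h n *\<^sub>R e + x))"
    proof (rule integrable_compact_support[where R="R + 1"])
      show "continuous_on UNIV (\<lambda>x. \<phi> (h n *\<^sub>R e + x))"
        by (intro continuous_on_compose2[OF test_function_continuous[OF assms, of UNIV]] continuous_intros) simp
      show "\<phi> (h n *\<^sub>R e + x) = 0" if "norm x > R + 1" for x
      proof (rule R(2))
        show "norm (h n *\<^sub>R e + x) > R"
          using norm_triangle_ineq2[of x "- (h n *\<^sub>R e)"] that h[of n] e by (simp add: add.commute)
      qed
    qed
    then show ?thesis
      using int integral_lborel_translation[of \<phi> "h n *\<^sub>R e"] by (simp add: D_def)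
  qed
  moreover have "(\<lambda>n. LINT x|lborel. D n x) \<longlonglongrightarrow> (LINT x|lborel. gradient \<phi> x $ i)"
  \<comment> \<open>The radius \<open>R + 1\<close> accounts for translations by at most
    \<open>h n \<le> 1\<close>; \<open>B\<close> bounds the quotients by the mean value
    inequality.\<close>
  proof (rule integral_dominated_convergence[where w="\<lambda>x. indicator (cball 0 (R + 1)) x *\<^sub>R B"])
    show "integrable lborel (\<lambda>x::real^'n. indicator (cball 0 (R + 1)) x *\<^sub>R B)"
      by (rule borel_integrable_compact) simp_all
    show "AE x in lborel. (\<lambda>n. D n x) \<longlonglongrightarrow> gradient \<phi> x $ i"
    proof (rule AE_I2)
      fix x
      have "((\<lambda>t. \<phi> (x + t *\<^sub>R e)) has_derivative (\<lambda>t. gradient \<phi> (x + 0 *\<^sub>R e) \<bullet> (t *\<^sub>R e))) (at 0)"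
        by (rule has_derivative_compose[OF _ test_function_has_derivative[OF assms]])
          (auto intro!: derivative_eq_intros)
      then have "((\<lambda>t. \<phi> (x + t *\<^sub>R e)) has_real_derivative (gradient \<phi> x $ i)) (at 0)"
        by (simp add: has_field_derivative_def e_def inner_axis mult_commute_abs)
      then have lim: "((\<lambda>t. (\<phi> (x + t *\<^sub>R e) - \<phi> x) / t) \<longlongrightarrow> gradient \<phi> x $ i) (at 0)"
        by (simp add: DERIV_def)
      have "filterlim h (at 0) sequentially"
        unfolding filterlim_at using h0 h(1) by (auto intro!: always_eventually simp: less_imp_neq[THEN not_sym])
      from filterlim_compose[OF lim this] show "(\<lambda>n. D n x) \<longlonglongrightarrow> gradient \<phi> x $ i"
        by (simp add: D_def add.commute)
    qed
    show "AE x in lborel. norm (D n x) \<le> indicator (cball 0 (R + 1)) x *\<^sub>R B" for n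
    proof (rule AE_I2)
      fix x
      have "\<bar>\<phi> (h n *\<^sub>R e + x) - \<phi> x\<bar> \<le> B * h n"
        using test_function_lipschitz[OF assms B(2), of "h n *\<^sub>R e + x" x] e h[of n] by simp
      then have D: "\<bar>D n x\<bar> \<le> B" using h[of n] by (simp add: D_def field_simps abs_divide)
      show "norm (D n x) \<le> indicator (cball 0 (R + 1)) x *\<^sub>R B"
      proof (cases "norm x \<le> R + 1")
        case True with D show ?thesis by simp
      next
        case False
        then have "norm (h n *\<^sub>R e + x) > R"
          using norm_triangle_ineq2[of x "- (h n *\<^sub>R e)"] h[of n] e by (simp add: add.commute)
        then have "D n x = 0" using R(2) False by (simp add: D_def)
        then show ?thesis using B by simp
      qed
    qed
    show "D n \<in> borel_measurable lborel" for n unfolding D_def by measurable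
    show "(\<lambda>x. gradient \<phi> x $ i) \<in> borel_measurable lborel"
      using measurable_compose[OF \<open>gradient \<phi> \<in> borel_measurable borel\<close> borel_measurable_nth] by simp
  qed
  ultimately have "(\<lambda>n. 0) \<longlonglongrightarrow> (LINT x|lborel. gradient \<phi> x $ i)" by simp
  then show ?thesis by (simp add: LIMSEQ_const_iff)
qed

section \<open>Weak gradients on a bounded open set\<close>

locale bounded_open =
  fixes \<Omega> :: "(real^'n) set"
  assumes open_dom: "open \<Omega>" and bounded_dom: "bounded \<Omega>"
begin

abbreviation M where "M \<equiv> lebesgue_on \<Omega>"
abbreviation test where "test \<equiv> test_function \<Omega>"

sublocale finite_measure M
  using lmeasurable_open[OF bounded_dom open_dom] by (rule finite_measure_lebesgue_on)

lemma dom_sets: "\<Omega> \<in> sets lebesgue"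
  using open_dom by auto

text \<open>Connects the completed measure restricted to \<open>\<Omega>\<close>, in which solutions
  are defined, with \<open>lborel\<close>, on which translations and Fubini's theorem are
  applied.\<close>

lemma integral_eq_lborel:
  fixes f :: "real^'n \<Rightarrow> 'b::{banach,second_countable_topology}"
  assumes "f \<in> borel_measurable borel" "\<And>x. x \<notin> \<Omega> \<Longrightarrow> f x = 0"
  shows "(LINT x|M. f x) = (LINT x|lborel. f x)"
proof -
  have "indicator \<Omega> x *\<^sub>R f x = f x" for x using assms(2)[of x] by (simp add: indicator_def)
  then have "(LINT x|M. f x) = (LINT x|lebesgue. f x)"
    using dom_sets by (subst integral_restrict_space) simp_all
  also have "\<dots> = (LINT x|lborel. f x)" using assms(1) by (intro integral_completion) simp
  finally show ?thesis .
qed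

lemma test_L2:
  assumes "test \<phi>"
  shows "L2 M \<phi>" "L2 M (gradient \<phi>)"
proof -
  obtain B where B: "\<And>x. \<bar>\<phi> x\<bar> \<le> B" "\<And>x. norm (gradient \<phi> x) \<le> B"
    using test_function_bounded[OF assms] by blast
  show "L2 M \<phi>" "L2 M (gradient \<phi>)"
    by (rule L2_bounded[where B=B]; use B test_function_measurable[OF assms] in simp)+
qed

lemma test_partial_L2: "test \<phi> \<Longrightarrow> L2 M (\<lambda>x. gradient \<phi> x $ i)"
  using L2_inner_const[OF test_L2(2), of \<phi> "axis i 1"] by (simp add: inner_axis)

lemma integration_by_parts:
  assumes \<phi>: "test \<phi>" and \<psi>: "test \<psi>"
  shows "(LINT x|M. \<phi> x * gradient \<psi> x $ i) = - (LINT x|M. \<psi> x * gradient \<phi> x $ i)"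
proof -
  have p: "test (\<lambda>x. \<phi> x * \<psi> x)" using \<phi> \<psi> by (intro test_function_mult) (auto simp: test_function_def)
  have "(LINT x|M. gradient (\<lambda>x. \<phi> x * \<psi> x) x $ i) = (LINT x|lborel. gradient (\<lambda>x. \<phi> x * \<psi> x) x $ i)"
  proof (rule integral_eq_lborel)
    have "gradient (\<lambda>x. \<phi> x * \<psi> x) \<in> borel_measurable borel"
      by (intro borel_measurable_continuous_onI test_function_gradient_continuous[OF p])
    from measurable_compose[OF this borel_measurable_nth]
    show "(\<lambda>x. gradient (\<lambda>x. \<phi> x * \<psi> x) x $ i) \<in> borel_measurable borel" .
  qed (simp add: gradient_eq_0_outside[OF p])
  also have "\<dots> = 0" by (rule integral_partial_derivative_0[OF p])
  finally have "(LINT x|M. \<phi> x * gradient \<psi> x $ i + \<psi> x * gradient \<phi> x $ i) = 0"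
    by (simp add: gradient_mult[OF \<phi> \<psi>])
  then show ?thesis
    using L2_integrable_mult[OF test_L2(1)[OF \<phi>] test_partial_L2[OF \<psi>]]
      L2_integrable_mult[OF test_L2(1)[OF \<psi>] test_partial_L2[OF \<phi>]] by simp
qed

lemma L2_component: "L2 M (g :: _ \<Rightarrow> real^'n) \<Longrightarrow> L2 M (\<lambda>x. g x $ i)"
  using L2_inner_const[of M g "axis i 1"] by (simp add: inner_axis)

lemma L2_component_const: "L2 M \<phi> \<Longrightarrow> L2 M (\<lambda>x. \<phi> x *\<^sub>R (c :: real^'n))"
  unfolding L2_def by (auto simp: power_mult_distrib)

lemma integral_scaleR_component:
  assumes "L2 M u" "L2 M g"
  shows "(LINT x|M. u x *\<^sub>R g x) $ i = (LINT x|M. u x * g x $ i)"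
proof -
  have [measurable]: "u \<in> borel_measurable M" "g \<in> borel_measurable M"
    using assms by (simp_all add: L2_def)
  have "integrable M (\<lambda>x. u x *\<^sub>R g x)"
  proof (rule Bochner_Integration.integrable_bound)
    show "integrable M (\<lambda>x. u x * norm (g x))"
      using assms by (intro L2_integrable_mult L2_norm)
  qed (auto simp: abs_mult)
  from integral_bounded_linear[OF bounded_linear_vec_nth this, of i] show ?thesis by simp
qed

lemma has_weak_gradient_iff:
  "has_weak_gradient \<Omega> u g \<longleftrightarrow> L2 M u \<and> L2 M g \<and>
     (\<forall>\<phi>. test \<phi> \<longrightarrow> (\<forall>i. (LINT x|M. u x * gradient \<phi> x $ i) = - (LINT x|M. \<phi> x * g x $ i)))"
proof -
  have *: "(LINT x|M. u x *\<^sub>R gradient \<phi> x) = - (LINT x|M. \<phi> x *\<^sub>R g x) \<longleftrightarrow>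
    (\<forall>i. (LINT x|M. u x * gradient \<phi> x $ i) = - (LINT x|M. \<phi> x * g x $ i))"
    if "L2 M u" "L2 M g" "test \<phi>" for \<phi>
    unfolding vec_eq_iff vector_uminus_component
      integral_scaleR_component[OF that(1) test_L2(2)[OF that(3)]]
      integral_scaleR_component[OF test_L2(1)[OF that(3)] that(2)] ..
  show ?thesis unfolding has_weak_gradient_def square_integrable_iff_L2
    by (intro conj_cong refl arg_cong[where f=All] ext imp_cong *)
qed

lemma has_weak_gradientD:
  "has_weak_gradient \<Omega> u g \<Longrightarrow> test \<phi> \<Longrightarrow> (LINT x|M. u x * gradient \<phi> x $ i) = - (LINT x|M. \<phi> x * g x $ i)"
  by (simp add: has_weak_gradient_iff)

lemma has_weak_gradient_test: "test \<phi> \<Longrightarrow> has_weak_gradient \<Omega> \<phi> (gradient \<phi>)"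
  unfolding has_weak_gradient_iff by (intro conjI allI impI test_L2 integration_by_parts)

lemma has_weak_gradient_diff:
  assumes "has_weak_gradient \<Omega> u g" "has_weak_gradient \<Omega> v h"
  shows "has_weak_gradient \<Omega> (\<lambda>x. u x - v x) (\<lambda>x. g x - h x)"
  unfolding has_weak_gradient_iff
proof (intro conjI allI impI)
  fix \<phi> i assume \<phi>: "test \<phi>"
  show "(LINT x|M. (u x - v x) * gradient \<phi> x $ i) = - (LINT x|M. \<phi> x * (g x - h x) $ i)"
    using assms[THEN has_weak_gradientD, OF \<phi>] assms
      L2_integrable_mult[OF _ test_partial_L2[OF \<phi>]] L2_integrable_mult[OF test_L2(1)[OF \<phi>] L2_component]
    by (simp add: left_diff_distrib right_diff_distrib has_weak_gradient_iff)
qed (use assms L2_diff in \<open>auto simp: has_weak_gradient_iff\<close>)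

text \<open>Both gradients give the same integrals against test functions, so the fundamental lemma
  applies to each component of the difference. This makes the choice in \<open>weak_gradient\<close>
  immaterial up to null sets.\<close>

lemma weak_gradient_unique:
  assumes "has_weak_gradient \<Omega> u g" "has_weak_gradient \<Omega> u h"
  shows "AE x in M. g x = h x"
proof -
  have L2: "L2 M g" "L2 M h" using assms by (simp_all add: has_weak_gradient_iff)
  have "AE x in M. (g x - h x) $ i = 0" for i
  proof (rule fundamental_eq_0[OF open_dom])
    show "integrable M (\<lambda>x. (g x - h x) $ i)"
      by (intro L2_integrable L2_component L2_diff L2)
    fix \<phi> assume \<phi>: "test \<phi>"
    have int: "integrable M (\<lambda>x. \<phi> x * g x $ i)" "integrable M (\<lambda>x. \<phi> x * h x $ i)"
      by (intro L2_integrable_mult test_L2(1)[OF \<phi>] L2_component L2)+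
    have "- (LINT x|M. \<phi> x * g x $ i) = - (LINT x|M. \<phi> x * h x $ i)"
      using assms[THEN has_weak_gradientD, OF \<phi>] by simp
    moreover have "(g x - h x) $ i * \<phi> x = \<phi> x * g x $ i - \<phi> x * h x $ i" for x
      by (simp add: algebra_simps)
    ultimately show "(LINT x|M. (g x - h x) $ i * \<phi> x) = 0" using int by simp
  qed
  then have "AE x in M. \<forall>i. (g x - h x) $ i = 0" by (simp add: AE_all_countable)
  then show ?thesis by (simp add: vec_eq_iff)
qed

lemma weak_gradient_AE:
  assumes "has_weak_gradient \<Omega> u g"
  shows "has_weak_gradient \<Omega> u (weak_gradient \<Omega> u)" "AE x in M. weak_gradient \<Omega> u x = g x"
proof -
  show *: "has_weak_gradient \<Omega> u (weak_gradient \<Omega> u)"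
    unfolding weak_gradient_def by (rule someI[of "has_weak_gradient \<Omega> u", OF assms])
  show "AE x in M. weak_gradient \<Omega> u x = g x" by (rule weak_gradient_unique[OF * assms])
qed

text \<open>The graph closure of the classical gradient: the limit of the gradients is carried as a
  second component, so that arguments can work with it instead of the version selected by
  \<open>weak_gradient\<close>.\<close>

definition H01_pair :: "(real^'n \<Rightarrow> real) \<Rightarrow> (real^'n \<Rightarrow> real^'n) \<Rightarrow> bool" where
  "H01_pair u g \<longleftrightarrow> L2 M u \<and> L2 M g \<and> (\<exists>\<phi>. (\<forall>k. test (\<phi> k)) \<and>
     (\<lambda>k. LINT x|M. (norm (\<phi> k x - u x))\<^sup>2) \<longlonglongrightarrow> 0 \<and>
     (\<lambda>k. LINT x|M. (norm (gradient (\<phi> k) x - g x))\<^sup>2) \<longlonglongrightarrow> 0)"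

text \<open>Integration by parts holds for each approximating test function, and both sides are
  inner products with a fixed square integrable function, hence pass to the limit.\<close>

lemma H01_pair_weak_gradient:
  assumes "H01_pair u g"
  shows "has_weak_gradient \<Omega> u g"
proof -
  obtain \<phi> where u: "L2 M u" and g: "L2 M g" and \<phi>: "\<And>k. test (\<phi> k)"
    and lim: "(\<lambda>k. LINT x|M. (norm (\<phi> k x - u x))\<^sup>2) \<longlonglongrightarrow> 0"
      "(\<lambda>k. LINT x|M. (norm (gradient (\<phi> k) x - g x))\<^sup>2) \<longlonglongrightarrow> 0"
    using assms unfolding H01_pair_def by blast
  have "(LINT x|M. u x * gradient \<psi> x $ i) = - (LINT x|M. \<psi> x * g x $ i)" if \<psi>: "test \<psi>" for \<psi> i
  proof -
    have 1: "(\<lambda>k. LINT x|M. \<phi> k x \<bullet> gradient \<psi> x $ i) \<longlonglongrightarrow> (LINT x|M. u x \<bullet> gradient \<psi> x $ i)"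
      by (rule L2_tendsto_inner[OF test_L2(1)[OF \<phi>] u test_partial_L2[OF \<psi>] lim(1)])
    have 2: "(\<lambda>k. LINT x|M. gradient (\<phi> k) x \<bullet> (\<psi> x *\<^sub>R axis i 1)) \<longlonglongrightarrow> (LINT x|M. g x \<bullet> (\<psi> x *\<^sub>R axis i 1))"
      by (rule L2_tendsto_inner[OF test_L2(2)[OF \<phi>] g L2_component_const[OF test_L2(1)[OF \<psi>]] lim(2)])
    have "(LINT x|M. \<phi> k x \<bullet> gradient \<psi> x $ i) = - (LINT x|M. gradient (\<phi> k) x \<bullet> (\<psi> x *\<^sub>R axis i 1))" for k
      using integration_by_parts[OF \<phi> \<psi>, of k i] by (simp add: inner_axis)
    with 1 have "(\<lambda>k. - (LINT x|M. gradient (\<phi> k) x \<bullet> (\<psi> x *\<^sub>R axis i 1))) \<longlonglongrightarrow> (LINT x|M. u x \<bullet> gradient \<psi> x $ i)"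
      by simp
    from LIMSEQ_unique[OF this tendsto_minus[OF 2]] show ?thesis by (simp add: inner_axis)
  qed
  with u g show ?thesis by (simp add: has_weak_gradient_iff)
qed

lemma H1_norm_square:
  assumes "has_weak_gradient \<Omega> u g"
  shows "(H1_norm \<Omega> u)\<^sup>2 = (LINT x|M. (norm (u x))\<^sup>2) + (LINT x|M. (norm (g x))\<^sup>2)"
proof -
  note w = weak_gradient_AE[OF assms]
  have m: "weak_gradient \<Omega> u \<in> borel_measurable M" "g \<in> borel_measurable M"
    using w(1) assms by (auto simp: has_weak_gradient_iff L2_def)
  have "AE x in M. (norm (weak_gradient \<Omega> u x))\<^sup>2 = (norm (g x))\<^sup>2"
    using w(2) by eventually_elim simp
  then have "(LINT x|M. (norm (weak_gradient \<Omega> u x))\<^sup>2) = (LINT x|M. (norm (g x))\<^sup>2)"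
    using m by (intro integral_cong_AE) simp_all
  then show ?thesis by (simp add: H1_norm_def)
qed

text \<open>The squared \<open>H1_norm\<close> of the error is the sum of the two squared
  \<open>L^2\<close> distances. It tends to 0 exactly when both summands do, each being nonnegative
  and at most the sum.\<close>

lemma H01_iff: "u \<in> H01 \<Omega> \<longleftrightarrow> (\<exists>g. H01_pair u g)"
proof
  assume "u \<in> H01 \<Omega>"
  then obtain g \<phi> where g: "has_weak_gradient \<Omega> u g" and \<phi>: "\<And>k. test (\<phi> k)"
    and lim: "(\<lambda>k. H1_norm \<Omega> (\<lambda>x. \<phi> k x - u x)) \<longlonglongrightarrow> 0"
    unfolding H01_def H1_def by blast
  have "(\<lambda>k. (H1_norm \<Omega> (\<lambda>x. \<phi> k x - u x))\<^sup>2) \<longlonglongrightarrow> 0"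
    using tendsto_power[OF lim, of 2] by simp
  then have l: "(\<lambda>k. (LINT x|M. (norm (\<phi> k x - u x))\<^sup>2) + (LINT x|M. (norm (gradient (\<phi> k) x - g x))\<^sup>2)) \<longlonglongrightarrow> 0"
    by (simp only: H1_norm_square[OF has_weak_gradient_diff[OF has_weak_gradient_test[OF \<phi>] g]])
  have "(\<lambda>k. LINT x|M. (norm (\<phi> k x - u x))\<^sup>2) \<longlonglongrightarrow> 0"
    by (rule tendsto_sandwich[OF _ _ tendsto_const l]) (simp_all add: always_eventually)
  moreover have "(\<lambda>k. LINT x|M. (norm (gradient (\<phi> k) x - g x))\<^sup>2) \<longlonglongrightarrow> 0"
    by (rule tendsto_sandwich[OF _ _ tendsto_const l]) (simp_all add: always_eventually)
  ultimately have "H01_pair u g" using g \<phi> unfolding H01_pair_def has_weak_gradient_iff by blast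
  then show "\<exists>g. H01_pair u g" by blast
next
  assume "\<exists>g. H01_pair u g"
  then obtain g where p: "H01_pair u g" by blast
  then obtain \<phi> where \<phi>: "\<And>k. test (\<phi> k)"
    and lim: "(\<lambda>k. LINT x|M. (norm (\<phi> k x - u x))\<^sup>2) \<longlonglongrightarrow> 0"
      "(\<lambda>k. LINT x|M. (norm (gradient (\<phi> k) x - g x))\<^sup>2) \<longlonglongrightarrow> 0"
    unfolding H01_pair_def by blast
  note g = H01_pair_weak_gradient[OF p]
  have "(\<lambda>k. (H1_norm \<Omega> (\<lambda>x. \<phi> k x - u x))\<^sup>2) \<longlonglongrightarrow> 0"
    unfolding H1_norm_square[OF has_weak_gradient_diff[OF has_weak_gradient_test[OF \<phi>] g]]
    using tendsto_add[OF lim] by simp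
  from tendsto_real_sqrt[OF this] have "(\<lambda>k. H1_norm \<Omega> (\<lambda>x. \<phi> k x - u x)) \<longlonglongrightarrow> 0"
    by (simp add: H1_norm_def)
  with g \<phi> show "u \<in> H01 \<Omega>" unfolding H01_def H1_def by blast
qed

end

section \<open>Compactness of bounded sequences of test functions\<close>

lemma nn_integral_lborel_translation:
  fixes f :: "'a::euclidean_space \<Rightarrow> ennreal"
  assumes "f \<in> borel_measurable borel"
  shows "(\<integral>\<^sup>+x. f (c + x) \<partial>lborel) = (\<integral>\<^sup>+x. f x \<partial>lborel)"
proof -
  have "(\<integral>\<^sup>+x. f x \<partial>lborel) = (\<integral>\<^sup>+x. f x \<partial>distr lborel borel ((+) c))" by (simp add: lborel_distr_plus)
  also have "\<dots> = (\<integral>\<^sup>+x. f (c + x) \<partial>lborel)" using assms by (intro nn_integral_distr) auto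
  finally show ?thesis by simp
qed

lemma test_function_borel:
  assumes "test_function U \<phi>"
  shows "\<phi> \<in> borel_measurable borel" "gradient \<phi> \<in> borel_measurable borel"
  by (simp_all add: borel_measurable_continuous_onI test_function_continuous[OF assms]
    test_function_gradient_continuous[OF assms])

text \<open>The fundamental theorem of calculus along the segment from \<open>x\<close> to
  \<open>h + x\<close>. The right side is a nonnegative integral so that the order of integration in
  \<open>x\<close> and \<open>t\<close> can be exchanged afterwards.\<close>

lemma test_function_increment_le:
  assumes \<phi>: "test_function U \<phi>"
  shows "ennreal \<bar>\<phi> (h + x) - \<phi> x\<bar> \<le>
    (\<integral>\<^sup>+t. ennreal (norm h * norm (gradient \<phi> (t *\<^sub>R h + x))) * indicator {0..1} t \<partial>lborel)"
proof -
  let ?f = "\<lambda>t. gradient \<phi> (t *\<^sub>R h + x) \<bullet> h"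
  let ?F = "\<lambda>t. \<phi> (t *\<^sub>R h + x)"
  have der: "DERIV ?F t :> ?f t" for t
  proof -
    have "((\<lambda>t. \<phi> (t *\<^sub>R h + x)) has_derivative (\<lambda>s. gradient \<phi> (t *\<^sub>R h + x) \<bullet> (s *\<^sub>R h))) (at t)"
      by (rule has_derivative_compose[OF _ test_function_has_derivative[OF \<phi>]])
        (auto intro!: derivative_eq_intros)
    then show ?thesis by (simp add: has_field_derivative_def mult_commute_abs)
  qed
  have "continuous_on UNIV ?f"
    by (intro continuous_intros continuous_on_compose2[OF test_function_gradient_continuous[OF \<phi>, of UNIV]]) simp
  then have cont: "isCont ?f t" for t by (simp add: continuous_on_eq_continuous_at)
  have "has_bochner_integral lborel (\<lambda>t. ?f t * indicator {0..1} t) (?F 1 - ?F 0)"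
    by (rule has_bochner_integral_FTC_Icc_real) (use der cont in auto)
  from has_bochner_integral_norm_bound[OF this]
  have "ennreal \<bar>\<phi> (h + x) - \<phi> x\<bar> \<le> (\<integral>\<^sup>+t. norm (?f t * indicator {0..1} t) \<partial>lborel)" by simp
  also have "\<dots> \<le> (\<integral>\<^sup>+t. ennreal (norm h * norm (gradient \<phi> (t *\<^sub>R h + x))) * indicator {0..1} t \<partial>lborel)"
  proof (rule nn_integral_mono)
    fix t
    show "ennreal (norm (?f t * indicator {0..1} t)) \<le> ennreal (norm h * norm (gradient \<phi> (t *\<^sub>R h + x))) * indicator {0..1} t"
      using Cauchy_Schwarz_ineq2[of "gradient \<phi> (t *\<^sub>R h + x)" h]
      by (simp add: indicator_def ennreal_leI mult.commute)
  qed
  finally show ?thesis .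
qed

text \<open>After exchanging the integrals, translation invariance makes the inner integral
  independent of the position \<open>t\<close> on the segment.\<close>

lemma test_function_translation_L1:
  fixes \<phi> :: "real^'n \<Rightarrow> real"
  assumes \<phi>: "test_function U \<phi>"
  shows "(\<integral>\<^sup>+x. ennreal \<bar>\<phi> (h + x) - \<phi> x\<bar> \<partial>lborel) \<le> ennreal (norm h) * (\<integral>\<^sup>+x. ennreal (norm (gradient \<phi> x)) \<partial>lborel)"
proof -
  have [measurable]: "\<phi> \<in> borel_measurable borel" "gradient \<phi> \<in> borel_measurable borel"
    by (rule test_function_borel[OF \<phi>])+
  let ?I = "\<integral>\<^sup>+x. ennreal (norm (gradient \<phi> x)) \<partial>lborel"
  let ?f = "\<lambda>x t. ennreal (norm h * norm (gradient \<phi> (t *\<^sub>R h + x))) * indicator {0..1::real} t"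
  have inner: "(\<integral>\<^sup>+x. ?f x t \<partial>lborel) = ennreal (norm h) * ?I * indicator {0..1} t" for t
  proof -
    have "(\<integral>\<^sup>+x. ?f x t \<partial>lborel) = (\<integral>\<^sup>+x. ennreal (norm h) * ennreal (norm (gradient \<phi> (t *\<^sub>R h + x))) \<partial>lborel) * indicator {0..1} t"
      by (simp add: nn_integral_multc ennreal_mult)
    also have "(\<integral>\<^sup>+x. ennreal (norm h) * ennreal (norm (gradient \<phi> (t *\<^sub>R h + x))) \<partial>lborel) = ennreal (norm h) * ?I"
      using nn_integral_lborel_translation[of "\<lambda>x. ennreal (norm (gradient \<phi> x))" "t *\<^sub>R h"]
      by (simp add: nn_integral_cmult)
    finally show ?thesis .
  qed
  have "(\<integral>\<^sup>+x. ennreal \<bar>\<phi> (h + x) - \<phi> x\<bar> \<partial>lborel) \<le> (\<integral>\<^sup>+x. (\<integral>\<^sup>+t. ?f x t \<partial>lborel) \<partial>lborel)"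
    by (intro nn_integral_mono test_function_increment_le[OF \<phi>])
  also have "\<dots> = (\<integral>\<^sup>+t. (\<integral>\<^sup>+x. ?f x t \<partial>lborel) \<partial>lborel)"
    by (rule lborel_pair.Fubini'[symmetric]) measurable
  also have "\<dots> = ennreal (norm h) * ?I"
    by (simp add: inner nn_integral_cmult)
  finally show ?thesis .
qed

section \<open>Averages over the cells of a cubic grid\<close>

definition cell :: "nat \<Rightarrow> real^'n \<Rightarrow> int^'n" where
  "cell N x = (\<chi> i. \<lfloor>real N * x $ i\<rfloor>)"

text \<open>The prefactor is the reciprocal of the volume of a cell, a half-open cube of side
  \<open>1 / N\<close>.\<close>

definition cell_average :: "nat \<Rightarrow> (real^'n \<Rightarrow> real) \<Rightarrow> real^'n \<Rightarrow> real" where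
  "cell_average N \<phi> x = real N ^ CARD('n) * (LINT y|lborel. indicator {y. cell N y = cell N x} y * \<phi> y)"

lemma cell_eq_iff: "cell N x = c \<longleftrightarrow> (\<forall>i. \<lfloor>real N * x $ i\<rfloor> = c $ i)"
  by (simp add: cell_def vec_eq_iff)

lemma cell_sets [measurable]: "{y. cell N y = c} \<in> sets borel"
  unfolding cell_eq_iff by measurable

lemma cell_measurable [measurable]: "(cell N :: real^'n \<Rightarrow> _) \<in> measurable borel (count_space UNIV)"
proof -
  have "(cell N :: real^'n \<Rightarrow> _) -` {c} \<inter> space borel \<in> sets borel" for c
    using cell_sets[of N c] by (simp add: vimage_def)
  then show ?thesis by (subst measurable_count_space_eq2_countable) simp_all
qed

lemma cell_average_measurable:
  fixes \<phi> :: "real^'n \<Rightarrow> real"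
  assumes [measurable]: "\<phi> \<in> borel_measurable borel"
  shows "cell_average N \<phi> \<in> borel_measurable borel"
proof -
  have "(\<lambda>p. indicator {p. cell N (snd p) = cell N (fst p)} p * \<phi> (snd p)) \<in> borel_measurable (borel \<Otimes>\<^sub>M lborel)"
    by measurable
  then have "(\<lambda>(x, y). indicator {y. cell N y = cell N x} y * \<phi> y) \<in> borel_measurable (borel \<Otimes>\<^sub>M lborel)"
    by (simp add: case_prod_beta' indicator_def)
  from lborel.borel_measurable_lebesgue_integral[OF this]
  show ?thesis unfolding cell_average_def[abs_def] by measurable
qed

lemma cell_close:
  assumes "cell N x = cell N y" "N > 0"
  shows "y - x \<in> cbox (\<chi> i. - (1 / N)) (\<chi> i. 1 / N)"
proof -
  have "\<bar>y $ i - x $ i\<bar> \<le> 1 / N" for i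
  proof -
    have "\<lfloor>real N * x $ i\<rfloor> = \<lfloor>real N * y $ i\<rfloor>"
      using assms(1) by (simp add: cell_def vec_eq_iff)
    then have "\<bar>real N * y $ i - real N * x $ i\<bar> \<le> 1" by linarith
    then have "real N * \<bar>y $ i - x $ i\<bar> \<le> 1" by (simp add: abs_mult flip: right_diff_distrib)
    then show ?thesis using assms(2) by (simp add: field_simps)
  qed
  then have "- (1 / N) \<le> y $ i - x $ i \<and> y $ i - x $ i \<le> 1 / N" for i
    by (metis abs_le_D1 abs_le_D2 minus_le_iff)
  then show ?thesis by (simp add: mem_box_cart)
qed

lemma emeasure_cube:
  fixes a :: "real^'n"
  assumes "s \<ge> 0"
  shows "emeasure lborel (cbox a (\<chi> i. a $ i + s)) = ennreal (s ^ CARD('n))"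
    "emeasure lborel (box a (\<chi> i. a $ i + s)) = ennreal (s ^ CARD('n))"
proof -
  have b: "((\<chi> i. a $ i + s) - a) \<bullet> b = s" if "b \<in> Basis" for b
    using that by (auto simp: Basis_vec_def inner_axis)
  have le: "a \<bullet> b \<le> (\<chi> i. a $ i + s) \<bullet> b" if "b \<in> Basis" for b
    using b[OF that] assms by (simp add: inner_diff_left)
  show "emeasure lborel (cbox a (\<chi> i. a $ i + s)) = ennreal (s ^ CARD('n))"
    "emeasure lborel (box a (\<chi> i. a $ i + s)) = ennreal (s ^ CARD('n))"
    using le by (simp_all add: emeasure_lborel_cbox emeasure_lborel_box b)
qed

text \<open>The half-open cube lies between the open and the closed cube, which have the same
  measure.\<close>

lemma emeasure_cell:
  assumes "N > 0"
  shows "emeasure lborel {y :: real^'n. cell N y = c} = ennreal ((1 / N) ^ CARD('n))"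
proof -
  define a :: "real^'n" where "a = (\<chi> i. real_of_int (c $ i) / N)"
  have eq: "cell N y = c \<longleftrightarrow> (\<forall>i. a $ i \<le> y $ i \<and> y $ i < a $ i + 1 / N)" for y
  proof -
    have "\<lfloor>real N * y $ i\<rfloor> = c $ i \<longleftrightarrow> a $ i \<le> y $ i \<and> y $ i < a $ i + 1 / N" for i
      using assms by (simp add: a_def floor_eq_iff field_simps)
    then show ?thesis by (simp add: cell_eq_iff)
  qed
  have "emeasure lborel (box a (\<chi> i. a $ i + 1 / N)) \<le> emeasure lborel {y. cell N y = c}"
    by (intro emeasure_mono) (auto simp: eq mem_box_cart less_imp_le)
  moreover have "emeasure lborel {y. cell N y = c} \<le> emeasure lborel (cbox a (\<chi> i. a $ i + 1 / N))"
    by (intro emeasure_mono) (auto simp: eq mem_box_cart less_imp_le)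
  ultimately show ?thesis using emeasure_cube[of "1 / N" a] by (simp add: antisym)
qed

text \<open>The deviation is the mean of \<open>\<phi> x - \<phi> y\<close> over the cell of
  \<open>x\<close>. Enlarging that cell to the cube of side \<open>2 / N\<close> centred at
  \<open>x\<close> makes the set of displacements \<open>h\<close> independent of \<open>x\<close>,
  which the exchange of integrals requires.\<close>

lemma cell_average_deviation:
  fixes \<phi> :: "real^'n \<Rightarrow> real"
  assumes \<phi>: "test_function U \<phi>" and N: "N > 0"
  shows "ennreal \<bar>\<phi> x - cell_average N \<phi> x\<bar> \<le>
    ennreal (real N ^ CARD('n)) * (\<integral>\<^sup>+h. indicator (cbox (\<chi> i. - (1 / N)) (\<chi> i. 1 / N)) h * ennreal \<bar>\<phi> (h + x) - \<phi> x\<bar> \<partial>lborel)"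
proof -
  have [measurable]: "\<phi> \<in> borel_measurable borel" by (rule test_function_borel[OF \<phi>])
  let ?C = "{y. cell N y = cell N x}" and ?K = "real N ^ CARD('n)"
  let ?B = "cbox (\<chi> i. - (1 / N)) (\<chi> i. 1 / N) :: (real^'n) set"
  obtain R where R: "\<And>x. norm x > R \<Longrightarrow> \<phi> x = 0" by (rule test_function_support_bounded[OF \<phi>]) blast
  have "integrable lborel \<phi>" by (rule integrable_compact_support[OF test_function_continuous[OF \<phi>] R])
  then have i1: "integrable lborel (\<lambda>y. indicator ?C y * \<phi> y)"
    using integrable_mult_indicator[of ?C lborel \<phi>] by simp
  have i2: "integrable lborel (\<lambda>y. indicator ?C y * \<phi> x)"
    using emeasure_cell[OF N, of "cell N x"] by (intro integrable_mult_left integrable_real_indicator) auto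
  have "measure lborel ?C = (1 / N) ^ CARD('n)" by (simp add: measure_def emeasure_cell[OF N])
  then have "(LINT y|lborel. ?K * (indicator ?C y * \<phi> x)) = \<phi> x"
    using N by (simp add: power_one_over)
  then have "\<phi> x - cell_average N \<phi> x = (LINT y|lborel. ?K * (indicator ?C y * \<phi> x) - ?K * (indicator ?C y * \<phi> y))"
    using i1 i2 by (simp add: cell_average_def)
  also have "\<dots> = (LINT y|lborel. ?K * (indicator ?C y * (\<phi> x - \<phi> y)))"
    by (simp add: algebra_simps)
  finally have eq: "\<phi> x - cell_average N \<phi> x = (LINT y|lborel. ?K * (indicator ?C y * (\<phi> x - \<phi> y)))" .
  have "integrable lborel (\<lambda>y. ?K * (indicator ?C y * (\<phi> x - \<phi> y)))"
    using i1 i2 by (simp add: right_diff_distrib)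
  from integral_norm_bound_ennreal[OF this]
  have "ennreal \<bar>\<phi> x - cell_average N \<phi> x\<bar> \<le> (\<integral>\<^sup>+y. norm (?K * (indicator ?C y * (\<phi> x - \<phi> y))) \<partial>lborel)"
    unfolding eq real_norm_def .
  also have "\<dots> \<le> (\<integral>\<^sup>+y. ennreal ?K * (indicator ?B (y - x) * ennreal \<bar>\<phi> y - \<phi> x\<bar>) \<partial>lborel)"
  proof (rule nn_integral_mono)
    fix y
    show "ennreal (norm (?K * (indicator ?C y * (\<phi> x - \<phi> y)))) \<le> ennreal ?K * (indicator ?B (y - x) * ennreal \<bar>\<phi> y - \<phi> x\<bar>)"
    proof (cases "y \<in> ?C")
      case True
      then have "y - x \<in> ?B" using cell_close[OF _ N, of x y] by simp
      with True show ?thesis by (simp add: abs_mult ennreal_mult abs_minus_commute)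
    qed simp
  qed
  also have "\<dots> = ennreal ?K * (\<integral>\<^sup>+y. indicator ?B (y - x) * ennreal \<bar>\<phi> y - \<phi> x\<bar> \<partial>lborel)"
    by (rule nn_integral_cmult) measurable
  also have "(\<integral>\<^sup>+y. indicator ?B (y - x) * ennreal \<bar>\<phi> y - \<phi> x\<bar> \<partial>lborel) =
      (\<integral>\<^sup>+h. indicator ?B h * ennreal \<bar>\<phi> (h + x) - \<phi> x\<bar> \<partial>lborel)"
    using nn_integral_lborel_translation[of "\<lambda>y. indicator ?B (y - x) * ennreal \<bar>\<phi> y - \<phi> x\<bar>" x]
    by (simp add: add.commute)
  finally show ?thesis .
qed

text \<open>A displacement \<open>h\<close> in the cube has norm at most \<open>CARD('n) / N\<close>
  and costs that multiple of the \<open>L^1\<close> norm of the gradient. The volume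
  \<open>(2 / N) ^ CARD('n)\<close> of the cube against the prefactor \<open>N ^ CARD('n)\<close>
  leaves \<open>2 ^ CARD('n)\<close>.\<close>

lemma cell_average_L1:
  fixes \<phi> :: "real^'n \<Rightarrow> real"
  assumes \<phi>: "test_function U \<phi>" and N: "N > 0"
  shows "(\<integral>\<^sup>+x. ennreal \<bar>\<phi> x - cell_average N \<phi> x\<bar> \<partial>lborel) \<le>
    ennreal (2 ^ CARD('n) * CARD('n) / N) * (\<integral>\<^sup>+x. ennreal (norm (gradient \<phi> x)) \<partial>lborel)"
proof -
  have [measurable]: "\<phi> \<in> borel_measurable borel" by (rule test_function_borel[OF \<phi>])
  let ?K = "real N ^ CARD('n)" and ?I = "\<integral>\<^sup>+x. ennreal (norm (gradient \<phi> x)) \<partial>lborel"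
  let ?B = "cbox (\<chi> i. - (1 / N)) (\<chi> i. 1 / N) :: (real^'n) set"
  have "(\<integral>\<^sup>+x. ennreal \<bar>\<phi> x - cell_average N \<phi> x\<bar> \<partial>lborel) \<le>
      (\<integral>\<^sup>+x. ennreal ?K * (\<integral>\<^sup>+h. indicator ?B h * ennreal \<bar>\<phi> (h + x) - \<phi> x\<bar> \<partial>lborel) \<partial>lborel)"
    by (intro nn_integral_mono cell_average_deviation[OF \<phi> N])
  also have "\<dots> = ennreal ?K * (\<integral>\<^sup>+x. (\<integral>\<^sup>+h. indicator ?B h * ennreal \<bar>\<phi> (h + x) - \<phi> x\<bar> \<partial>lborel) \<partial>lborel)"
    by (rule nn_integral_cmult) measurable
  also have "(\<integral>\<^sup>+x. (\<integral>\<^sup>+h. indicator ?B h * ennreal \<bar>\<phi> (h + x) - \<phi> x\<bar> \<partial>lborel) \<partial>lborel) =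
      (\<integral>\<^sup>+h. (\<integral>\<^sup>+x. indicator ?B h * ennreal \<bar>\<phi> (h + x) - \<phi> x\<bar> \<partial>lborel) \<partial>lborel)"
    by (rule lborel_pair.Fubini'[symmetric]) measurable
  also have "\<dots> \<le> (\<integral>\<^sup>+h. indicator ?B h * (ennreal (CARD('n) / N) * ?I) \<partial>lborel)"
  proof (rule nn_integral_mono)
    fix h :: "real^'n"
    show "(\<integral>\<^sup>+x. indicator ?B h * ennreal \<bar>\<phi> (h + x) - \<phi> x\<bar> \<partial>lborel) \<le> indicator ?B h * (ennreal (CARD('n) / N) * ?I)"
    proof (cases "h \<in> ?B")
      case True
      have "norm h \<le> (\<Sum>i\<in>UNIV. \<bar>h $ i\<bar>)" by (rule norm_le_l1_cart)
      also have "\<dots> \<le> (\<Sum>i\<in>(UNIV::'n set). 1 / N)"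
      proof (rule sum_mono)
        fix i
        have "- (1 / N) \<le> h $ i" "h $ i \<le> 1 / N" using True by (simp_all add: mem_box_cart)
        then show "\<bar>h $ i\<bar> \<le> 1 / N" by linarith
      qed
      finally have "norm h \<le> CARD('n) / N" by simp
      then have "ennreal (norm h) * ?I \<le> ennreal (CARD('n) / N) * ?I" by (intro mult_right_mono ennreal_leI) simp_all
      with test_function_translation_L1[OF \<phi>, of h]
      have "(\<integral>\<^sup>+x. ennreal \<bar>\<phi> (h + x) - \<phi> x\<bar> \<partial>lborel) \<le> ennreal (CARD('n) / N) * ?I"
        by (rule order_trans)
      with True show ?thesis by simp
    qed simp
  qed
  also have "\<dots> = emeasure lborel ?B * (ennreal (CARD('n) / N) * ?I)"
    by (simp add: nn_integral_multc)
  also have "emeasure lborel ?B = ennreal ((2 / N) ^ CARD('n))"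
    using emeasure_cube(1)[of "2 / N" "\<chi> i. - (1 / N)"] N by (simp add: field_simps)
  also have "ennreal ?K * (ennreal ((2 / N) ^ CARD('n)) * (ennreal (CARD('n) / N) * ?I)) =
      ennreal (?K * ((2 / N) ^ CARD('n) * (CARD('n) / N))) * ?I"
    by (simp add: mult.assoc[symmetric] flip: ennreal_mult)
  also have "?K * ((2 / N) ^ CARD('n) * (CARD('n) / N)) = 2 ^ CARD('n) * CARD('n) / N"
    using N by (simp add: power_divide)
  finally show ?thesis by (simp add: mult_left_mono)
qed

context bounded_open
begin

lemma cell_average_deviation_L1:
  assumes \<phi>: "test \<phi>" and C: "(LINT x|M. (norm (gradient \<phi> x))\<^sup>2) \<le> C" and N: "N > 0"
  shows "integrable M (\<lambda>x. \<phi> x - cell_average N \<phi> x)"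
    "(LINT x|M. \<bar>\<phi> x - cell_average N \<phi> x\<bar>) \<le> 2 ^ CARD('n) * CARD('n) / N * (measure M (space M) + C)"
proof -
  have [measurable]: "\<phi> \<in> borel_measurable borel" "gradient \<phi> \<in> borel_measurable borel"
    by (rule test_function_borel[OF \<phi>])+
  have [measurable]: "cell_average N \<phi> \<in> borel_measurable borel"
    by (rule cell_average_measurable) measurable
  have meas: "(\<lambda>x. \<phi> x - cell_average N \<phi> x) \<in> borel_measurable M"
    by (intro measurable_restrict_space1 measurable_completion) measurable
  let ?c = "2 ^ CARD('n) * CARD('n) / N"
  obtain R where R: "\<And>x. norm x > R \<Longrightarrow> gradient \<phi> x = 0" by (rule test_function_support_bounded[OF \<phi>]) blast
  have "integrable lborel (\<lambda>x. norm (gradient \<phi> x))"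
    by (intro integrable_norm integrable_compact_support[OF test_function_gradient_continuous[OF \<phi>] R])
  then have "(\<integral>\<^sup>+x. ennreal (norm (gradient \<phi> x)) \<partial>lborel) = ennreal (LINT x|lborel. norm (gradient \<phi> x))"
    by (intro nn_integral_eq_integral) simp_all
  also have "(LINT x|lborel. norm (gradient \<phi> x)) = (LINT x|M. norm (gradient \<phi> x))"
    by (rule integral_eq_lborel[symmetric]) (measurable, simp add: gradient_eq_0_outside[OF \<phi>])
  also have "\<dots> \<le> (LINT x|M. 1 + (norm (gradient \<phi> x))\<^sup>2)"
    using L2_integrable[OF test_L2(2)[OF \<phi>]] L2_integrable_square[OF test_L2(2)[OF \<phi>]]
    by (intro integral_mono norm_le_one_plus_square) simp_all
  also have "\<dots> = measure M (space M) + (LINT x|M. (norm (gradient \<phi> x))\<^sup>2)"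
    using L2_integrable_square[OF test_L2(2)[OF \<phi>]] by simp
  also have "\<dots> \<le> measure M (space M) + C" using C by simp
  finally have grad: "(\<integral>\<^sup>+x. ennreal (norm (gradient \<phi> x)) \<partial>lborel) \<le> ennreal (measure M (space M) + C)"
    by (simp add: ennreal_leI)
  have C0: "C \<ge> 0" using C by (rule order_trans[rotated]) simp
  have "(\<integral>\<^sup>+x. ennreal \<bar>\<phi> x - cell_average N \<phi> x\<bar> \<partial>M) =
      (\<integral>\<^sup>+x. ennreal \<bar>\<phi> x - cell_average N \<phi> x\<bar> * indicator \<Omega> x \<partial>lebesgue)"
    using dom_sets by (simp add: nn_integral_restrict_space)
  also have "\<dots> \<le> (\<integral>\<^sup>+x. ennreal \<bar>\<phi> x - cell_average N \<phi> x\<bar> \<partial>lebesgue)"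
    by (intro nn_integral_mono) (simp add: indicator_def)
  also have "\<dots> = (\<integral>\<^sup>+x. ennreal \<bar>\<phi> x - cell_average N \<phi> x\<bar> \<partial>lborel)"
    by (simp add: nn_integral_completion)
  also have "\<dots> \<le> ennreal ?c * ennreal (measure M (space M) + C)"
    by (rule order_trans[OF cell_average_L1[OF \<phi> N] mult_left_mono[OF grad]]) simp
  also have "\<dots> = ennreal (?c * (measure M (space M) + C))"
    using C0 by (intro ennreal_mult[symmetric]) simp_all
  finally have nn: "(\<integral>\<^sup>+x. ennreal (norm (\<phi> x - cell_average N \<phi> x)) \<partial>M) \<le> ennreal (?c * (measure M (space M) + C))"
    by simp
  then show int: "integrable M (\<lambda>x. \<phi> x - cell_average N \<phi> x)"
    by (intro integrableI_bounded meas) (simp add: le_less_trans[OF _ ennreal_less_top])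
  have "ennreal (LINT x|M. \<bar>\<phi> x - cell_average N \<phi> x\<bar>) \<le> ennreal (?c * (measure M (space M) + C))"
    using nn int by (subst nn_integral_eq_integral[symmetric]) simp_all
  then show "(LINT x|M. \<bar>\<phi> x - cell_average N \<phi> x\<bar>) \<le> ?c * (measure M (space M) + C)"
    using C0 by (subst (asm) ennreal_le_iff) simp_all
qed

lemma cell_integral_bound:
  assumes \<phi>: "test \<phi>" and B: "\<And>x. \<bar>\<phi> x\<bar> \<le> B"
  shows "\<bar>LINT y|lborel. indicator {y. cell N y = c} y * \<phi> y\<bar> \<le> B * measure M (space M)"
proof -
  have [measurable]: "\<phi> \<in> borel_measurable borel" by (rule test_function_borel[OF \<phi>])
  obtain R where R: "\<And>x. norm x > R \<Longrightarrow> \<phi> x = 0" by (rule test_function_support_bounded[OF \<phi>]) blast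
  have int: "integrable lborel \<phi>" by (rule integrable_compact_support[OF test_function_continuous[OF \<phi>] R])
  have "norm (LINT y|lborel. indicator {y. cell N y = c} y * \<phi> y) \<le> (LINT y|lborel. norm (indicator {y. cell N y = c} y * \<phi> y))"
    by (rule integral_norm_bound)
  also have "\<dots> \<le> (LINT y|lborel. \<bar>\<phi> y\<bar>)"
    using int integrable_mult_indicator[of "{y. cell N y = c}" lborel \<phi>]
    by (intro integral_mono) (simp_all add: indicator_def)
  also have "\<dots> = (LINT y|M. \<bar>\<phi> y\<bar>)"
    by (rule integral_eq_lborel[symmetric]) (measurable, simp add: test_function_eq_0[OF \<phi>])
  also have "\<dots> \<le> (LINT y|M. B)"
    using L2_integrable[OF test_L2(1)[OF \<phi>]] B by (intro integral_mono) simp_all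
  finally show ?thesis by (simp add: mult.commute)
qed

text \<open>For each \<open>N\<close> the cell averages are close to the functions uniformly in the
  sequence, by the gradient bound. The averages are determined by countably many bounded numbers, so
  one subsequence makes all of them converge, for every \<open>N\<close>. The Cauchy form is what
  the later completeness arguments take as input.\<close>

lemma rellich:
  fixes \<phi> :: "nat \<Rightarrow> real^'n \<Rightarrow> real"
  assumes \<phi>: "\<And>k. test (\<phi> k)" and B: "\<And>k x. \<bar>\<phi> k x\<bar> \<le> B"
    and C: "\<And>k. (LINT x|M. (norm (gradient (\<phi> k) x))\<^sup>2) \<le> C"
  shows "\<exists>r :: nat \<Rightarrow> nat. strict_mono r \<and> (\<forall>e>0. \<exists>K. \<forall>k\<ge>K. \<forall>l\<ge>K. (LINT x|M. \<bar>\<phi> (r k) x - \<phi> (r l) x\<bar>) \<le> e)"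
proof -
  \<comment> \<open>Pairs of a grid size and a cell label form a countable set, so a diagonal
    subsequence exists.\<close>
  define a where "a k = (\<lambda>(N, c). LINT y|lborel. indicator {y. cell N y = c} y * \<phi> k y)" for k :: nat
  have bound: "norm (a k p) \<le> B * measure M (space M)" for k p
    using cell_integral_bound[OF \<phi> B] by (simp add: a_def split: prod.split)
  obtain r where r: "strict_mono r" "\<And>p. \<exists>l. (\<lambda>k. a (r k) p) \<longlonglongrightarrow> l"
    by (rule function_convergent_subsequence[of "UNIV :: (nat \<times> (int^'n)) set" a, OF _ bound]) blast+
  have cauchy: "\<exists>K. \<forall>k\<ge>K. \<forall>l\<ge>K. (LINT x|M. \<bar>\<phi> (r k) x - \<phi> (r l) x\<bar>) \<le> e" if e: "e > 0" for e
  proof -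
    let ?m = "measure M (space M)" and ?c = "real (2 ^ CARD('n) * CARD('n))"
    have C0: "C \<ge> 0" using C[of 0] by (rule order_trans[rotated]) simp
    obtain N where N: "N > 0" "?c / real N * (?m + C) \<le> e / 4"
    proof -
      obtain n where n: "4 * ?c * (?m + C) / e < real n" using reals_Archimedean2 by blast
      then have "4 * ?c * (?m + C) < real (Suc n) * e" using e by (simp add: field_simps)
      then show ?thesis by (intro that[of "Suc n"]) (simp_all add: field_simps)
    qed
    let ?P = "\<lambda>k. cell_average N (\<phi> (r k))"
    have dev: "integrable M (\<lambda>x. \<phi> (r k) x - ?P k x)" "(LINT x|M. \<bar>\<phi> (r k) x - ?P k x\<bar>) \<le> e / 4" for k
    proof -
      show "integrable M (\<lambda>x. \<phi> (r k) x - ?P k x)" by (rule cell_average_deviation_L1(1)[OF \<phi> C N(1)])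
      show "(LINT x|M. \<bar>\<phi> (r k) x - ?P k x\<bar>) \<le> e / 4"
        by (rule order_trans[OF cell_average_deviation_L1(2)[OF \<phi> C N(1)] N(2)])
    qed
    have P: "integrable M (?P k)" for k
      using Bochner_Integration.integrable_diff[OF L2_integrable[OF test_L2(1)[OF \<phi>]] dev(1)[of k], of "r k"] by simp
    have meas[measurable]: "?P k \<in> borel_measurable M" for k by (rule borel_measurable_integrable[OF P])
    define Q where "Q x = lim (\<lambda>k. ?P k x)" for x
    have Q[measurable]: "Q \<in> borel_measurable M" unfolding Q_def by measurable
    have lim: "(\<lambda>k. ?P k x) \<longlonglongrightarrow> Q x" for x
    proof -
      obtain l where "(\<lambda>k. a (r k) (N, cell N x)) \<longlonglongrightarrow> l" using r(2) by blast
      then have "(\<lambda>k. real N ^ CARD('n) * a (r k) (N, cell N x)) \<longlonglongrightarrow> real N ^ CARD('n) * l" by (rule tendsto_mult_left)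
      then have "(\<lambda>k. ?P k x) \<longlonglongrightarrow> real N ^ CARD('n) * l" by (simp add: a_def cell_average_def)
      then show ?thesis unfolding Q_def by (simp add: limI)
    qed
    \<comment> \<open>A bound for the averages that is uniform in \<open>k\<close>; on a finite
      measure a constant serves as dominating function.\<close>
    let ?D = "real N ^ CARD('n) * (B * ?m)"
    have Pbound: "\<bar>?P k x\<bar> \<le> ?D" for k x
      using cell_integral_bound[OF \<phi> B, of N "cell N x" "r k"]
      by (simp add: cell_average_def abs_mult mult_left_mono)
    have Qbound: "\<bar>Q x\<bar> \<le> ?D" for x
      by (rule LIMSEQ_le_const2[OF tendsto_rabs[OF lim]]) (use Pbound in auto)
    have Qint: "integrable M Q"
      by (rule integrable_const_bound[where B="?D"]) (use Qbound Q in auto)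
    have "(\<lambda>k. LINT x|M. \<bar>?P k x - Q x\<bar>) \<longlonglongrightarrow> (LINT x|M. 0)"
    proof (rule integral_dominated_convergence[where w="\<lambda>_. 2 * ?D"])
      show "AE x in M. (\<lambda>k. \<bar>?P k x - Q x\<bar>) \<longlonglongrightarrow> 0"
        using lim by (intro AE_I2 tendsto_rabs_zero) (simp add: LIM_zero)
      show "AE x in M. norm \<bar>?P k x - Q x\<bar> \<le> 2 * ?D" for k
      proof (rule AE_I2)
        fix x
        show "norm \<bar>?P k x - Q x\<bar> \<le> 2 * ?D"
          using Pbound[of k x] Qbound[of x] abs_triangle_ineq4[of "?P k x" "Q x"] by simp
      qed
    qed simp_all
    then have "(\<lambda>k. LINT x|M. \<bar>?P k x - Q x\<bar>) \<longlonglongrightarrow> 0" by simp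
    then have "\<forall>\<^sub>F k in sequentially. (LINT x|M. \<bar>?P k x - Q x\<bar>) < e / 4"
      by (rule order_tendstoD(2)) (use e in simp)
    then obtain K where K: "\<And>k. k \<ge> K \<Longrightarrow> (LINT x|M. \<bar>?P k x - Q x\<bar>) < e / 4"
      by (auto simp: eventually_sequentially)
    have "(LINT x|M. \<bar>\<phi> (r k) x - \<phi> (r l) x\<bar>) \<le> e" if "k \<ge> K" "l \<ge> K" for k l
    proof -
      have i: "integrable M (\<lambda>x. \<phi> (r k) x - \<phi> (r l) x)"
        by (intro Bochner_Integration.integrable_diff L2_integrable test_L2 \<phi>)
      have "(LINT x|M. \<bar>\<phi> (r k) x - \<phi> (r l) x\<bar>) \<le>
         (LINT x|M. (\<bar>\<phi> (r k) x - ?P k x\<bar> + \<bar>?P k x - Q x\<bar>) + (\<bar>?P l x - Q x\<bar> + \<bar>\<phi> (r l) x - ?P l x\<bar>))"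
        using i P Qint dev(1) by (intro integral_mono) auto
      also have "\<dots> = ((LINT x|M. \<bar>\<phi> (r k) x - ?P k x\<bar>) + (LINT x|M. \<bar>?P k x - Q x\<bar>)) +
         ((LINT x|M. \<bar>?P l x - Q x\<bar>) + (LINT x|M. \<bar>\<phi> (r l) x - ?P l x\<bar>))"
        using P Qint dev(1) by simp
      finally show ?thesis using K[OF that(1)] K[OF that(2)] dev(2)[of k] dev(2)[of l] by linarith
    qed
    then show ?thesis by blast
  qed
  show ?thesis by (intro exI[of _ r] conjI allI impI r(1) cauchy)
qed

end

section \<open>Minimizing the energy\<close>

lemma clip_bounds: "0 \<le> \<delta> \<Longrightarrow> 0 \<le> clip \<delta> s" "0 \<le> \<delta> \<Longrightarrow> clip \<delta> s \<le> \<delta>"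
  by (simp_all add: clip_def)

lemma clip_idem: "0 \<le> \<delta> \<Longrightarrow> clip \<delta> (clip \<delta> s) = clip \<delta> s"
  by (simp add: clip_def)

lemma clip_lipschitz: "\<bar>clip \<delta> s - clip \<delta> t\<bar> \<le> \<bar>s - t\<bar>"
  by (simp add: clip_def max_def min_def)

lemma parallelogram:
  fixes a b :: "'a::real_inner"
  shows "(norm (a - b))\<^sup>2 = 2 * (norm a)\<^sup>2 + 2 * (norm b)\<^sup>2 - 4 * (norm ((1/2) *\<^sub>R a + (1/2) *\<^sub>R b))\<^sup>2"
  by (simp add: power2_norm_eq_inner inner_diff_left inner_diff_right inner_add_left inner_add_right inner_commute[of b a] field_simps)

text \<open>Here \<open>a\<close>, \<open>b\<close>, \<open>m\<close> are the energies of two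
  functions and of their midpoint, \<open>p\<close> and \<open>q\<close> the potential differences
  to the midpoint, \<open>I\<close> the infimum of the energy and \<open>J\<close> the
  \<open>L^1\<close> distance.\<close>

lemma parallelogram_arith:
  fixes a b m p q L J I X :: real
  assumes "X = 4 * a + 4 * b - 8 * m + 4 * p + 4 * q" "I \<le> m" "p \<le> L * (J / 2)" "q \<le> L * (J / 2)"
  shows "X \<le> 4 * (a - I) + 4 * (b - I) + 4 * L * J"
proof -
  have "p \<le> (L * J) / 2" "q \<le> (L * J) / 2" using assms(3,4) by simp_all
  with assms(1,2) have "X \<le> 4 * (a - I) + 4 * (b - I) + 4 * (L * J)"
    unfolding ring_distribs by linarith
  then show ?thesis by (simp add: mult.assoc)
qed

lemma energy_bound_arith:
  fixes g k I a c A :: real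
  shows "g / 2 - k \<le> I + a \<Longrightarrow> k \<le> c \<Longrightarrow> a \<le> A \<Longrightarrow> g \<le> 2 * (I + A + c)"
  unfolding ring_distribs by linarith

text \<open>Used with \<open>p\<close> a member of the sequence, \<open>u\<close> its limit,
  \<open>c\<close> a clipped value near \<open>p\<close>, and \<open>e\<close> the clipped
  limit.\<close>

lemma abs_chain:
  fixes u e p c a :: real
  assumes "\<bar>c - e\<bar> \<le> \<bar>c - p\<bar> + \<bar>p - u\<bar>" "\<bar>p - c\<bar> \<le> a"
  shows "\<bar>u - e\<bar> \<le> 2 * \<bar>p - u\<bar> + 2 * a"
proof -
  have "\<bar>u - e\<bar> \<le> \<bar>p - u\<bar> + \<bar>p - c\<bar> + \<bar>c - e\<bar>" by linarith
  also have "\<dots> \<le> \<bar>p - u\<bar> + a + (a + \<bar>p - u\<bar>)"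
    using assms by (intro add_mono order_refl) (simp_all add: abs_minus_commute[of c p])
  finally show ?thesis by simp
qed

section \<open>Energy with a globally Lipschitz potential\<close>

locale lipschitz_potential = bounded_open \<Omega> for \<Omega> :: "(real^'n) set" +
  fixes K :: "real \<Rightarrow> real" and L :: real
  assumes K_lipschitz: "\<And>s t. \<bar>K s - K t\<bar> \<le> L * \<bar>s - t\<bar>"
begin

lemma L_nonneg: "0 \<le> L"
  using K_lipschitz[of 0 1] by simp

lemma K_measurable [measurable]: "K \<in> borel_measurable borel"
proof (rule borel_measurable_continuous_onI)
  have "L-lipschitz_on UNIV K"
    using K_lipschitz L_nonneg by (intro lipschitz_onI) (simp_all add: dist_real_def)
  then show "continuous_on UNIV K" by (rule lipschitz_on_continuous_on)
qed

lemma K_integrable: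
  assumes "L2 M u"
  shows "integrable M (\<lambda>x. K (u x))"
proof (rule Bochner_Integration.integrable_bound)
  have [measurable]: "u \<in> borel_measurable M" using assms by (rule L2_measurable)
  show "integrable M (\<lambda>x. \<bar>K 0\<bar> + L * \<bar>u x\<bar>)" using L2_integrable[OF assms] by simp
  show "AE x in M. norm (K (u x)) \<le> norm (\<bar>K 0\<bar> + L * \<bar>u x\<bar>)"
  proof (rule AE_I2)
    fix x
    have "\<bar>K (u x) - K 0\<bar> \<le> L * \<bar>u x\<bar>" using K_lipschitz[of "u x" 0] by simp
    moreover have "0 \<le> L * \<bar>u x\<bar>" using L_nonneg by simp
    ultimately show "norm (K (u x)) \<le> norm (\<bar>K 0\<bar> + L * \<bar>u x\<bar>)"
      unfolding real_norm_def by linarith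
  qed
  show "(\<lambda>x. K (u x)) \<in> borel_measurable M" by measurable
qed

lemma K_integral_diff:
  assumes "L2 M u" "L2 M v"
  shows "\<bar>(LINT x|M. K (u x)) - (LINT x|M. K (v x))\<bar> \<le> L * (LINT x|M. \<bar>u x - v x\<bar>)"
proof -
  have "\<bar>(LINT x|M. K (u x)) - (LINT x|M. K (v x))\<bar> = \<bar>LINT x|M. K (u x) - K (v x)\<bar>"
    using assms by (simp add: K_integrable)
  also have "\<dots> \<le> (LINT x|M. \<bar>K (u x) - K (v x)\<bar>)" by (rule integral_abs_bound)
  also have "\<dots> \<le> (LINT x|M. L * \<bar>u x - v x\<bar>)"
    using assms K_integrable L2_integrable[OF L2_diff[OF assms]] K_lipschitz by (intro integral_mono) simp_all
  finally show ?thesis by simp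
qed

lemma K_integral_tendsto:
  assumes "\<And>k. L2 M (f k)" "L2 M u" "(\<lambda>k. LINT x|M. \<bar>f k x - u x\<bar>) \<longlonglongrightarrow> 0"
  shows "(\<lambda>k. LINT x|M. K (f k x)) \<longlonglongrightarrow> (LINT x|M. K (u x))"
proof -
  have "(\<lambda>k. L * (LINT x|M. \<bar>f k x - u x\<bar>)) \<longlonglongrightarrow> 0"
    using tendsto_mult_left[OF assms(3), of L] by simp
  then have "(\<lambda>k. (LINT x|M. K (f k x)) - (LINT x|M. K (u x))) \<longlonglongrightarrow> 0"
    by (rule Lim_null_comparison[rotated])
      (use K_integral_diff[OF assms(1,2)] in \<open>simp add: always_eventually\<close>)
  then show ?thesis by (rule LIM_zero_cancel)
qed

lemma L2_clip:
  assumes [measurable]: "\<phi> \<in> borel_measurable M" and "0 \<le> \<delta>"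
  shows "L2 M (\<lambda>x. clip \<delta> (\<phi> x))"
proof (rule L2_bounded)
  show "(\<lambda>x. clip \<delta> (\<phi> x)) \<in> borel_measurable M" unfolding clip_def by measurable
  show "AE x in M. norm (clip \<delta> (\<phi> x)) \<le> \<delta>"
    using clip_bounds[OF \<open>0 \<le> \<delta>\<close>] by (intro AE_I2) simp
qed

text \<open>Written with the classical \<open>gradient\<close>, hence applied to test functions
  only; statements about a limit \<open>u\<close> use its gradient \<open>g\<close>
  explicitly.\<close>

definition energy :: "(real^'n \<Rightarrow> real) \<Rightarrow> real" where
  "energy \<phi> = (LINT x|M. (norm (gradient \<phi> x))\<^sup>2) / 2 - (LINT x|M. K (\<phi> x))"

text \<open>The smooth truncation does not increase gradients and is uniformly within
  \<open>\<epsilon>\<close> of the sharp one, so the potential term changes by at most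
  \<open>L * \<epsilon>\<close> times the total measure.\<close>

lemma energy_clip:
  assumes \<phi>: "test \<phi>" and "\<delta> > 0" "\<epsilon> > 0"
  obtains \<psi> where "test \<psi>" "\<And>x. \<bar>\<psi> x - clip \<delta> (\<phi> x)\<bar> \<le> \<epsilon>"
    "energy \<psi> \<le> (LINT x|M. (norm (gradient \<phi> x))\<^sup>2) / 2 - (LINT x|M. K (clip \<delta> (\<phi> x))) + L * measure M (space M) * \<epsilon>"
proof -
  obtain \<psi> where \<psi>: "test \<psi>" "\<And>x. norm (gradient \<psi> x) \<le> norm (gradient \<phi> x)"
    "\<And>x. \<bar>\<psi> x - clip \<delta> (\<phi> x)\<bar> \<le> \<epsilon>"
    using soft_clip[OF \<phi> \<open>\<epsilon> > 0\<close> \<open>\<delta> > 0\<close>] by metis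
  have clip: "L2 M (\<lambda>x. clip \<delta> (\<phi> x))"
    using \<open>\<delta> > 0\<close> by (intro L2_clip test_function_measurable[OF \<phi>]) simp
  have "(LINT x|M. K (clip \<delta> (\<phi> x))) - (LINT x|M. K (\<psi> x)) \<le> L * (LINT x|M. \<bar>\<psi> x - clip \<delta> (\<phi> x)\<bar>)"
    using K_integral_diff[OF test_L2(1)[OF \<psi>(1)] clip] by (simp add: abs_le_iff)
  also have "\<dots> \<le> L * (LINT x|M. \<epsilon>)"
    using \<psi>(3) L_nonneg L2_integrable[OF L2_diff[OF test_L2(1)[OF \<psi>(1)] clip]]
    by (intro mult_left_mono integral_mono) simp_all
  also have "\<dots> = L * measure M (space M) * \<epsilon>" by simp
  finally have K: "(LINT x|M. K (clip \<delta> (\<phi> x))) - (LINT x|M. K (\<psi> x)) \<le> L * measure M (space M) * \<epsilon>" .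
  have "(LINT x|M. (norm (gradient \<psi> x))\<^sup>2) \<le> (LINT x|M. (norm (gradient \<phi> x))\<^sup>2)"
    using \<psi>(2) L2_integrable_square[OF test_L2(2)[OF \<psi>(1)]] L2_integrable_square[OF test_L2(2)[OF \<phi>]]
    by (intro integral_mono power_mono) simp_all
  with K have "energy \<psi> \<le> (LINT x|M. (norm (gradient \<phi> x))\<^sup>2) / 2 - (LINT x|M. K (clip \<delta> (\<phi> x))) + L * measure M (space M) * \<epsilon>"
    by (simp add: energy_def)
  from that[OF \<psi>(1) \<psi>(3) this] show ?thesis .
qed

text \<open>Takes the place of convexity: the midpoint has energy at least \<open>I\<close>, and the
  potential at the midpoint differs from that at the endpoints by at most \<open>L / 2\<close> times
  their \<open>L^1\<close> distance. Hence minimizing and \<open>L^1\<close>-Cauchy together imply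
  that the gradients are Cauchy.\<close>

lemma energy_parallelogram:
  assumes \<phi>: "test \<phi>" and \<psi>: "test \<psi>" and low: "\<And>\<omega>. test \<omega> \<Longrightarrow> I \<le> energy \<omega>"
  shows "(LINT x|M. (norm (gradient \<phi> x - gradient \<psi> x))\<^sup>2) \<le>
    4 * (energy \<phi> - I) + 4 * (energy \<psi> - I) + 4 * L * (LINT x|M. \<bar>\<phi> x - \<psi> x\<bar>)"
proof -
  let ?\<omega> = "\<lambda>x. (1/2) * \<phi> x + (1/2) * \<psi> x"
  have half: "test (\<lambda>x. (1/2) * \<phi> x)" "test (\<lambda>x. (1/2) * \<psi> x)"
    by (intro test_function_cmult \<phi> \<psi>)+
  have \<omega>: "test ?\<omega>" by (rule test_function_add[OF half])
  have grad: "gradient ?\<omega> x = (1/2) *\<^sub>R gradient \<phi> x + (1/2) *\<^sub>R gradient \<psi> x" for x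
    by (simp only: gradient_add[OF half] gradient_cmult[OF \<phi>] gradient_cmult[OF \<psi>])
  note sq = L2_integrable_square[OF test_L2(2)]
  have "(LINT x|M. (norm (gradient \<phi> x - gradient \<psi> x))\<^sup>2) =
     (LINT x|M. 2 * (norm (gradient \<phi> x))\<^sup>2 + 2 * (norm (gradient \<psi> x))\<^sup>2 - 4 * (norm (gradient ?\<omega> x))\<^sup>2)"
    unfolding grad by (simp only: parallelogram)
  also have "\<dots> = 2 * (LINT x|M. (norm (gradient \<phi> x))\<^sup>2) + 2 * (LINT x|M. (norm (gradient \<psi> x))\<^sup>2)
      - 4 * (LINT x|M. (norm (gradient ?\<omega> x))\<^sup>2)"
    using sq[OF \<phi>] sq[OF \<psi>] sq[OF \<omega>] by simp
  finally have eq: "(LINT x|M. (norm (gradient \<phi> x - gradient \<psi> x))\<^sup>2) =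
     4 * energy \<phi> + 4 * energy \<psi> - 8 * energy ?\<omega>
     + 4 * ((LINT x|M. K (\<phi> x)) - (LINT x|M. K (?\<omega> x))) + 4 * ((LINT x|M. K (\<psi> x)) - (LINT x|M. K (?\<omega> x)))"
    by (simp add: energy_def field_simps)
  let ?J = "LINT x|M. \<bar>\<phi> x - \<psi> x\<bar>"
  have "(LINT x|M. \<bar>\<phi> x - ?\<omega> x\<bar>) = (LINT x|M. (1/2) * \<bar>\<phi> x - \<psi> x\<bar>)"
    "(LINT x|M. \<bar>\<psi> x - ?\<omega> x\<bar>) = (LINT x|M. (1/2) * \<bar>\<phi> x - \<psi> x\<bar>)"
    by (intro Bochner_Integration.integral_cong; simp add: abs_if field_simps)+
  then have d: "(LINT x|M. \<bar>\<phi> x - ?\<omega> x\<bar>) = ?J / 2" "(LINT x|M. \<bar>\<psi> x - ?\<omega> x\<bar>) = ?J / 2" by simp_all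
  have "(LINT x|M. K (\<phi> x)) - (LINT x|M. K (?\<omega> x)) \<le> L * (?J / 2)"
    "(LINT x|M. K (\<psi> x)) - (LINT x|M. K (?\<omega> x)) \<le> L * (?J / 2)"
    using K_integral_diff[OF test_L2(1)[OF \<phi>] test_L2(1)[OF \<omega>]] K_integral_diff[OF test_L2(1)[OF \<psi>] test_L2(1)[OF \<omega>]]
    unfolding d by linarith+
  with eq low[OF \<omega>] show ?thesis by (rule parallelogram_arith)
qed

text \<open>Records what survives the limit of a minimizing sequence: the first inequality is the
  expanded comparison of \<open>u\<close> with \<open>u + t * v\<close>, the second compares
  \<open>u\<close> with an arbitrary test function.\<close>

definition energy_minimizer :: "real \<Rightarrow> (real^'n \<Rightarrow> real) \<Rightarrow> (real^'n \<Rightarrow> real^'n) \<Rightarrow> bool" where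
  "energy_minimizer \<delta> u g \<longleftrightarrow> H01_pair u g \<and> (AE x in M. 0 \<le> u x \<and> u x \<le> \<delta>) \<and>
     (\<forall>v t. test v \<longrightarrow> (LINT x|M. K (u x + t * v x)) - (LINT x|M. K (u x)) \<le>
        t * (LINT x|M. g x \<bullet> gradient v x) + t\<^sup>2 / 2 * (LINT x|M. (norm (gradient v x))\<^sup>2)) \<and>
     (\<forall>v. test v \<longrightarrow> (LINT x|M. (norm (g x))\<^sup>2) / 2 - (LINT x|M. K (u x)) \<le> energy v)"

text \<open>An upper bound for \<open>K\<close> makes the infimum finite. A near-minimizer may be
  truncated because \<open>clip\<close> raises the potential. The constant \<open>A\<close> is
  \<open>1 + L\<close> times the measure: one part is the distance to the infimum, the other the
  smoothing error.\<close>

lemma minimizing_sequence: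
  assumes bound: "\<And>s. K s \<le> C" and clip: "\<And>s. K s \<le> K (clip \<delta> s)" and \<delta>: "\<delta> > 0"
  obtains \<psi> :: "nat \<Rightarrow> real^'n \<Rightarrow> real" and I A :: real where
    "\<And>k. test (\<psi> k)" "\<And>\<phi>. test \<phi> \<Longrightarrow> I \<le> energy \<phi>" "0 \<le> A" "\<And>k. energy (\<psi> k) \<le> I + A / Suc k"
    "\<And>k x. \<exists>s. \<bar>\<psi> k x - clip \<delta> s\<bar> \<le> 1 / Suc k"
proof -
  let ?m = "measure M (space M)"
  have low: "- (C * ?m) \<le> energy \<phi>" if "test \<phi>" for \<phi>
  proof -
    have "(LINT x|M. K (\<phi> x)) \<le> (LINT x|M. C)"
      using bound K_integrable[OF test_L2(1)[OF that]] by (intro integral_mono) simp_all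
    moreover have "0 \<le> (LINT x|M. (norm (gradient \<phi> x))\<^sup>2)" by simp
    moreover have "(LINT x|M. C) = C * ?m" by simp
    ultimately show ?thesis unfolding energy_def by linarith
  qed
  define S where "S = energy ` Collect test"
  define I where "I = Inf S"
  have ne: "S \<noteq> {}" unfolding S_def using test_function_0 by blast
  have bdd: "bdd_below S" unfolding S_def bdd_below_def using low by blast
  have I: "I \<le> energy \<phi>" if "test \<phi>" for \<phi>
    unfolding I_def using that by (intro cInf_lower bdd) (simp add: S_def)
  have "\<exists>\<psi>. test \<psi> \<and> energy \<psi> \<le> I + (1 + L * ?m) / Suc k \<and> (\<forall>x. \<exists>s. \<bar>\<psi> x - clip \<delta> s\<bar> \<le> 1 / Suc k)" for k
  proof -
    have "Inf S < I + 1 / Suc k" by (simp add: I_def)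
    then have "\<exists>y\<in>S. y < I + 1 / Suc k" by (simp add: cInf_less_iff[OF ne bdd])
    then obtain \<phi> where \<phi>: "test \<phi>" "energy \<phi> < I + 1 / Suc k"
      unfolding S_def by blast
    have eps: "1 / real (Suc k) > 0" by simp
    obtain \<psi> where \<psi>: "test \<psi>" "\<And>x. \<bar>\<psi> x - clip \<delta> (\<phi> x)\<bar> \<le> 1 / Suc k"
      "energy \<psi> \<le> (LINT x|M. (norm (gradient \<phi> x))\<^sup>2) / 2 - (LINT x|M. K (clip \<delta> (\<phi> x))) + L * ?m * (1 / Suc k)"
      by (rule energy_clip[OF \<phi>(1) \<delta> eps]) blast
    have "L2 M (\<lambda>x. clip \<delta> (\<phi> x))"
      using \<delta> by (intro L2_clip test_function_measurable[OF \<phi>(1)]) simp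
    then have "(LINT x|M. K (\<phi> x)) \<le> (LINT x|M. K (clip \<delta> (\<phi> x)))"
      by (intro integral_mono K_integrable test_L2(1)[OF \<phi>(1)] clip)
    with \<psi>(3) \<phi>(2) have "energy \<psi> \<le> I + 1 / Suc k + L * ?m * (1 / Suc k)"
      unfolding energy_def by linarith
    also have "\<dots> = I + (1 + L * ?m) / Suc k" by (simp add: add_divide_distrib)
    finally show ?thesis using \<psi>(1,2) by blast
  qed
  then obtain \<psi> where \<psi>: "\<And>k. test (\<psi> k) \<and> energy (\<psi> k) \<le> I + (1 + L * ?m) / Suc k \<and> (\<forall>x. \<exists>s. \<bar>\<psi> k x - clip \<delta> s\<bar> \<le> 1 / Suc k)"
    by metis
  show ?thesis
    by (rule that[of \<psi> I "1 + L * ?m"]) (use \<psi> I L_nonneg in \<open>simp_all add: add_nonneg_nonneg\<close>)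
qed

lemma minimizing_sequence_compact:
  fixes \<psi> :: "nat \<Rightarrow> real^'n \<Rightarrow> real"
  assumes bound: "\<And>s. K s \<le> C" and \<delta>: "\<delta> > 0"
    and \<psi>: "\<And>k. test (\<psi> k)" and I: "\<And>\<phi>. test \<phi> \<Longrightarrow> I \<le> energy \<phi>" and A: "0 \<le> A"
    and E: "\<And>k. energy (\<psi> k) \<le> I + A / Suc k" and close: "\<And>k x. \<exists>s. \<bar>\<psi> k x - clip \<delta> s\<bar> \<le> 1 / Suc k"
  obtains r u g where "strict_mono r" "L2 M u" "L2 M g"
    "(\<lambda>k. LINT x|M. (norm (\<psi> (r k) x - u x))\<^sup>2) \<longlonglongrightarrow> 0"
    "(\<lambda>k. LINT x|M. (norm (gradient (\<psi> (r k)) x - g x))\<^sup>2) \<longlonglongrightarrow> 0"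
proof -
  let ?m = "measure M (space M)"
  have B: "\<bar>\<psi> k x\<bar> \<le> \<delta> + 1" for k x
  proof -
    obtain s where "\<bar>\<psi> k x - clip \<delta> s\<bar> \<le> 1 / Suc k" using close by blast
    moreover have "1 / real (Suc k) \<le> 1" by simp
    moreover have "0 \<le> clip \<delta> s" "clip \<delta> s \<le> \<delta>" using \<delta> clip_bounds[of \<delta>] by simp_all
    ultimately show ?thesis by linarith
  qed
  have G: "(LINT x|M. (norm (gradient (\<psi> k) x))\<^sup>2) \<le> 2 * (I + A + C * ?m)" for k
  proof -
    have "(LINT x|M. K (\<psi> k x)) \<le> (LINT x|M. C)"
      using bound K_integrable[OF test_L2(1)[OF \<psi>]] by (intro integral_mono) simp_all
    also have "\<dots> = C * ?m" by simp
    finally have "(LINT x|M. K (\<psi> k x)) \<le> C * ?m" .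
    moreover have "A / Suc k \<le> A" using A by (simp add: divide_le_eq ring_distribs)
    ultimately show ?thesis by (rule energy_bound_arith[OF E[of k, unfolded energy_def]])
  qed
  obtain r :: "nat \<Rightarrow> nat" where r: "strict_mono r"
    "\<forall>e>0. \<exists>N. \<forall>k\<ge>N. \<forall>l\<ge>N. (LINT x|M. \<bar>\<psi> (r k) x - \<psi> (r l) x\<bar>) \<le> e"
    using rellich[of \<psi>, OF \<psi> B G] by (elim exE conjE) (rule that)
  have int: "integrable M (\<lambda>x. \<bar>\<psi> k x - \<psi> l x\<bar>)" for k l
    using L2_integrable[OF L2_diff[OF test_L2(1)[OF \<psi>] test_L2(1)[OF \<psi>]]] by simp
  have "\<exists>N. \<forall>k\<ge>N. \<forall>l\<ge>N. (LINT x|M. (norm (\<psi> (r k) x - \<psi> (r l) x))\<^sup>2) \<le> e" if e: "e > 0" for e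
  proof -
    \<comment> \<open>\<open>?B\<close> bounds the differences of members, so the square of a
      difference is at most \<open>?B\<close> times its modulus and the \<open>L^1\<close> estimate
      becomes an \<open>L^2\<close> estimate.\<close>
    let ?B = "2 * (\<delta> + 1)"
    have e': "e / ?B > 0" using e \<delta> by simp
    obtain N where N: "\<And>k l. k \<ge> N \<Longrightarrow> l \<ge> N \<Longrightarrow> (LINT x|M. \<bar>\<psi> (r k) x - \<psi> (r l) x\<bar>) \<le> e / ?B"
      using r(2)[rule_format, OF e'] by blast
    have "(LINT x|M. (norm (\<psi> (r k) x - \<psi> (r l) x))\<^sup>2) \<le> e" if "k \<ge> N" "l \<ge> N" for k l
    proof -
      have "(LINT x|M. (norm (\<psi> (r k) x - \<psi> (r l) x))\<^sup>2) \<le> (LINT x|M. ?B * \<bar>\<psi> (r k) x - \<psi> (r l) x\<bar>)"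
      proof (rule integral_mono)
        show "integrable M (\<lambda>x. (norm (\<psi> (r k) x - \<psi> (r l) x))\<^sup>2)"
          by (rule L2_integrable_square[OF L2_diff[OF test_L2(1)[OF \<psi>] test_L2(1)[OF \<psi>]]])
        show "integrable M (\<lambda>x. ?B * \<bar>\<psi> (r k) x - \<psi> (r l) x\<bar>)" using int by simp
        fix x
        have "\<bar>\<psi> (r k) x - \<psi> (r l) x\<bar> \<le> (\<delta> + 1) + (\<delta> + 1)" using B[of "r k" x] B[of "r l" x] by linarith
        then have "\<bar>\<psi> (r k) x - \<psi> (r l) x\<bar> \<le> ?B" by simp
        then have "\<bar>\<psi> (r k) x - \<psi> (r l) x\<bar> * \<bar>\<psi> (r k) x - \<psi> (r l) x\<bar> \<le> ?B * \<bar>\<psi> (r k) x - \<psi> (r l) x\<bar>"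
          by (rule mult_right_mono) simp
        then show "(norm (\<psi> (r k) x - \<psi> (r l) x))\<^sup>2 \<le> ?B * \<bar>\<psi> (r k) x - \<psi> (r l) x\<bar>"
          by (simp only: power2_eq_square real_norm_def)
      qed
      also have "\<dots> = ?B * (LINT x|M. \<bar>\<psi> (r k) x - \<psi> (r l) x\<bar>)" by simp
      also have "\<dots> \<le> ?B * (e / ?B)" using N[OF that] \<delta> by (intro mult_left_mono) simp_all
      also have "\<dots> = e" using \<delta> by simp
      finally show ?thesis .
    qed
    then show ?thesis by blast
  qed
  then obtain u where u: "L2 M u" "(\<lambda>k. LINT x|M. (norm (\<psi> (r k) x - u x))\<^sup>2) \<longlonglongrightarrow> 0"
    using L2_complete[of M "\<lambda>k. \<psi> (r k)", OF test_L2(1)[OF \<psi>]] by blast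
  have "\<exists>N. \<forall>k\<ge>N. \<forall>l\<ge>N. (LINT x|M. (norm (gradient (\<psi> (r k)) x - gradient (\<psi> (r l)) x))\<^sup>2) \<le> e" if e: "e > 0" for e
  proof -
    \<comment> \<open>\<open>L + 1\<close> keeps the quotient meaningful for \<open>L = 0\<close>.
      The potential error then takes \<open>e / 2\<close>, and each of the two energy excesses
      \<open>e / 4\<close>.\<close>
    have e': "e / (8 * (L + 1)) > 0" using e L_nonneg by simp
    obtain N1 where N1: "\<And>k l. k \<ge> N1 \<Longrightarrow> l \<ge> N1 \<Longrightarrow> (LINT x|M. \<bar>\<psi> (r k) x - \<psi> (r l) x\<bar>) \<le> e / (8 * (L + 1))"
      using r(2)[rule_format, OF e'] by blast
    obtain N2 :: nat where N2: "16 * A / e < N2" using reals_Archimedean2 by blast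
    have small: "4 * (energy (\<psi> (r k)) - I) \<le> e / 4" if "k \<ge> N2" for k
    proof -
      have "real N2 \<le> Suc (r k)" using that seq_suble[OF r(1), of k] by simp
      with N2 have "16 * A / e < real (Suc (r k))" by linarith
      then have "16 * A < real (Suc (r k)) * e" using e by (simp add: pos_divide_less_eq)
      then have "A / Suc (r k) \<le> e / 16" by (simp add: field_simps)
      then have "energy (\<psi> (r k)) - I \<le> e / 16" using E[of "r k"] by linarith
      then show ?thesis by simp
    qed
    have "(LINT x|M. (norm (gradient (\<psi> (r k)) x - gradient (\<psi> (r l)) x))\<^sup>2) \<le> e"
      if k: "k \<ge> max N1 N2" and l: "l \<ge> max N1 N2" for k l
    proof -
      have "4 * L * (LINT x|M. \<bar>\<psi> (r k) x - \<psi> (r l) x\<bar>) \<le> 4 * (L + 1) * (e / (8 * (L + 1)))"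
        using N1[of k l] k l L_nonneg by (intro mult_mono) simp_all
      also have "\<dots> = e / 2" using L_nonneg by (simp add: field_simps)
      finally show ?thesis
        using energy_parallelogram[OF \<psi> \<psi> I, of "r k" "r l"] small[of k] small[of l] k l by simp
    qed
    then show ?thesis by blast
  qed
  then obtain g where g: "L2 M g" "(\<lambda>k. LINT x|M. (norm (gradient (\<psi> (r k)) x - g x))\<^sup>2) \<longlonglongrightarrow> 0"
    using L2_complete[of M "\<lambda>k. gradient (\<psi> (r k))", OF test_L2(2)[OF \<psi>]] by blast
  from that[OF r(1) u(1) g(1) u(2) g(2)] show ?thesis .
qed

text \<open>\<open>clip\<close> is 1-Lipschitz and fixes clipped values, so the distance of
  \<open>u\<close> to its own truncation is controlled by its distance to \<open>\<psi> k\<close>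
  and by \<open>a k\<close>. In the limit the integral of that distance vanishes.\<close>

lemma L1_limit_in_interval:
  fixes \<psi> :: "nat \<Rightarrow> real^'n \<Rightarrow> real"
  assumes \<delta>: "\<delta> > 0" and \<psi>: "\<And>k. L2 M (\<psi> k)" and u: "L2 M u"
    and close: "\<And>k x. \<exists>s. \<bar>\<psi> k x - clip \<delta> s\<bar> \<le> a k" and a: "a \<longlonglongrightarrow> 0"
    and lim: "(\<lambda>k. LINT x|M. \<bar>\<psi> k x - u x\<bar>) \<longlonglongrightarrow> 0"
  shows "AE x in M. 0 \<le> u x \<and> u x \<le> \<delta>"
proof -
  have "L2 M (\<lambda>x. clip \<delta> (u x))" using \<delta> by (intro L2_clip L2_measurable[OF u]) simp
  then have int: "integrable M (\<lambda>x. u x - clip \<delta> (u x))"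
    by (intro L2_integrable L2_diff[OF u])
  have "(LINT x|M. \<bar>u x - clip \<delta> (u x)\<bar>) \<le> 2 * (LINT x|M. \<bar>\<psi> k x - u x\<bar>) + 2 * a k * measure M (space M)" for k
  proof -
    have "(LINT x|M. \<bar>u x - clip \<delta> (u x)\<bar>) \<le> (LINT x|M. 2 * \<bar>\<psi> k x - u x\<bar> + 2 * a k)"
    proof (rule integral_mono)
      show "integrable M (\<lambda>x. 2 * \<bar>\<psi> k x - u x\<bar> + 2 * a k)"
        using L2_integrable[OF L2_diff[OF \<psi> u]] by simp
      fix x
      obtain s where s: "\<bar>\<psi> k x - clip \<delta> s\<bar> \<le> a k" using close by blast
      have "\<bar>clip \<delta> (clip \<delta> s) - clip \<delta> (\<psi> k x)\<bar> \<le> \<bar>clip \<delta> s - \<psi> k x\<bar>" by (rule clip_lipschitz)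
      moreover have "clip \<delta> (clip \<delta> s) = clip \<delta> s" using \<delta> by (simp add: clip_idem)
      moreover have "\<bar>clip \<delta> (\<psi> k x) - clip \<delta> (u x)\<bar> \<le> \<bar>\<psi> k x - u x\<bar>" by (rule clip_lipschitz)
      ultimately have "\<bar>clip \<delta> s - clip \<delta> (u x)\<bar> \<le> \<bar>clip \<delta> s - \<psi> k x\<bar> + \<bar>\<psi> k x - u x\<bar>" by linarith
      then show "\<bar>u x - clip \<delta> (u x)\<bar> \<le> 2 * \<bar>\<psi> k x - u x\<bar> + 2 * a k" using s by (rule abs_chain)
    qed (use int in simp)
    also have "\<dots> = 2 * (LINT x|M. \<bar>\<psi> k x - u x\<bar>) + 2 * a k * measure M (space M)"
      using L2_integrable[OF L2_diff[OF \<psi> u]] by simp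
    finally show ?thesis .
  qed
  moreover have "(\<lambda>k. 2 * (LINT x|M. \<bar>\<psi> k x - u x\<bar>) + 2 * a k * measure M (space M)) \<longlonglongrightarrow> 2 * 0 + 2 * 0 * measure M (space M)"
    by (intro tendsto_intros lim a)
  ultimately have "(LINT x|M. \<bar>u x - clip \<delta> (u x)\<bar>) \<le> 2 * 0 + 2 * 0 * measure M (space M)"
    by (intro LIMSEQ_le_const) auto
  then have "(LINT x|M. \<bar>u x - clip \<delta> (u x)\<bar>) \<le> 0" by simp
  then have "(LINT x|M. \<bar>u x - clip \<delta> (u x)\<bar>) = 0"
    by (intro antisym integral_nonneg_AE) simp_all
  then have "AE x in M. \<bar>u x - clip \<delta> (u x)\<bar> = 0"
    using integral_nonneg_eq_0_iff_AE[OF integrable_abs[OF int]] by simp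
  then show ?thesis
  proof (rule eventually_mono)
    fix x assume "\<bar>u x - clip \<delta> (u x)\<bar> = 0"
    then have "u x = clip \<delta> (u x)" by simp
    then show "0 \<le> u x \<and> u x \<le> \<delta>" using \<delta> clip_bounds[of \<delta> "u x"] by simp
  qed
qed

theorem energy_minimizer_exists:
  assumes bound: "\<And>s. K s \<le> C" and clip: "\<And>s. K s \<le> K (clip \<delta> s)" and \<delta>: "\<delta> > 0"
  shows "\<exists>u g. energy_minimizer \<delta> u g"
proof -
  obtain \<psi> :: "nat \<Rightarrow> real^'n \<Rightarrow> real" and I A where \<psi>: "\<And>k. test (\<psi> k)" and I: "\<And>\<phi>. test \<phi> \<Longrightarrow> I \<le> energy \<phi>"
    and A: "0 \<le> A" and E: "\<And>k. energy (\<psi> k) \<le> I + A / Suc k"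
    and close: "\<And>k x. \<exists>s. \<bar>\<psi> k x - clip \<delta> s\<bar> \<le> 1 / Suc k"
    by (rule minimizing_sequence[OF bound clip \<delta>]) blast
  obtain r u g where r: "strict_mono r" and u: "L2 M u" and g: "L2 M g"
    and lim: "(\<lambda>k. LINT x|M. (norm (\<psi> (r k) x - u x))\<^sup>2) \<longlonglongrightarrow> 0"
      "(\<lambda>k. LINT x|M. (norm (gradient (\<psi> (r k)) x - g x))\<^sup>2) \<longlonglongrightarrow> 0"
    by (rule minimizing_sequence_compact[OF bound \<delta> \<psi> I A E close]) blast
  have inv: "(\<lambda>k. 1 / Suc (r k)) \<longlonglongrightarrow> 0"
    using LIMSEQ_subseq_LIMSEQ[OF LIMSEQ_inverse_real_of_nat r] by (simp add: o_def inverse_eq_divide)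
  have L1: "(\<lambda>k. LINT x|M. \<bar>\<psi> (r k) x - u x\<bar>) \<longlonglongrightarrow> 0"
    using L2_tendsto_L1[OF test_L2(1)[OF \<psi>] u lim(1)] by simp
  have pair: "H01_pair u g"
    unfolding H01_pair_def by (intro conjI u g exI[of _ "\<lambda>k. \<psi> (r k)"] allI \<psi> lim)
  have range: "AE x in M. 0 \<le> u x \<and> u x \<le> \<delta>"
    by (rule L1_limit_in_interval[OF \<delta> test_L2(1)[OF \<psi>] u close inv L1])
  let ?G = "LINT x|M. (norm (g x))\<^sup>2"
  have G: "(\<lambda>k. LINT x|M. (norm (gradient (\<psi> (r k)) x))\<^sup>2) \<longlonglongrightarrow> ?G"
    by (rule L2_tendsto_norm_square[OF test_L2(2)[OF \<psi>] g lim(2)])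
  have K: "(\<lambda>k. LINT x|M. K (\<psi> (r k) x + t * v x)) \<longlonglongrightarrow> (LINT x|M. K (u x + t * v x))" if v: "test v" for v t
  proof (rule K_integral_tendsto)
    have tv: "L2 M (\<lambda>x. t * v x)" by (rule L2_cmult[OF test_L2(1)[OF v]])
    show "L2 M (\<lambda>x. \<psi> (r k) x + t * v x)" for k by (rule L2_add[OF test_L2(1)[OF \<psi>] tv])
    show "L2 M (\<lambda>x. u x + t * v x)" by (rule L2_add[OF u tv])
    show "(\<lambda>k. LINT x|M. \<bar>\<psi> (r k) x + t * v x - (u x + t * v x)\<bar>) \<longlonglongrightarrow> 0" using L1 by simp
  qed
  \<comment> \<open>Strong convergence of the gradients makes the energies converge to that of the
    limit. Every perturbed energy is at least \<open>I\<close>, so this bound is what turns the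
    limit of the perturbed energies into a variational inequality for \<open>u\<close>.\<close>
  have E0: "?G / 2 - (LINT x|M. K (u x)) \<le> I"
  proof (rule LIMSEQ_le)
    show "(\<lambda>k. energy (\<psi> (r k))) \<longlonglongrightarrow> ?G / 2 - (LINT x|M. K (u x))"
      unfolding energy_def using K[OF test_function_0, of 0] by (intro tendsto_intros G) simp_all
    have "(\<lambda>k. I + A * (1 / Suc (r k))) \<longlonglongrightarrow> I + A * 0" by (intro tendsto_intros inv)
    then show "(\<lambda>k. I + A / Suc (r k)) \<longlonglongrightarrow> I" by simp
    show "\<exists>N. \<forall>n\<ge>N. energy (\<psi> (r n)) \<le> I + A / Suc (r n)" using E by blast
  qed
  have var: "(LINT x|M. K (u x + t * v x)) - (LINT x|M. K (u x)) \<le>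
        t * (LINT x|M. g x \<bullet> gradient v x) + t\<^sup>2 / 2 * (LINT x|M. (norm (gradient v x))\<^sup>2)" if v: "test v" for v t
  proof -
    let ?V = "LINT x|M. (norm (gradient v x))\<^sup>2"
    have tv: "test (\<lambda>x. t * v x)" by (rule test_function_cmult[OF v])
    have en: "energy (\<lambda>x. \<psi> (r k) x + t * v x) = ((LINT x|M. (norm (gradient (\<psi> (r k)) x))\<^sup>2)
        + 2 * t * (LINT x|M. gradient (\<psi> (r k)) x \<bullet> gradient v x) + t\<^sup>2 * ?V) / 2
        - (LINT x|M. K (\<psi> (r k) x + t * v x))" for k
      unfolding energy_def gradient_add[OF \<psi> tv] gradient_cmult[OF v]
      by (simp only: L2_norm_square_add[OF test_L2(2)[OF \<psi>] test_L2(2)[OF v]])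
    have "(\<lambda>k. energy (\<lambda>x. \<psi> (r k) x + t * v x)) \<longlonglongrightarrow>
      (?G + 2 * t * (LINT x|M. g x \<bullet> gradient v x) + t\<^sup>2 * ?V) / 2 - (LINT x|M. K (u x + t * v x))"
      unfolding en by (intro tendsto_intros G K[OF v] L2_tendsto_inner[OF test_L2(2)[OF \<psi>] g test_L2(2)[OF v] lim(2)]) simp
    moreover have "I \<le> energy (\<lambda>x. \<psi> (r k) x + t * v x)" for k
      by (rule I[OF test_function_add[OF \<psi> tv]])
    ultimately have "I \<le> (?G + 2 * t * (LINT x|M. g x \<bullet> gradient v x) + t\<^sup>2 * ?V) / 2 - (LINT x|M. K (u x + t * v x))"
      by (intro LIMSEQ_le_const) auto
    with E0 show ?thesis by (simp add: field_simps)
  qed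
  have low: "?G / 2 - (LINT x|M. K (u x)) \<le> energy v" if "test v" for v
    using E0 I[OF that] by simp
  have "energy_minimizer \<delta> u g"
    unfolding energy_minimizer_def by (intro conjI allI impI pair range var low)
  then show ?thesis by blast
qed

end

section \<open>The Euler-Lagrange inclusion\<close>

lemma le_of_le_add_small:
  fixes a b c t0 :: real
  assumes "t0 > 0" "\<And>t. 0 < t \<Longrightarrow> t < t0 \<Longrightarrow> a \<le> b + t * c"
  shows "a \<le> b"
proof (rule ccontr)
  assume "\<not> a \<le> b"
  \<comment> \<open>The second entry keeps \<open>t * c\<close> at most half of the supposed gap
    \<open>a - b\<close>; the first keeps \<open>t\<close> below \<open>t0\<close>.\<close>
  define t where "t = min (t0 / 2) ((a - b) / (2 * (\<bar>c\<bar> + 1)))"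
  have "0 < t" using assms(1) \<open>\<not> a \<le> b\<close> by (simp add: t_def)
  moreover have "t \<le> t0 / 2" unfolding t_def by (rule min.cobounded1)
  ultimately have t: "0 < t" "t < t0" using assms(1) by linarith+
  have "t * c \<le> t * (\<bar>c\<bar> + 1)" using t by (intro mult_left_mono) auto
  also have "\<dots> \<le> (a - b) / (2 * (\<bar>c\<bar> + 1)) * (\<bar>c\<bar> + 1)"
    by (intro mult_right_mono) (auto simp: t_def)
  also have "\<dots> = (a - b) / 2" by (simp add: field_simps)
  finally show False using assms(2)[OF t] \<open>\<not> a \<le> b\<close> by simp
qed

lemma linear_quadratic_nonneg_eq_0:
  fixes a V :: real
  assumes "\<And>t. 0 \<le> t * a + t\<^sup>2 / 2 * V"
  shows "a = 0"
proof (rule antisym)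
  have *: "0 \<le> s * b" if "\<And>t. 0 < t \<Longrightarrow> 0 \<le> t * (s * b) + t\<^sup>2 / 2 * V" for s b
  proof (rule le_of_le_add_small[of 1])
    fix t :: real assume t: "0 < t"
    have "0 \<le> t * (s * b + t * (V / 2))" using that[OF t] by (simp add: algebra_simps power2_eq_square)
    then show "0 \<le> s * b + t * (V / 2)" using t by (simp add: zero_le_mult_iff)
  qed simp
  show "0 \<le> a" using *[of 1 a] assms by simp
  have "0 \<le> (-1) * a"
  proof (rule *)
    fix t :: real
    show "0 \<le> t * ((-1) * a) + t\<^sup>2 / 2 * V" using assms[of "- t"] by simp
  qed
  then show "a \<le> 0" by simp
qed

section \<open>Representation of functionals bounded in \<open>L^1\<close>\<close>

context bounded_open
begin

text \<open>The representing function is the \<open>L^2\<close> limit of a minimizing sequence of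
  \<open>J\<close>, half the square norm minus \<open>ell\<close>. The \<open>L^1\<close> bound and
  \<open>(\<bar>\<phi> x\<bar> - L)\<^sup>2 \<ge> 0\<close> bound \<open>J\<close> below on a finite
  measure, the parallelogram identity makes the sequence Cauchy, and the first variation of
  \<open>J\<close> at the limit vanishes.\<close>

lemma riesz_test:
  fixes ell :: "(real^'n \<Rightarrow> real) \<Rightarrow> real"
  assumes linear: "\<And>\<phi> \<psi> c. test \<phi> \<Longrightarrow> test \<psi> \<Longrightarrow> ell (\<lambda>x. \<phi> x + c * \<psi> x) = ell \<phi> + c * ell \<psi>"
    and bound: "\<And>\<phi>. test \<phi> \<Longrightarrow> \<bar>ell \<phi>\<bar> \<le> L * (LINT x|M. \<bar>\<phi> x\<bar>)"
  shows "\<exists>\<xi>. L2 M \<xi> \<and> (\<forall>v. test v \<longrightarrow> ell v = (LINT x|M. \<xi> x * v x))"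
proof -
  define J where "J \<phi> = (LINT x|M. (norm (\<phi> x))\<^sup>2) / 2 - ell \<phi>" for \<phi>
  have low: "- (L\<^sup>2 / 2 * measure M (space M)) \<le> J \<phi>" if \<phi>: "test \<phi>" for \<phi>
  proof -
    have i: "integrable M (\<lambda>x. (norm (\<phi> x))\<^sup>2)" "integrable M (\<lambda>x. \<bar>\<phi> x\<bar>)"
      using L2_integrable_square[OF test_L2(1)[OF \<phi>]] L2_integrable[OF test_L2(1)[OF \<phi>]] by simp_all
    have "(LINT x|M. - (L\<^sup>2 / 2)) \<le> (LINT x|M. (norm (\<phi> x))\<^sup>2 / 2 - L * \<bar>\<phi> x\<bar>)"
    proof (rule integral_mono)
      fix x
      have "0 \<le> (\<bar>\<phi> x\<bar> - L)\<^sup>2" by simp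
      then show "- (L\<^sup>2 / 2) \<le> (norm (\<phi> x))\<^sup>2 / 2 - L * \<bar>\<phi> x\<bar>"
        by (simp add: power2_diff field_simps)
    qed (use i in simp_all)
    also have "\<dots> = (LINT x|M. (norm (\<phi> x))\<^sup>2) / 2 - L * (LINT x|M. \<bar>\<phi> x\<bar>)" using i by simp
    also have "\<dots> \<le> J \<phi>" using bound[OF \<phi>] by (simp add: J_def abs_le_iff)
    finally show ?thesis by (simp add: mult.commute)
  qed
  define S where "S = J ` Collect test"
  have ne: "S \<noteq> {}" unfolding S_def using test_function_0 by blast
  have bdd: "bdd_below S" unfolding S_def bdd_below_def using low by blast
  define I where "I = Inf S"
  have I: "I \<le> J \<phi>" if "test \<phi>" for \<phi>
    unfolding I_def using that by (intro cInf_lower bdd) (simp add: S_def)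
  have "\<exists>\<phi>. test \<phi> \<and> J \<phi> < I + 1 / Suc k" for k
  proof -
    have "Inf S < I + 1 / Suc k" by (simp add: I_def)
    then have "\<exists>y\<in>S. y < I + 1 / Suc k" by (simp add: cInf_less_iff[OF ne bdd])
    then show ?thesis unfolding S_def by blast
  qed
  then obtain \<phi> where \<phi>: "\<And>k. test (\<phi> k)" "\<And>k. J (\<phi> k) < I + 1 / Suc k" by metis
  have ell0: "ell (\<lambda>x. c * \<psi> x) = c * ell \<psi>" if \<psi>: "test \<psi>" for \<psi> c
  proof -
    \<comment> \<open>Linearity at the zero function reads \<open>ell 0 = ell 0 + ell 0\<close>, so
      the value is 0 and homogeneity follows.\<close>
    have "ell (\<lambda>x. 0 + 1 * 0) = ell (\<lambda>x. 0) + 1 * ell (\<lambda>x. 0)" by (rule linear) simp_all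
    then show ?thesis using linear[OF test_function_0 \<psi>, of c] by simp
  qed
  have par: "(LINT x|M. (norm (\<phi> k x - \<phi> l x))\<^sup>2) \<le> 4 / Suc k + 4 / Suc l" for k l
  proof -
    let ?w = "\<lambda>x. (1/2) * \<phi> k x + (1/2) * \<phi> l x"
    have w: "test ?w" by (intro test_function_add test_function_cmult \<phi>)
    note sq = L2_integrable_square[OF test_L2(1)]
    have "(norm (\<phi> k x - \<phi> l x))\<^sup>2 = 2 * (norm (\<phi> k x))\<^sup>2 + 2 * (norm (\<phi> l x))\<^sup>2 - 4 * (norm (?w x))\<^sup>2" for x
      using parallelogram[of "\<phi> k x" "\<phi> l x"] by simp
    then have "(LINT x|M. (norm (\<phi> k x - \<phi> l x))\<^sup>2) =
      (LINT x|M. 2 * (norm (\<phi> k x))\<^sup>2 + 2 * (norm (\<phi> l x))\<^sup>2 - 4 * (norm (?w x))\<^sup>2)" by (simp only:)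
    also have "\<dots> = 2 * (LINT x|M. (norm (\<phi> k x))\<^sup>2) + 2 * (LINT x|M. (norm (\<phi> l x))\<^sup>2) - 4 * (LINT x|M. (norm (?w x))\<^sup>2)"
      using sq[OF \<phi>(1)] sq[OF w] by simp
    finally have eq: "(LINT x|M. (norm (\<phi> k x - \<phi> l x))\<^sup>2) =
      2 * (LINT x|M. (norm (\<phi> k x))\<^sup>2) + 2 * (LINT x|M. (norm (\<phi> l x))\<^sup>2) - 4 * (LINT x|M. (norm (?w x))\<^sup>2)" .
    have "ell ?w = 1/2 * ell (\<phi> k) + 1/2 * ell (\<phi> l)"
      unfolding linear[OF test_function_cmult[OF \<phi>(1)] \<phi>(1)] ell0[OF \<phi>(1)] ..
    then have "(LINT x|M. (norm (\<phi> k x - \<phi> l x))\<^sup>2) = 4 * J (\<phi> k) + 4 * J (\<phi> l) - 8 * J ?w"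
      unfolding eq J_def by (simp add: field_simps)
    moreover have "4 * J (\<phi> k) \<le> 4 * I + 4 / Suc k" "4 * J (\<phi> l) \<le> 4 * I + 4 / Suc l"
      using \<phi>(2)[of k] \<phi>(2)[of l] by (simp_all add: field_simps)
    ultimately show ?thesis using I[OF w] by linarith
  qed
  have "\<exists>N. \<forall>k\<ge>N. \<forall>l\<ge>N. (LINT x|M. (norm (\<phi> k x - \<phi> l x))\<^sup>2) \<le> e" if e: "e > 0" for e
  proof -
    obtain N :: nat where N: "8 / e < N" using reals_Archimedean2 by blast
    have small: "4 / Suc k \<le> e / 2" if "k \<ge> N" for k
    proof -
      have "8 / e < Suc k" using N that by linarith
      then show ?thesis using e by (simp add: field_simps)
    qed
    have "(LINT x|M. (norm (\<phi> k x - \<phi> l x))\<^sup>2) \<le> e" if "k \<ge> N" "l \<ge> N" for k l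
      using par[of k l] small[OF that(1)] small[OF that(2)] by linarith
    then show ?thesis by blast
  qed
  then obtain \<xi> where \<xi>: "L2 M \<xi>" "(\<lambda>k. LINT x|M. (norm (\<phi> k x - \<xi> x))\<^sup>2) \<longlonglongrightarrow> 0"
    using L2_complete[of M \<phi>, OF test_L2(1)[OF \<phi>(1)]] by blast
  have "ell v = (LINT x|M. \<xi> x * v x)" if v: "test v" for v
  proof -
    let ?V = "LINT x|M. (norm (v x))\<^sup>2"
    have "0 \<le> t * ((LINT x|M. \<xi> x * v x) - ell v) + t\<^sup>2 / 2 * ?V" for t
    proof -
      have "J (\<lambda>x. \<phi> k x + t * v x) = J (\<phi> k) + t * (LINT x|M. \<phi> k x \<bullet> v x) + t\<^sup>2 / 2 * ?V - t * ell v" for k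
        using L2_norm_square_add[OF test_L2(1)[OF \<phi>(1)] test_L2(1)[OF v], of k t]
        by (simp add: J_def linear[OF \<phi>(1) v] field_simps)
      then have "0 \<le> 1 / Suc k + t * (LINT x|M. \<phi> k x \<bullet> v x) + t\<^sup>2 / 2 * ?V - t * ell v" for k
        using I[OF test_function_add[OF \<phi>(1) test_function_cmult[OF v]], of k t] \<phi>(2)[of k] by simp
      moreover have "(\<lambda>k. 1 / Suc k + t * (LINT x|M. \<phi> k x \<bullet> v x) + t\<^sup>2 / 2 * ?V - t * ell v)
         \<longlonglongrightarrow> 0 + t * (LINT x|M. \<xi> x \<bullet> v x) + t\<^sup>2 / 2 * ?V - t * ell v"
        using LIMSEQ_inverse_real_of_nat
        by (intro tendsto_intros L2_tendsto_inner[OF test_L2(1)[OF \<phi>(1)] \<xi>(1) test_L2(1)[OF v] \<xi>(2)])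
          (simp add: inverse_eq_divide)
      ultimately have "0 \<le> 0 + t * (LINT x|M. \<xi> x \<bullet> v x) + t\<^sup>2 / 2 * ?V - t * ell v"
        by (intro LIMSEQ_nonneg[of _ "0 + t * (LINT x|M. \<xi> x \<bullet> v x) + t\<^sup>2 / 2 * ?V - t * ell v"])
      then show ?thesis by (simp add: right_diff_distrib)
    qed
    then show ?thesis using linear_quadratic_nonneg_eq_0 by fastforce
  qed
  with \<xi>(1) show ?thesis by blast
qed

lemma H01_pair_inner_extend:
  assumes g: "L2 M g" and \<xi>: "L2 M \<xi>" and eq: "\<And>v. test v \<Longrightarrow> (LINT x|M. g x \<bullet> gradient v x) = (LINT x|M. \<xi> x * v x)"
    and v: "H01_pair v h"
  shows "(LINT x|M. g x \<bullet> h x) = (LINT x|M. \<xi> x * v x)"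
proof -
  obtain \<phi> where vL: "L2 M v" and hL: "L2 M h" and \<phi>: "\<And>k. test (\<phi> k)"
    and lim: "(\<lambda>k. LINT x|M. (norm (\<phi> k x - v x))\<^sup>2) \<longlonglongrightarrow> 0"
      "(\<lambda>k. LINT x|M. (norm (gradient (\<phi> k) x - h x))\<^sup>2) \<longlonglongrightarrow> 0"
    using v unfolding H01_pair_def by blast
  have 1: "(\<lambda>k. LINT x|M. gradient (\<phi> k) x \<bullet> g x) \<longlonglongrightarrow> (LINT x|M. h x \<bullet> g x)"
    by (rule L2_tendsto_inner[OF test_L2(2)[OF \<phi>] hL g lim(2)])
  have 2: "(\<lambda>k. LINT x|M. \<phi> k x \<bullet> \<xi> x) \<longlonglongrightarrow> (LINT x|M. v x \<bullet> \<xi> x)"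
    by (rule L2_tendsto_inner[OF test_L2(1)[OF \<phi>] vL \<xi> lim(1)])
  have "(LINT x|M. gradient (\<phi> k) x \<bullet> g x) = (LINT x|M. \<phi> k x \<bullet> \<xi> x)" for k
    using eq[OF \<phi>, of k] by (simp add: inner_commute mult.commute)
  with 1 2 have "(LINT x|M. h x \<bullet> g x) = (LINT x|M. v x \<bullet> \<xi> x)" by (simp add: LIMSEQ_unique)
  then show ?thesis by (simp add: inner_commute mult.commute)
qed

end

section \<open>Pointwise bounds by difference quotients\<close>

context lipschitz_potential
begin

text \<open>The upper limit defining Clarke's derivative in direction 1, stopped at the scale
  \<open>\<epsilon>\<close>. At a fixed scale it is a bounded measurable function of
  \<open>s\<close> and can be integrated.\<close>

definition upper_slope :: "real \<Rightarrow> real \<Rightarrow> real" where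
  "upper_slope \<epsilon> s = Sup {(K (z + t) - K z) / t | z t. \<bar>z - s\<bar> < \<epsilon> \<and> 0 < t \<and> t < \<epsilon>}"

lemma quotient_bound: "0 < t \<Longrightarrow> \<bar>(K (z + t) - K z) / t\<bar> \<le> L"
  using K_lipschitz[of "z + t" z] by (simp add: field_simps abs_divide)

lemma upper_slope_bdd: "bdd_above {(K (z + t) - K z) / t | z t. \<bar>z - s\<bar> < \<epsilon> \<and> 0 < t \<and> t < \<epsilon>}"
proof (rule bdd_aboveI)
  fix q assume "q \<in> {(K (z + t) - K z) / t | z t. \<bar>z - s\<bar> < \<epsilon> \<and> 0 < t \<and> t < \<epsilon>}"
  then obtain z t where "q = (K (z + t) - K z) / t" "0 < t" by blast
  then show "q \<le> L" using abs_le_D1[OF quotient_bound] by simp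
qed

lemma upper_slope_upper:
  "\<bar>z - s\<bar> < \<epsilon> \<Longrightarrow> 0 < t \<Longrightarrow> t < \<epsilon> \<Longrightarrow> (K (z + t) - K z) / t \<le> upper_slope \<epsilon> s"
  unfolding upper_slope_def by (intro cSup_upper upper_slope_bdd) blast

lemma upper_slope_nonempty:
  assumes "\<epsilon> > 0"
  shows "{(K (z + t) - K z) / t | z t. \<bar>z - s\<bar> < \<epsilon> \<and> 0 < t \<and> t < \<epsilon>} \<noteq> {}"
proof -
  have "\<bar>s - s\<bar> < \<epsilon> \<and> 0 < \<epsilon> / 2 \<and> \<epsilon> / 2 < \<epsilon>" using assms by simp
  then show ?thesis by blast
qed

lemma upper_slope_least:
  assumes "\<epsilon> > 0" "\<And>z t. \<bar>z - s\<bar> < \<epsilon> \<Longrightarrow> 0 < t \<Longrightarrow> t < \<epsilon> \<Longrightarrow> K (z + t) - K z \<le> r * t"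
  shows "upper_slope \<epsilon> s \<le> r"
  unfolding upper_slope_def
  by (rule cSup_least[OF upper_slope_nonempty[OF assms(1)]]) (auto simp: divide_le_eq assms(2))

lemma upper_slope_abs:
  assumes "\<epsilon> > 0"
  shows "\<bar>upper_slope \<epsilon> s\<bar> \<le> L"
proof -
  have "(K (s + \<epsilon>/2) - K s) / (\<epsilon>/2) \<le> upper_slope \<epsilon> s" using assms by (intro upper_slope_upper) simp_all
  moreover have "upper_slope \<epsilon> s \<le> L"
  proof (rule upper_slope_least[OF assms])
    fix z t :: real assume "0 < t"
    then show "K (z + t) - K z \<le> L * t" using K_lipschitz[of "z + t" z] by simp
  qed
  ultimately show ?thesis using quotient_bound[of "\<epsilon>/2" s] assms by linarith
qed

text \<open>A quotient with base point \<open>z\<close> and admissible step contributes to all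
  \<open>s\<close> within \<open>\<epsilon>\<close> of \<open>z\<close>; superlevel sets are
  therefore unions of open balls.\<close>

lemma upper_slope_measurable:
  assumes "\<epsilon> > 0"
  shows "upper_slope \<epsilon> \<in> borel_measurable borel"
proof (rule borel_measurableI_greater)
  fix a
  have "{s. a < upper_slope \<epsilon> s} = (\<Union>(z, t)\<in>{(z, t). 0 < t \<and> t < \<epsilon> \<and> a < (K (z + t) - K z) / t}. ball z \<epsilon>)"
  proof (rule set_eqI)
    fix s
    have "a < upper_slope \<epsilon> s \<longleftrightarrow> (\<exists>z t. \<bar>z - s\<bar> < \<epsilon> \<and> 0 < t \<and> t < \<epsilon> \<and> a < (K (z + t) - K z) / t)"
      unfolding upper_slope_def less_cSup_iff[OF upper_slope_nonempty[OF assms] upper_slope_bdd] by blast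
    then show "s \<in> {s. a < upper_slope \<epsilon> s} \<longleftrightarrow>
        s \<in> (\<Union>(z, t)\<in>{(z, t). 0 < t \<and> t < \<epsilon> \<and> a < (K (z + t) - K z) / t}. ball z \<epsilon>)"
      by (simp add: dist_real_def) blast
  qed
  then have "open {s. a < upper_slope \<epsilon> s}" by auto
  then show "{x \<in> space borel. a < upper_slope \<epsilon> x} \<in> sets borel" by simp
qed

text \<open>Lowering \<open>u\<close> by \<open>\<tau> * v\<close> changes the potential by at most
  \<open>\<tau> * v\<close> times the slope at scale \<open>\<epsilon>\<close>. Dividing by
  \<open>\<tau>\<close>, letting it tend to 0 and applying the fundamental lemma gives
  \<open>\<xi>\<close> at most that slope almost everywhere.\<close>

lemma pointwise_upper:
  assumes u: "L2 M u" and \<xi>: "L2 M \<xi>"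
    and var: "\<And>v. test v \<Longrightarrow> (\<And>x. 0 \<le> v x) \<Longrightarrow> \<exists>c. \<forall>\<tau>>0.
      \<tau> * (LINT x|M. \<xi> x * v x) \<le> (LINT x|M. K (u x)) - (LINT x|M. K (u x - \<tau> * v x)) + c * \<tau>\<^sup>2"
  shows "AE x in M. \<forall>m::nat. \<forall>r. (\<forall>z t. \<bar>z - u x\<bar> < 1 / Suc m \<longrightarrow> 0 < t \<longrightarrow> t < 1 / Suc m \<longrightarrow> K (z + t) - K z \<le> r * t) \<longrightarrow> \<xi> x \<le> r"
proof -
  have main: "AE x in M. 0 \<le> upper_slope \<epsilon> (u x) - \<xi> x" if \<epsilon>: "\<epsilon> > 0" for \<epsilon>
  proof (rule fundamental_nonneg[OF open_dom])
    have [measurable]: "u \<in> borel_measurable M" by (rule L2_measurable[OF u])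
    have [measurable]: "upper_slope \<epsilon> \<in> borel_measurable borel" by (rule upper_slope_measurable[OF \<epsilon>])
    have D: "L2 M (\<lambda>x. upper_slope \<epsilon> (u x))"
    proof (rule L2_bounded)
      show "(\<lambda>x. upper_slope \<epsilon> (u x)) \<in> borel_measurable M" by measurable
      show "AE x in M. norm (upper_slope \<epsilon> (u x)) \<le> L" using upper_slope_abs[OF \<epsilon>] by (intro AE_I2) simp
    qed
    show "integrable M (\<lambda>x. upper_slope \<epsilon> (u x) - \<xi> x)" by (rule L2_integrable[OF L2_diff[OF D \<xi>]])
    fix v assume v: "test v" and nn: "\<And>x. 0 \<le> v x"
    obtain B where B: "B > 0" "\<And>x. \<bar>v x\<bar> \<le> B" using test_function_bounded[OF v] by blast
    obtain c where c: "\<And>\<tau>. \<tau> > 0 \<Longrightarrow>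
      \<tau> * (LINT x|M. \<xi> x * v x) \<le> (LINT x|M. K (u x)) - (LINT x|M. K (u x - \<tau> * v x)) + c * \<tau>\<^sup>2"
      using var[OF v nn] by blast
    note iD = L2_integrable_mult[OF D test_L2(1)[OF v]] and i\<xi> = L2_integrable_mult[OF \<xi> test_L2(1)[OF v]]
    have "(LINT x|M. \<xi> x * v x) \<le> (LINT x|M. upper_slope \<epsilon> (u x) * v x)"
    proof (rule le_of_le_add_small)
      show "\<epsilon> / B > 0" using \<epsilon> B by simp
      fix \<tau> assume \<tau>: "0 < \<tau>" "\<tau> < \<epsilon> / B"
      have K1: "integrable M (\<lambda>x. K (u x))" by (rule K_integrable[OF u])
      have K2: "integrable M (\<lambda>x. K (u x - \<tau> * v x))"
        by (rule K_integrable[OF L2_diff[OF u L2_cmult[OF test_L2(1)[OF v]]]])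
      have "(LINT x|M. K (u x) - K (u x - \<tau> * v x)) \<le> (LINT x|M. \<tau> * (upper_slope \<epsilon> (u x) * v x))"
      proof (rule integral_mono)
        show "integrable M (\<lambda>x. K (u x) - K (u x - \<tau> * v x))" using K1 K2 by simp
        show "integrable M (\<lambda>x. \<tau> * (upper_slope \<epsilon> (u x) * v x))" using iD by simp
        fix x
        show "K (u x) - K (u x - \<tau> * v x) \<le> \<tau> * (upper_slope \<epsilon> (u x) * v x)"
        proof (cases "v x = 0")
          case False
          then have pos: "0 < \<tau> * v x" using nn[of x] \<tau> by simp
          have "\<tau> * v x \<le> \<tau> * B" using B(2)[of x] \<tau> by (intro mult_left_mono) auto
          also have "\<dots> < \<epsilon>" using \<tau> B(1) by (simp add: pos_less_divide_eq)
          finally have "\<tau> * v x < \<epsilon>" .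
          \<comment> \<open>The base point of this quotient is the lowered value, which lies within
            \<open>\<epsilon>\<close> of \<open>u x\<close> because
            \<open>\<tau> < \<epsilon> / B\<close>.\<close>
          then have "(K (u x - \<tau> * v x + \<tau> * v x) - K (u x - \<tau> * v x)) / (\<tau> * v x) \<le> upper_slope \<epsilon> (u x)"
            using pos by (intro upper_slope_upper) simp_all
          then have "(K (u x) - K (u x - \<tau> * v x)) / (\<tau> * v x) \<le> upper_slope \<epsilon> (u x)" by simp
          then have "K (u x) - K (u x - \<tau> * v x) \<le> upper_slope \<epsilon> (u x) * (\<tau> * v x)"
            using pos by (simp only: pos_divide_le_eq)
          then show ?thesis by (simp add: algebra_simps)
        qed simp
      qed
      then have "\<tau> * (LINT x|M. \<xi> x * v x) \<le> \<tau> * ((LINT x|M. upper_slope \<epsilon> (u x) * v x) + \<tau> * c)"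
        using c[OF \<tau>(1)] K1 K2 by (simp add: algebra_simps power2_eq_square)
      then show "(LINT x|M. \<xi> x * v x) \<le> (LINT x|M. upper_slope \<epsilon> (u x) * v x) + \<tau> * c"
        using \<tau>(1) by simp
    qed
    then show "0 \<le> (LINT x|M. (upper_slope \<epsilon> (u x) - \<xi> x) * v x)"
      using iD i\<xi> by (simp add: left_diff_distrib)
  qed
  \<comment> \<open>Restricting the scales to reciprocals of positive integers leaves countably many
    null sets, hence a single exceptional set for all \<open>m\<close> and \<open>r\<close>.\<close>
  have "AE x in M. \<forall>m::nat. 0 \<le> upper_slope (1 / Suc m) (u x) - \<xi> x"
    unfolding AE_all_countable by (intro allI main) simp
  then show ?thesis
  proof (rule eventually_mono, intro allI impI)
    fix x m r
    assume "\<forall>m::nat. 0 \<le> upper_slope (1 / Suc m) (u x) - \<xi> x"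
      and q: "\<forall>z t. \<bar>z - u x\<bar> < 1 / Suc m \<longrightarrow> 0 < t \<longrightarrow> t < 1 / Suc m \<longrightarrow> K (z + t) - K z \<le> r * t"
    then have "\<xi> x \<le> upper_slope (1 / Suc m) (u x)" by (metis diff_ge_0_iff_ge)
    also have "\<dots> \<le> r" by (rule upper_slope_least) (use q in simp_all)
    finally show "\<xi> x \<le> r" .
  qed
qed

text \<open>Reflection: the upper bound is applied to the potential \<open>K (- s)\<close> with
  \<open>- u\<close> and \<open>- \<xi>\<close>.\<close>

lemma pointwise_lower:
  assumes u: "L2 M u" and \<xi>: "L2 M \<xi>"
    and var: "\<And>v. test v \<Longrightarrow> (\<And>x. 0 \<le> v x) \<Longrightarrow> \<exists>c. \<forall>\<tau>>0.
      \<tau> * (LINT x|M. \<xi> x * v x) \<ge> (LINT x|M. K (u x + \<tau> * v x)) - (LINT x|M. K (u x)) - c * \<tau>\<^sup>2"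
  shows "AE x in M. \<forall>m::nat. \<forall>r. (\<forall>z t. \<bar>z - u x\<bar> < 1 / Suc m \<longrightarrow> 0 < t \<longrightarrow> t < 1 / Suc m \<longrightarrow> r * t \<le> K (z + t) - K z) \<longrightarrow> r \<le> \<xi> x"
proof -
  interpret neg: lipschitz_potential \<Omega> "\<lambda>s. K (- s)" L
  proof
    show "\<bar>K (- s) - K (- t)\<bar> \<le> L * \<bar>s - t\<bar>" for s t
      using K_lipschitz[of "- s" "- t"] by (simp add: abs_minus_commute)
  qed
  have "AE x in M. \<forall>m::nat. \<forall>r. (\<forall>z t. \<bar>z - (- u x)\<bar> < 1 / Suc m \<longrightarrow> 0 < t \<longrightarrow> t < 1 / Suc m \<longrightarrow>
      K (- (z + t)) - K (- z) \<le> r * t) \<longrightarrow> - \<xi> x \<le> r"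
  proof (rule neg.pointwise_upper)
    show "L2 M (\<lambda>x. - u x)" "L2 M (\<lambda>x. - \<xi> x)"
      using L2_scaleR[OF u, of "-1"] L2_scaleR[OF \<xi>, of "-1"] by simp_all
    fix v assume v: "test v" "\<And>x. 0 \<le> v x"
    obtain c where c: "\<And>\<tau>. \<tau> > 0 \<Longrightarrow>
        \<tau> * (LINT x|M. \<xi> x * v x) \<ge> (LINT x|M. K (u x + \<tau> * v x)) - (LINT x|M. K (u x)) - c * \<tau>\<^sup>2"
      using var[OF v] by blast
    show "\<exists>c. \<forall>\<tau>>0. \<tau> * (LINT x|M. - \<xi> x * v x) \<le>
        (LINT x|M. K (- (- u x))) - (LINT x|M. K (- (- u x - \<tau> * v x))) + c * \<tau>\<^sup>2"
    proof (intro exI[of _ c] allI impI)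
      fix \<tau> :: real assume "\<tau> > 0"
      from c[OF this] show "\<tau> * (LINT x|M. - \<xi> x * v x) \<le>
          (LINT x|M. K (- (- u x))) - (LINT x|M. K (- (- u x - \<tau> * v x))) + c * \<tau>\<^sup>2" by (simp add: add.commute)
    qed
  qed
  then show ?thesis
  proof (rule eventually_mono, intro allI impI)
    fix x m r
    assume neg: "\<forall>m::nat. \<forall>r. (\<forall>z t. \<bar>z - (- u x)\<bar> < 1 / Suc m \<longrightarrow> 0 < t \<longrightarrow> t < 1 / Suc m \<longrightarrow>
        K (- (z + t)) - K (- z) \<le> r * t) \<longrightarrow> - \<xi> x \<le> r"
      and q: "\<forall>z t. \<bar>z - u x\<bar> < 1 / Suc m \<longrightarrow> 0 < t \<longrightarrow> t < 1 / Suc m \<longrightarrow> r * t \<le> K (z + t) - K z"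
    \<comment> \<open>Reflection moves the base point from \<open>z\<close> to
      \<open>- (z + t)\<close>, an extra displacement by \<open>t\<close>. Index
      \<open>2 * m + 1\<close> halves the scale and makes room for it.\<close>
    have half: "1 / real (Suc (2 * m + 1)) = (1 / Suc m) / 2" by (simp add: field_simps)
    have "- \<xi> x \<le> - r"
    proof (rule neg[rule_format, where m="2 * m + 1"])
      fix z t :: real
      assume z: "\<bar>z - (- u x)\<bar> < 1 / Suc (2 * m + 1)" and t: "0 < t" "t < 1 / Suc (2 * m + 1)"
      define d where "d = 1 / real (Suc m)"
      have d: "\<bar>z + u x\<bar> < d / 2" "t < d / 2" using z t(2) unfolding half d_def[symmetric] by simp_all
      have "\<bar>- (z + t) - u x\<bar> \<le> \<bar>z + u x\<bar> + t" using t(1) by linarith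
      then have "\<bar>- (z + t) - u x\<bar> < 1 / Suc m" unfolding d_def[symmetric] using d by linarith
      moreover have "t < 1 / Suc m" unfolding d_def[symmetric] using d(2) t(1) by linarith
      ultimately have "r * t \<le> K (- (z + t) + t) - K (- (z + t))" using q t(1) by blast
      then show "K (- (z + t)) - K (- z) \<le> - r * t" by simp
    qed
    then show "r \<le> \<xi> x" by simp
  qed
qed

text \<open>The variational inequality is divided by small steps of either sign; the Lipschitz bound
  for \<open>K\<close> survives and the quadratic term disappears. This is the \<open>L^1\<close>
  bound required by \<open>riesz_test\<close>.\<close>

lemma minimizer_dual_bound:
  assumes m: "energy_minimizer \<delta> u g" and v: "test v"
  shows "\<bar>LINT x|M. g x \<bullet> gradient v x\<bar> \<le> L * (LINT x|M. \<bar>v x\<bar>)"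
proof -
  let ?ell = "LINT x|M. g x \<bullet> gradient v x" and ?V = "LINT x|M. (norm (gradient v x))\<^sup>2" and ?J = "LINT x|M. \<bar>v x\<bar>"
  have u: "L2 M u" using m by (simp add: energy_minimizer_def H01_pair_def)
  have var: "(LINT x|M. K (u x + t * v x)) - (LINT x|M. K (u x)) \<le> t * ?ell + t\<^sup>2 / 2 * ?V" for t
    using m v by (simp add: energy_minimizer_def)
  have "- (L * (\<bar>t\<bar> * ?J)) \<le> t * ?ell + t\<^sup>2 / 2 * ?V" for t
  proof -
    have "\<bar>(LINT x|M. K (u x + t * v x)) - (LINT x|M. K (u x))\<bar> \<le> L * (LINT x|M. \<bar>u x + t * v x - u x\<bar>)"
      by (rule K_integral_diff[OF L2_add[OF u L2_cmult[OF test_L2(1)[OF v]]] u])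
    also have "\<dots> = L * (\<bar>t\<bar> * ?J)" by (simp add: abs_mult)
    finally show ?thesis using var[of t] by linarith
  qed
  note low = this
  have "- (L * ?J) \<le> ?ell"
  proof (rule le_of_le_add_small[of 1])
    fix t :: real assume t: "0 < t"
    have "t * (- (L * ?J)) \<le> t * (?ell + t * (?V / 2))"
      using low[of t] t by (simp add: algebra_simps power2_eq_square)
    then show "- (L * ?J) \<le> ?ell + t * (?V / 2)" by (rule mult_left_le_imp_le[OF _ t])
  qed simp
  moreover have "?ell \<le> L * ?J"
  proof (rule le_of_le_add_small[of 1])
    fix t :: real assume t: "0 < t"
    have "t * ?ell \<le> t * (L * ?J + t * (?V / 2))"
      using low[of "- t"] t by (simp add: algebra_simps power2_eq_square)
    then show "?ell \<le> L * ?J + t * (?V / 2)" by (rule mult_left_le_imp_le[OF _ t])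
  qed simp
  ultimately show ?thesis by linarith
qed

theorem energy_minimizer_inclusion:
  assumes m: "energy_minimizer \<delta> u g"
  shows "\<exists>\<xi>. L2 M \<xi> \<and> (\<forall>v. test v \<longrightarrow> (LINT x|M. g x \<bullet> gradient v x) = (LINT x|M. \<xi> x * v x)) \<and>
    (AE x in M. \<forall>m::nat. \<forall>r.
      ((\<forall>z t. \<bar>z - u x\<bar> < 1 / Suc m \<longrightarrow> 0 < t \<longrightarrow> t < 1 / Suc m \<longrightarrow> K (z + t) - K z \<le> r * t) \<longrightarrow> \<xi> x \<le> r) \<and>
      ((\<forall>z t. \<bar>z - u x\<bar> < 1 / Suc m \<longrightarrow> 0 < t \<longrightarrow> t < 1 / Suc m \<longrightarrow> r * t \<le> K (z + t) - K z) \<longrightarrow> r \<le> \<xi> x))"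
proof -
  have u: "L2 M u" and g: "L2 M g" using m by (simp_all add: energy_minimizer_def H01_pair_def)
  have var: "(LINT x|M. K (u x + t * v x)) - (LINT x|M. K (u x)) \<le>
     t * (LINT x|M. g x \<bullet> gradient v x) + t\<^sup>2 / 2 * (LINT x|M. (norm (gradient v x))\<^sup>2)" if "test v" for v t
    using m that by (simp add: energy_minimizer_def)
  have "\<exists>\<xi>. L2 M \<xi> \<and> (\<forall>v. test v \<longrightarrow> (LINT x|M. g x \<bullet> gradient v x) = (LINT x|M. \<xi> x * v x))"
  proof (rule riesz_test)
    fix \<phi> \<psi> c assume \<phi>: "test \<phi>" and \<psi>: "test \<psi>"
    show "(LINT x|M. g x \<bullet> gradient (\<lambda>x. \<phi> x + c * \<psi> x) x) =
        (LINT x|M. g x \<bullet> gradient \<phi> x) + c * (LINT x|M. g x \<bullet> gradient \<psi> x)"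
      unfolding gradient_add[OF \<phi> test_function_cmult[OF \<psi>]] gradient_cmult[OF \<psi>]
      using L2_integrable_inner[OF g test_L2(2)[OF \<phi>]] L2_integrable_inner[OF g test_L2(2)[OF \<psi>]]
      by (simp add: inner_add_right)
  qed (rule minimizer_dual_bound[OF m])
  then obtain \<xi> where \<xi>: "L2 M \<xi>" and eq: "\<And>v. test v \<Longrightarrow> (LINT x|M. g x \<bullet> gradient v x) = (LINT x|M. \<xi> x * v x)"
    by blast
  have up: "AE x in M. \<forall>m::nat. \<forall>r. (\<forall>z t. \<bar>z - u x\<bar> < 1 / Suc m \<longrightarrow> 0 < t \<longrightarrow> t < 1 / Suc m \<longrightarrow> K (z + t) - K z \<le> r * t) \<longrightarrow> \<xi> x \<le> r"
  proof (rule pointwise_upper[OF u \<xi>])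
    fix v assume v: "test v"
    let ?V = "LINT x|M. (norm (gradient v x))\<^sup>2"
    show "\<exists>c. \<forall>\<tau>>0. \<tau> * (LINT x|M. \<xi> x * v x) \<le> (LINT x|M. K (u x)) - (LINT x|M. K (u x - \<tau> * v x)) + c * \<tau>\<^sup>2"
    proof (intro exI[of _ "?V / 2"] allI impI)
      fix \<tau> :: real
      show "\<tau> * (LINT x|M. \<xi> x * v x) \<le> (LINT x|M. K (u x)) - (LINT x|M. K (u x - \<tau> * v x)) + ?V / 2 * \<tau>\<^sup>2"
        using var[OF v, of "- \<tau>"] eq[OF v] by (simp add: mult.commute)
    qed
  qed
  have lo: "AE x in M. \<forall>m::nat. \<forall>r. (\<forall>z t. \<bar>z - u x\<bar> < 1 / Suc m \<longrightarrow> 0 < t \<longrightarrow> t < 1 / Suc m \<longrightarrow> r * t \<le> K (z + t) - K z) \<longrightarrow> r \<le> \<xi> x"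
  proof (rule pointwise_lower[OF u \<xi>])
    fix v assume v: "test v"
    let ?V = "LINT x|M. (norm (gradient v x))\<^sup>2"
    show "\<exists>c. \<forall>\<tau>>0. \<tau> * (LINT x|M. \<xi> x * v x) \<ge> (LINT x|M. K (u x + \<tau> * v x)) - (LINT x|M. K (u x)) - c * \<tau>\<^sup>2"
    proof (intro exI[of _ "?V / 2"] allI impI)
      fix \<tau> :: real
      show "\<tau> * (LINT x|M. \<xi> x * v x) \<ge> (LINT x|M. K (u x + \<tau> * v x)) - (LINT x|M. K (u x)) - ?V / 2 * \<tau>\<^sup>2"
        using var[OF v, of \<tau>] eq[OF v] by (simp add: mult.commute)
    qed
  qed
  have "AE x in M. \<forall>m::nat. \<forall>r.
      ((\<forall>z t. \<bar>z - u x\<bar> < 1 / Suc m \<longrightarrow> 0 < t \<longrightarrow> t < 1 / Suc m \<longrightarrow> K (z + t) - K z \<le> r * t) \<longrightarrow> \<xi> x \<le> r) \<and>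
      ((\<forall>z t. \<bar>z - u x\<bar> < 1 / Suc m \<longrightarrow> 0 < t \<longrightarrow> t < 1 / Suc m \<longrightarrow> r * t \<le> K (z + t) - K z) \<longrightarrow> r \<le> \<xi> x)"
    using eventually_conj[OF up lo] by (rule eventually_mono) simp
  with \<xi> eq show ?thesis by (intro exI[of _ \<xi>]) simp
qed

end

section \<open>The Clarke gradient on the real line\<close>

lemma eventually_nhds_at_right:
  "(\<forall>\<^sub>F (z, t) in nhds (s::real) \<times>\<^sub>F at_right (0::real). P z t) \<longleftrightarrow>
    (\<exists>e>0. \<forall>z t. \<bar>z - s\<bar> < e \<longrightarrow> 0 < t \<longrightarrow> t < e \<longrightarrow> P z t)"
proof
  assume "\<forall>\<^sub>F (z, t) in nhds s \<times>\<^sub>F at_right 0. P z t"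
  then obtain Q R where Q: "eventually Q (nhds s)" and R: "eventually R (at_right 0)"
    and QR: "\<And>z t. Q z \<Longrightarrow> R t \<Longrightarrow> P z t"
    unfolding eventually_prod_filter by auto
  obtain d where d: "d > 0" "\<And>z. dist z s < d \<Longrightarrow> Q z" using Q unfolding eventually_nhds_metric by blast
  obtain b where b: "b > 0" "\<And>t. 0 < t \<Longrightarrow> t < b \<Longrightarrow> R t" using R unfolding eventually_at_right_field by blast
  show "\<exists>e>0. \<forall>z t. \<bar>z - s\<bar> < e \<longrightarrow> 0 < t \<longrightarrow> t < e \<longrightarrow> P z t"
    using d b QR by (intro exI[of _ "min d b"]) (simp add: dist_real_def)
next
  assume "\<exists>e>0. \<forall>z t. \<bar>z - s\<bar> < e \<longrightarrow> 0 < t \<longrightarrow> t < e \<longrightarrow> P z t"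
  then obtain e where e: "e > 0" "\<And>z t. \<bar>z - s\<bar> < e \<Longrightarrow> 0 < t \<Longrightarrow> t < e \<Longrightarrow> P z t" by blast
  show "\<forall>\<^sub>F (z, t) in nhds s \<times>\<^sub>F at_right 0. P z t"
    unfolding eventually_prod_filter
  proof (intro exI conjI)
    show "\<forall>\<^sub>F z in nhds s. \<bar>z - s\<bar> < e" unfolding eventually_nhds_metric using e(1) by (auto simp: dist_real_def)
    show "\<forall>\<^sub>F t in at_right 0. 0 < t \<and> t < e" unfolding eventually_at_right_field using e(1) by auto
  qed (use e in auto)
qed

lemma clarke_filter_nontrivial: "nhds (s::real) \<times>\<^sub>F at_right (0::real) \<noteq> bot"
  by (simp add: prod_filter_eq_bot)

lemma clarke_derivative_le:
  assumes "e > 0" "\<And>z t. \<bar>z - s\<bar> < e \<Longrightarrow> 0 < t \<Longrightarrow> t < e \<Longrightarrow> f (z + t * v) - f z \<le> r * t"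
  shows "clarke_derivative f s v \<le> ereal r"
  unfolding clarke_derivative_def
proof (rule Limsup_bounded)
  have "\<forall>\<^sub>F (z, t) in nhds s \<times>\<^sub>F at_right 0. (f (z + t * v) - f z) / t \<le> r"
    unfolding eventually_nhds_at_right
    by (intro exI[of _ e] conjI allI impI) (use assms in \<open>simp_all add: divide_le_eq\<close>)
  then show "\<forall>\<^sub>F p in nhds s \<times>\<^sub>F at_right 0. (case p of (z, t) \<Rightarrow> ereal ((f (z + t * v) - f z) / t)) \<le> ereal r"
    by (simp add: case_prod_beta')
qed

lemma clarke_derivative_ge:
  assumes "e > 0" "\<And>z t. \<bar>z - s\<bar> < e \<Longrightarrow> 0 < t \<Longrightarrow> t < e \<Longrightarrow> r * t \<le> f (z + t * v) - f z"
  shows "ereal r \<le> clarke_derivative f s v"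
  unfolding clarke_derivative_def
proof (rule le_Limsup[OF clarke_filter_nontrivial])
  have "\<forall>\<^sub>F (z, t) in nhds s \<times>\<^sub>F at_right 0. r \<le> (f (z + t * v) - f z) / t"
    unfolding eventually_nhds_at_right
    by (intro exI[of _ e] conjI allI impI) (use assms in \<open>simp_all add: le_divide_eq\<close>)
  then show "\<forall>\<^sub>F p in nhds s \<times>\<^sub>F at_right 0. ereal r \<le> (case p of (z, t) \<Rightarrow> ereal ((f (z + t * v) - f z) / t))"
    by (simp add: case_prod_beta')
qed

lemma clarke_derivative_less:
  assumes "clarke_derivative f s v < ereal r"
  shows "\<exists>e>0. \<forall>z t. \<bar>z - s\<bar> < e \<longrightarrow> 0 < t \<longrightarrow> t < e \<longrightarrow> f (z + t * v) - f z \<le> r * t"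
proof -
  have "\<forall>\<^sub>F p in nhds s \<times>\<^sub>F at_right 0. (case p of (z, t) \<Rightarrow> ereal ((f (z + t * v) - f z) / t)) < ereal r"
    using assms unfolding clarke_derivative_def by (rule Limsup_lessD)
  then have "\<forall>\<^sub>F (z, t) in nhds s \<times>\<^sub>F at_right 0. (f (z + t * v) - f z) / t < r"
    by (simp add: case_prod_beta')
  then obtain e where e: "e > 0" "\<And>z t. \<bar>z - s\<bar> < e \<Longrightarrow> 0 < t \<Longrightarrow> t < e \<Longrightarrow> (f (z + t * v) - f z) / t < r"
    unfolding eventually_nhds_at_right by blast
  have "f (z + t * v) - f z \<le> r * t" if "\<bar>z - s\<bar> < e" "0 < t" "t < e" for z t
    using e(2)[OF that] that(2) by (simp add: divide_less_eq)
  with e(1) show ?thesis by blast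
qed

text \<open>For locally Lipschitz functions the derivative is finite and the conversion is faithful;
  \<open>real_of_ereal\<close> sends infinite values to 0.\<close>

definition clarke_upper :: "(real \<Rightarrow> real) \<Rightarrow> real \<Rightarrow> real" where
  "clarke_upper f s = real_of_ereal (clarke_derivative f s 1)"

text \<open>The constraint for \<open>v = -1\<close> reads \<open>- \<xi> \<le>\<close> the
  derivative in that direction, whence both minus signs.\<close>

definition clarke_lower :: "(real \<Rightarrow> real) \<Rightarrow> real \<Rightarrow> real" where
  "clarke_lower f s = - real_of_ereal (clarke_derivative f s (- 1))"

lemma locally_lipschitz_increment:
  assumes "locally_lipschitz_on UNIV f"
  obtains e L where "e > 0" "L \<ge> 0" "\<And>z t. \<bar>z - s\<bar> < e \<Longrightarrow> \<bar>t\<bar> < e \<Longrightarrow> \<bar>f (z + t) - f z\<bar> \<le> L * \<bar>t\<bar>"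
proof -
  obtain r L where r: "r > 0" "L-lipschitz_on (cball s r) f"
    using assms unfolding locally_lipschitz_on_def by (metis Int_UNIV_right UNIV_I)
  show ?thesis
  proof (rule that[of "r / 2" L])
    show "\<bar>f (z + t) - f z\<bar> \<le> L * \<bar>t\<bar>" if "\<bar>z - s\<bar> < r / 2" "\<bar>t\<bar> < r / 2" for z t
    proof -
      have "\<bar>s - (z + t)\<bar> \<le> r" "\<bar>s - z\<bar> \<le> r" using that by linarith+
      then show ?thesis using lipschitz_onD[OF r(2), of "z + t" z] by (simp add: dist_real_def)
    qed
  qed (use r lipschitz_on_nonneg in auto)
qed

section \<open>Clarke gradients as intervals and a mean value inequality\<close>

context
  fixes f :: "real \<Rightarrow> real"
  assumes ll: "locally_lipschitz_on UNIV f"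
begin

lemma clarke_derivative_real:
  "clarke_derivative f s 1 = ereal (clarke_upper f s)" "clarke_derivative f s (- 1) = ereal (- clarke_lower f s)"
proof -
  obtain e L where L: "e > 0" "L \<ge> 0" "\<And>z t. \<bar>z - s\<bar> < e \<Longrightarrow> \<bar>t\<bar> < e \<Longrightarrow> \<bar>f (z + t) - f z\<bar> \<le> L * \<bar>t\<bar>"
    by (rule locally_lipschitz_increment[OF ll, of s]) blast
  have *: "ereal (real_of_ereal (clarke_derivative f s v)) = clarke_derivative f s v" if v: "\<bar>v\<bar> = 1" for v
  proof (rule ereal_real')
    have b: "\<bar>f (z + t * v) - f z\<bar> \<le> L * t" if "\<bar>z - s\<bar> < e" "0 < t" "t < e" for z t
      using L(3)[OF that(1), of "t * v"] that v by (simp add: abs_mult)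
    have "clarke_derivative f s v \<le> ereal L"
      by (rule clarke_derivative_le[OF L(1)]) (use b in \<open>simp add: abs_le_iff\<close>)
    moreover have "ereal (- L) \<le> clarke_derivative f s v"
    proof (rule clarke_derivative_ge[OF L(1)])
      fix z t assume "\<bar>z - s\<bar> < e" "0 < t" "t < e"
      from b[OF this] show "- L * t \<le> f (z + t * v) - f z" by (simp add: abs_le_iff)
    qed
    ultimately show "\<bar>clarke_derivative f s v\<bar> \<noteq> \<infinity>" by auto
  qed
  show "clarke_derivative f s 1 = ereal (clarke_upper f s)" "clarke_derivative f s (- 1) = ereal (- clarke_lower f s)"
    using *[of 1] *[of "-1"] by (simp_all add: clarke_upper_def clarke_lower_def)
qed

lemma clarke_upper_less:
  assumes "clarke_upper f s < r"
  shows "\<exists>e>0. \<forall>z t. \<bar>z - s\<bar> < e \<longrightarrow> 0 < t \<longrightarrow> t < e \<longrightarrow> f (z + t) - f z \<le> r * t"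
  using clarke_derivative_less[of f s 1 r] assms by (simp add: clarke_derivative_real)

text \<open>The increment from \<open>z\<close> to \<open>z + t\<close> is the backward increment at
  \<open>z + t\<close>. The base point moves by \<open>t\<close>, so the window is halved.\<close>

lemma clarke_lower_greater:
  assumes "r < clarke_lower f s"
  shows "\<exists>e>0. \<forall>z t. \<bar>z - s\<bar> < e \<longrightarrow> 0 < t \<longrightarrow> t < e \<longrightarrow> r * t \<le> f (z + t) - f z"
proof -
  have "clarke_derivative f s (- 1) < ereal (- r)" using assms by (simp add: clarke_derivative_real)
  from clarke_derivative_less[OF this]
  obtain e where e: "e > 0" "\<And>z t. \<bar>z - s\<bar> < e \<Longrightarrow> 0 < t \<Longrightarrow> t < e \<Longrightarrow> f (z + t * (- 1)) - f z \<le> - r * t"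
    by blast
  have "r * t \<le> f (z + t) - f z" if "\<bar>z - s\<bar> < e / 2" "0 < t" "t < e / 2" for z t
  proof -
    have "\<bar>z + t - s\<bar> < e" "t < e" using that by linarith+
    then show ?thesis using e(2)[of "z + t" t] that(2) by simp
  qed
  then show ?thesis using e(1) by (intro exI[of _ "e / 2"]) simp
qed

lemma clarke_lower_le_upper: "clarke_lower f s \<le> clarke_upper f s"
proof (rule ccontr)
  assume "\<not> clarke_lower f s \<le> clarke_upper f s"
  then obtain a b where ab: "clarke_upper f s < a" "a < b" "b < clarke_lower f s" by (metis dense not_le)
  obtain d where d: "d > 0" "\<And>z t. \<bar>z - s\<bar> < d \<Longrightarrow> 0 < t \<Longrightarrow> t < d \<Longrightarrow> f (z + t) - f z \<le> a * t"
    using clarke_upper_less[OF ab(1)] by blast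
  obtain e where e: "e > 0" "\<And>z t. \<bar>z - s\<bar> < e \<Longrightarrow> 0 < t \<Longrightarrow> t < e \<Longrightarrow> b * t \<le> f (z + t) - f z"
    using clarke_lower_greater[OF ab(3)] by blast
  define t where "t = min d e / 2"
  have t: "0 < t" "t < d" "t < e" using d(1) e(1) by (simp_all add: t_def min_def)
  have "f (s + t) - f s \<le> a * t" "b * t \<le> f (s + t) - f s"
    using d(2)[of s t] e(2)[of s t] t d(1) e(1) by simp_all
  then have "b * t \<le> a * t" by linarith
  then show False using ab(2) t(1) by simp
qed

text \<open>The modulus of \<open>v\<close> can be absorbed into the step \<open>t\<close>, so by
  positive homogeneity only the directions \<open>1\<close> and \<open>-1\<close> impose
  constraints.\<close>

lemma clarke_gradient_eq: "clarke_gradient f s = {clarke_lower f s..clarke_upper f s}"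
proof (intro set_eqI iffI)
  fix \<xi> assume "\<xi> \<in> clarke_gradient f s"
  then have *: "ereal (\<xi> * v) \<le> clarke_derivative f s v" for v by (simp add: clarke_gradient_def)
  show "\<xi> \<in> {clarke_lower f s..clarke_upper f s}"
    using *[of 1] *[of "-1"] by (simp add: clarke_derivative_real)
next
  fix \<xi> assume \<xi>: "\<xi> \<in> {clarke_lower f s..clarke_upper f s}"
  have "ereal (\<xi> * v) \<le> clarke_derivative f s v" for v
  proof (cases "v = 0")
    case True
    have "ereal 0 \<le> clarke_derivative f s v"
      by (rule clarke_derivative_ge[of 1]) (simp_all add: True)
    then show ?thesis using True by simp
  next
    case False
    show ?thesis
    proof (rule ccontr)
      assume "\<not> ereal (\<xi> * v) \<le> clarke_derivative f s v"
      then obtain y where y: "clarke_derivative f s v < ereal y" "y < \<xi> * v"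
        unfolding not_le using ereal_dense2[of "clarke_derivative f s v" "ereal (\<xi> * v)"] by auto
      obtain e where e: "e > 0" "\<And>z t. \<bar>z - s\<bar> < e \<Longrightarrow> 0 < t \<Longrightarrow> t < e \<Longrightarrow> f (z + t * v) - f z \<le> y * t"
        using clarke_derivative_less[OF y(1)] by blast
      have le: "clarke_derivative f s (sgn v) \<le> ereal (y / \<bar>v\<bar>)"
      proof (rule clarke_derivative_le)
        \<comment> \<open>The first entry controls the base point, the second gives
          \<open>t / \<bar>v\<bar> < e\<close> for the rescaled step.\<close>
        show "min e (e * \<bar>v\<bar>) > 0" using e(1) False by simp
        fix z t assume zt: "\<bar>z - s\<bar> < min e (e * \<bar>v\<bar>)" "0 < t" "t < min e (e * \<bar>v\<bar>)"
        have "t / \<bar>v\<bar> < e" using zt False by (simp add: divide_less_eq)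
        then have "f (z + t / \<bar>v\<bar> * v) - f z \<le> y * (t / \<bar>v\<bar>)" using zt False by (intro e(2)) simp_all
        moreover have "t / \<bar>v\<bar> * v = t * sgn v" using False by (simp add: sgn_div_norm divide_inverse)
        ultimately show "f (z + t * sgn v) - f z \<le> y / \<bar>v\<bar> * t" by simp
      qed
      have "y / \<bar>v\<bar> < \<xi> * sgn v"
      proof -
        have "y / \<bar>v\<bar> < \<xi> * v / \<bar>v\<bar>" using y(2) False by (intro divide_strict_right_mono) simp_all
        then show ?thesis by (simp add: sgn_div_norm divide_inverse mult.assoc mult.commute[of v])
      qed
      then show False
        using le \<xi> False by (cases "v > 0") (simp_all add: clarke_derivative_real)
    qed
  qed
  then show "\<xi> \<in> clarke_gradient f s" by (simp add: clarke_gradient_def)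
qed

lemma clarke_max_eq: "clarke_max f s = clarke_upper f s"
  unfolding clarke_max_def clarke_gradient_eq
  by (rule Greatest_equality) (use clarke_lower_le_upper in auto)

lemma clarke_min_eq: "clarke_min f s = clarke_lower f s"
  unfolding clarke_min_def clarke_gradient_eq
  by (rule Least_equality) (use clarke_lower_le_upper in auto)

lemma locally_lipschitz_continuous: "isCont f s"
proof -
  obtain e L where L: "e > 0" "L \<ge> 0" "\<And>z t. \<bar>z - s\<bar> < e \<Longrightarrow> \<bar>t\<bar> < e \<Longrightarrow> \<bar>f (z + t) - f z\<bar> \<le> L * \<bar>t\<bar>"
    by (rule locally_lipschitz_increment[OF ll, of s]) blast
  have "((\<lambda>h. f (s + h) - f s) \<longlongrightarrow> 0) (at 0)"
  proof (rule Lim_null_comparison)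
    show "\<forall>\<^sub>F h in at 0. norm (f (s + h) - f s) \<le> L * \<bar>h\<bar>"
      unfolding eventually_at using L by (intro exI[of _ e]) (simp add: dist_real_def)
    have "((\<lambda>h. L * \<bar>h\<bar>) \<longlongrightarrow> L * \<bar>0\<bar>) (at (0::real))" by (intro tendsto_intros)
    then show "((\<lambda>h. L * \<bar>h\<bar>) \<longlongrightarrow> 0) (at (0::real))" by simp
  qed
  then show ?thesis unfolding isCont_iff by (rule LIM_zero_cancel)
qed

text \<open>A slope strictly below \<open>\<kappa>\<close> is valid on a window around each point,
  and bisection adds up the windows on \<open>[a', b]\<close>. The endpoint \<open>a\<close>, where
  no bound is assumed, is reached by continuity, and then \<open>\<kappa>'\<close> increases to
  \<open>\<kappa>\<close>.\<close>

lemma clarke_lower_increment: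
  assumes "a < b" "\<And>x. a < x \<Longrightarrow> x \<le> b \<Longrightarrow> \<kappa> \<le> clarke_lower f x"
  shows "\<kappa> * (b - a) \<le> f b - f a"
proof -
  have inner: "\<kappa>' * (b - a') \<le> f b - f a'" if \<kappa>': "\<kappa>' < \<kappa>" and a': "a < a'" "a' < b" for \<kappa>' a'
  proof -
    have "a' \<le> b" using a' by simp
    then show ?thesis
    proof (induction rule: Bolzano)
      case (trans x y z)
      have "\<kappa>' * (z - x) = \<kappa>' * (y - x) + \<kappa>' * (z - y)" by (simp add: algebra_simps)
      with trans show ?case by linarith
    next
      case (local x)
      then have "\<kappa>' < clarke_lower f x" using \<kappa>' a' assms(2)[of x] by simp
      then obtain e where e: "e > 0" "\<And>z t. \<bar>z - x\<bar> < e \<Longrightarrow> 0 < t \<Longrightarrow> t < e \<Longrightarrow> \<kappa>' * t \<le> f (z + t) - f z"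
        using clarke_lower_greater by blast
      have "\<kappa>' * (d - c) \<le> f d - f c" if "c \<le> x" "x \<le> d" "d - c < e" for c d
      proof (cases "c = d")
        case False
        then show ?thesis using e(2)[of c "d - c"] that by simp
      qed simp
      with e(1) show ?case by blast
    qed
  qed
  have "\<kappa>' * (b - a) \<le> f b - f a" if \<kappa>': "\<kappa>' < \<kappa>" for \<kappa>'
  proof (rule tendsto_le)
    show "at_right a \<noteq> bot" by simp
    have "(f \<longlongrightarrow> f a) (at_right a)"
      using locally_lipschitz_continuous[of a] by (simp add: isCont_def filterlim_at_split)
    then show "((\<lambda>x. f b - f x) \<longlongrightarrow> f b - f a) (at_right a)" by (intro tendsto_intros)
    show "((\<lambda>x. \<kappa>' * (b - x)) \<longlongrightarrow> \<kappa>' * (b - a)) (at_right a)" by (intro tendsto_intros)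
    show "\<forall>\<^sub>F x in at_right a. \<kappa>' * (b - x) \<le> f b - f x"
      unfolding eventually_at_right_field using inner[OF \<kappa>'] assms(1) by blast
  qed
  then have "\<kappa>' \<le> (f b - f a) / (b - a)" if "\<kappa>' < \<kappa>" for \<kappa>'
    using that assms(1) by (simp add: le_divide_eq)
  then have "\<kappa> \<le> (f b - f a) / (b - a)" by (rule dense_le)
  then show ?thesis using assms(1) by (simp add: le_divide_eq)
qed

end

section \<open>Zero extension of the data\<close>

lemma zero_extension_eq: "F 0 = 0 \<Longrightarrow> zero_extension F s = F (max s 0)"
  by (simp add: zero_extension_def max_def)

text \<open>The extension is \<open>F\<close> after the positive part, which is 1-Lipschitz; all
  negative arguments collapse to 0, so the constant at 0 works on a half-line.\<close>

lemma zero_extension_lipschitz_near: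
  assumes "locally_lipschitz_on {0..} F" "F 0 = 0"
  obtains \<rho> L where "\<rho> > 0" "L \<ge> 0"
    "\<And>s t. s \<le> \<rho> \<Longrightarrow> t \<le> \<rho> \<Longrightarrow> \<bar>zero_extension F s - zero_extension F t\<bar> \<le> L * \<bar>s - t\<bar>"
proof -
  obtain r L where r: "r > 0" "L-lipschitz_on (cball 0 r \<inter> {0..}) F"
    using assms(1) unfolding locally_lipschitz_on_def by (metis atLeast_iff order_refl)
  show ?thesis
  proof (rule that[OF r(1) lipschitz_on_nonneg[OF r(2)]])
    fix s t assume "s \<le> r" "t \<le> r"
    then have "\<bar>F (max s 0) - F (max t 0)\<bar> \<le> L * \<bar>max s 0 - max t 0\<bar>"
      using lipschitz_onD[OF r(2), of "max s 0" "max t 0"] r(1) by (simp add: dist_real_def)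
    also have "\<dots> \<le> L * \<bar>s - t\<bar>"
      using lipschitz_on_nonneg[OF r(2)] by (intro mult_left_mono) (simp_all add: max_def)
    finally show "\<bar>zero_extension F s - zero_extension F t\<bar> \<le> L * \<bar>s - t\<bar>"
      by (simp add: zero_extension_eq[of F, OF assms(2)])
  qed
qed

lemma zero_extension_locally_lipschitz:
  assumes "locally_lipschitz_on {0..} F" "F 0 = 0"
  shows "locally_lipschitz_on UNIV (zero_extension F)"
  unfolding locally_lipschitz_on_def
proof
  fix x :: real
  show "\<exists>r>0. \<exists>L. L-lipschitz_on (cball x r \<inter> UNIV) (zero_extension F)"
  proof (cases "x < 0")
    case True
    have "0-lipschitz_on (cball x (- x / 2) \<inter> UNIV) (zero_extension F)"
      using True by (intro lipschitz_onI) (auto simp: zero_extension_def dist_real_def)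
    then show ?thesis using True by (intro exI[of _ "- x / 2"] conjI exI[of _ 0]) simp_all
  next
    case False
    then obtain r L where r: "r > 0" "L-lipschitz_on (cball x r \<inter> {0..}) F"
      using assms(1) unfolding locally_lipschitz_on_def by (metis atLeast_iff not_le)
    have "L-lipschitz_on (cball x r \<inter> UNIV) (zero_extension F)"
    proof (rule lipschitz_onI[OF _ lipschitz_on_nonneg[OF r(2)]])
      fix s t assume "s \<in> cball x r \<inter> UNIV" "t \<in> cball x r \<inter> UNIV"
      then have "max s 0 \<in> cball x r \<inter> {0..}" "max t 0 \<in> cball x r \<inter> {0..}"
        using False by (auto simp: dist_real_def max_def)
      from lipschitz_onD[OF r(2) this] have "dist (F (max s 0)) (F (max t 0)) \<le> L * dist (max s 0) (max t 0)" .
      also have "\<dots> \<le> L * dist s t"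
        using lipschitz_on_nonneg[OF r(2)] by (intro mult_left_mono) (simp_all add: dist_real_def max_def)
      finally show "dist (zero_extension F s) (zero_extension F t) \<le> L * dist s t"
        by (simp add: zero_extension_eq[of F, OF assms(2)])
    qed
    with r(1) show ?thesis by blast
  qed
qed

section \<open>Solutions for a frozen potential\<close>

text \<open>The sum is swept out by first moving the left summand from \<open>a1\<close> to
  \<open>a2\<close> with \<open>b1\<close> fixed, then moving the right one.\<close>

lemma interval_sum_decompose:
  fixes a1 a2 b1 b2 l x :: real
  assumes "a1 \<le> a2" "b1 \<le> b2" "0 \<le> l" "a1 + l * b1 \<le> x" "x \<le> a2 + l * b2"
  shows "\<exists>a b. x = a + l * b \<and> a \<in> {a1..a2} \<and> b \<in> {b1..b2}"
proof (cases "x \<le> a2 + l * b1")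
  case True
  then show ?thesis using assms by (intro exI[of _ "x - l * b1"] exI[of _ b1]) simp
next
  case False
  then have "l \<noteq> 0" using assms(5) by auto
  with assms(3) have l: "l > 0" by simp
  have "x = a2 + l * ((x - a2) / l) \<and> a2 \<in> {a1..a2} \<and> (x - a2) / l \<in> {b1..b2}"
    using assms False l by (auto simp: field_simps)
  then show ?thesis by blast
qed

lemma exists_small_inverse:
  fixes e :: real
  assumes "e > 0"
  shows "\<exists>m::nat. 1 / Suc m < e"
  using reals_Archimedean[OF assms] by (simp add: inverse_eq_divide)

text \<open>Half of the gap is distributed as \<open>\<eta>\<close> on \<open>f\<close> and
  \<open>l * \<eta>\<close> on \<open>l * g\<close>, which leaves a slope strictly below
  \<open>x\<close>. Strictness is used both for a negative slope at \<open>a\<close> and for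
  contradictions in \<open>clarke_inclusion\<close>.\<close>

lemma sum_clarke_upper:
  assumes f: "locally_lipschitz_on UNIV f" and g: "locally_lipschitz_on UNIV g" and l: "l \<ge> 0"
    and less: "clarke_upper f s + l * clarke_upper g s < x"
  shows "\<exists>e>0. \<exists>r<x. \<forall>z t. \<bar>z - s\<bar> < e \<longrightarrow> 0 < t \<longrightarrow> t < e \<longrightarrow> (f (z + t) + l * g (z + t)) - (f z + l * g z) \<le> r * t"
proof -
  define \<eta> where "\<eta> = (x - (clarke_upper f s + l * clarke_upper g s)) / (2 * (1 + l))"
  have \<eta>: "\<eta> > 0" using less l by (simp add: \<eta>_def)
  have "(1 + l) * \<eta> = (x - (clarke_upper f s + l * clarke_upper g s)) / 2"
    using l unfolding \<eta>_def by (simp add: field_simps)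
  then have r: "(clarke_upper f s + \<eta>) + l * (clarke_upper g s + \<eta>) < x"
    using less by (simp add: algebra_simps)
  obtain d where d: "d > 0" "\<And>z t. \<bar>z - s\<bar> < d \<Longrightarrow> 0 < t \<Longrightarrow> t < d \<Longrightarrow> f (z + t) - f z \<le> (clarke_upper f s + \<eta>) * t"
    using clarke_upper_less[OF f, of s "clarke_upper f s + \<eta>"] \<eta> by auto
  obtain e where e: "e > 0" "\<And>z t. \<bar>z - s\<bar> < e \<Longrightarrow> 0 < t \<Longrightarrow> t < e \<Longrightarrow> g (z + t) - g z \<le> (clarke_upper g s + \<eta>) * t"
    using clarke_upper_less[OF g, of s "clarke_upper g s + \<eta>"] \<eta> by auto
  show "\<exists>e>0. \<exists>r<x. \<forall>z t. \<bar>z - s\<bar> < e \<longrightarrow> 0 < t \<longrightarrow> t < e \<longrightarrow> (f (z + t) + l * g (z + t)) - (f z + l * g z) \<le> r * t"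
  proof (rule exI[of _ "min d e"], intro conjI exI[of _ "(clarke_upper f s + \<eta>) + l * (clarke_upper g s + \<eta>)"] allI impI r)
    fix z t assume zt: "\<bar>z - s\<bar> < min d e" "0 < t" "t < min d e"
    have "l * (g (z + t) - g z) \<le> l * ((clarke_upper g s + \<eta>) * t)"
      using zt l by (intro mult_left_mono e(2)) simp_all
    with d(2)[of z t] zt show "(f (z + t) + l * g (z + t)) - (f z + l * g z) \<le> ((clarke_upper f s + \<eta>) + l * (clarke_upper g s + \<eta>)) * t"
      by (simp add: algebra_simps)
  qed (use d e in simp)
qed

lemma sum_clarke_lower:
  assumes f: "locally_lipschitz_on UNIV f" and g: "locally_lipschitz_on UNIV g" and l: "l \<ge> 0"
    and less: "x < clarke_lower f s + l * clarke_lower g s"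
  shows "\<exists>e>0. \<exists>r>x. \<forall>z t. \<bar>z - s\<bar> < e \<longrightarrow> 0 < t \<longrightarrow> t < e \<longrightarrow> r * t \<le> (f (z + t) + l * g (z + t)) - (f z + l * g z)"
proof -
  define \<eta> where "\<eta> = ((clarke_lower f s + l * clarke_lower g s) - x) / (2 * (1 + l))"
  have \<eta>: "\<eta> > 0" using less l by (simp add: \<eta>_def)
  have "(1 + l) * \<eta> = ((clarke_lower f s + l * clarke_lower g s) - x) / 2"
    using l unfolding \<eta>_def by (simp add: field_simps)
  then have r: "(clarke_lower f s - \<eta>) + l * (clarke_lower g s - \<eta>) > x"
    using less by (simp add: algebra_simps)
  obtain d where d: "d > 0" "\<And>z t. \<bar>z - s\<bar> < d \<Longrightarrow> 0 < t \<Longrightarrow> t < d \<Longrightarrow> (clarke_lower f s - \<eta>) * t \<le> f (z + t) - f z"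
    using clarke_lower_greater[OF f, of "clarke_lower f s - \<eta>" s] \<eta> by auto
  obtain e where e: "e > 0" "\<And>z t. \<bar>z - s\<bar> < e \<Longrightarrow> 0 < t \<Longrightarrow> t < e \<Longrightarrow> (clarke_lower g s - \<eta>) * t \<le> g (z + t) - g z"
    using clarke_lower_greater[OF g, of "clarke_lower g s - \<eta>" s] \<eta> by auto
  show "\<exists>e>0. \<exists>r>x. \<forall>z t. \<bar>z - s\<bar> < e \<longrightarrow> 0 < t \<longrightarrow> t < e \<longrightarrow> r * t \<le> (f (z + t) + l * g (z + t)) - (f z + l * g z)"
  proof (rule exI[of _ "min d e"], intro conjI exI[of _ "(clarke_lower f s - \<eta>) + l * (clarke_lower g s - \<eta>)"] allI impI r)
    fix z t assume zt: "\<bar>z - s\<bar> < min d e" "0 < t" "t < min d e"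
    have "l * ((clarke_lower g s - \<eta>) * t) \<le> l * (g (z + t) - g z)"
      using zt l by (intro mult_left_mono e(2)) simp_all
    with d(2)[of z t] zt show "((clarke_lower f s - \<eta>) + l * (clarke_lower g s - \<eta>)) * t \<le> (f (z + t) + l * g (z + t)) - (f z + l * g z)"
      by (simp add: algebra_simps)
  qed (use d e in simp)
qed

text \<open>
  Here \<open>F\<close> and \<open>G\<close> play the role of the zero extensions, and \<open>a\<close> is a point at which the generalized
  gradient of \<open>F + l G\<close> is negative. Freezing the potential beyond \<open>a\<close> makes it globally
  Lipschitz; a minimizer with values in \<open>{0..\<delta>}\<close>, \<open>\<delta> < a\<close>, does not notice the change.
\<close>

locale frozen_potential = bounded_open \<Omega> for \<Omega> :: "(real^'n) set" +
  fixes F G :: "real \<Rightarrow> real" and l a L :: real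
  assumes F: "locally_lipschitz_on UNIV F" and G: "locally_lipschitz_on UNIV G" and l: "0 \<le> l" and a: "0 < a"
    and lipschitz: "\<And>s t. s \<le> a \<Longrightarrow> t \<le> a \<Longrightarrow> \<bar>(F s + l * G s) - (F t + l * G t)\<bar> \<le> L * \<bar>s - t\<bar>"
    and zero: "\<And>s. s \<le> 0 \<Longrightarrow> F s = 0" "\<And>s. s \<le> 0 \<Longrightarrow> G s = 0"
    and neg: "clarke_upper F a + l * clarke_upper G a < 0"
begin

definition P :: "real \<Rightarrow> real" where "P s = F s + l * G s"

definition K :: "real \<Rightarrow> real" where "K s = P (min s a)"

lemma L_nonneg: "0 \<le> L"
  using lipschitz[of 0 "-1"] a zero by simp

sublocale lipschitz_potential \<Omega> K L
proof
  fix s t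
  have "\<bar>K s - K t\<bar> \<le> L * \<bar>min s a - min t a\<bar>" using lipschitz[of "min s a" "min t a"] by (simp add: K_def P_def)
  also have "\<dots> \<le> L * \<bar>s - t\<bar>" using L_nonneg by (intro mult_left_mono) (simp_all add: min_def)
  finally show "\<bar>K s - K t\<bar> \<le> L * \<bar>s - t\<bar>" .
qed

lemma K_nonpos_arg: "s \<le> 0 \<Longrightarrow> K s = 0"
  using a by (simp add: K_def P_def zero min_def)

lemma K_le:
  assumes "0 \<le> s"
  shows "K s \<le> L * s"
  using K_lipschitz[of s 0] K_nonpos_arg[of 0] assms by (simp add: abs_le_iff)

lemma K_bounded: "K s \<le> L * a"
proof (cases "s \<le> 0")
  case True then show ?thesis using K_nonpos_arg[OF True] L_nonneg a by simp
next
  case False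
  have "K s = K (min s a)" by (simp add: K_def)
  also have "\<dots> \<le> L * min s a" using False a by (intro K_le) simp
  also have "\<dots> \<le> L * a" using L_nonneg by (intro mult_left_mono) simp_all
  finally show ?thesis .
qed

text \<open>The upper slope of \<open>P\<close> at \<open>a\<close> is negative on a window, and
  \<open>d\<close> is at most half of that window and half of \<open>a\<close>. Values above
  \<open>\<delta>\<close>, frozen beyond \<open>a\<close>, are then at most
  \<open>P \<delta>\<close>; negative arguments give 0, the value at 0.\<close>

lemma K_clip: "\<exists>\<delta>. 0 < \<delta> \<and> \<delta> < a \<and> (\<forall>s. K s \<le> K (clip \<delta> s))"
proof -
  obtain e r where e: "e > 0" "r < 0" "\<And>z t. \<bar>z - a\<bar> < e \<Longrightarrow> 0 < t \<Longrightarrow> t < e \<Longrightarrow> P (z + t) - P z \<le> r * t"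
    using sum_clarke_upper[OF F G l neg] unfolding P_def by blast
  define d where "d = min (e / 2) (a / 2)"
  have d: "0 < d" "d < e" "d < a"
  proof -
    show "0 < d" using e(1) a by (simp add: d_def)
    have "d \<le> e / 2" "d \<le> a / 2" by (simp_all add: d_def)
    then show "d < e" "d < a" using e(1) a by linarith+
  qed
  define \<delta> where "\<delta> = a - d"
  have \<delta>: "0 < \<delta>" "\<delta> < a" using d by (simp_all add: \<delta>_def)
  have "K s \<le> K (clip \<delta> s)" for s
  proof -
    consider "s \<le> 0" | "0 < s" "s \<le> \<delta>" | "\<delta> < s" by linarith
    then show ?thesis
    proof cases
      case 1 then show ?thesis using \<delta> K_nonpos_arg[of 0] K_nonpos_arg[OF 1] by (simp add: clip_def)
    next
      case 2 then show ?thesis by (simp add: clip_def)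
    next
      case 3
      have "\<bar>\<delta> - a\<bar> < e" "0 < min s a - \<delta>" "min s a - \<delta> < e" using d \<delta> 3 by (auto simp: \<delta>_def min_def)
      from e(3)[OF this] have "P (min s a) - P \<delta> \<le> r * (min s a - \<delta>)" by simp
      also have "\<dots> \<le> 0" using e(2) \<open>0 < min s a - \<delta>\<close> by (intro mult_nonpos_nonneg) simp_all
      finally have "P (min s a) \<le> P \<delta>" by simp
      moreover have "clip \<delta> s = \<delta>" using 3 \<delta> by (simp add: clip_def)
      ultimately show ?thesis using \<delta> by (simp add: K_def)
    qed
  qed
  with \<delta> show ?thesis by blast
qed

text \<open>Half of the gap between \<open>\<delta>\<close> and \<open>a\<close> is spent on the
  base point and half on the step, so both arguments stay left of the freezing point.\<close>

lemma K_increment: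
  assumes "\<delta> < a" "s \<le> \<delta>" "\<bar>z - s\<bar> < (a - \<delta>) / 2" "0 < t" "t < (a - \<delta>) / 2"
  shows "K (z + t) - K z = (F (z + t) + l * G (z + t)) - (F z + l * G z)"
proof -
  define d where "d = (a - \<delta>) / 2"
  have "a = \<delta> + 2 * d" by (simp add: d_def field_simps)
  then have "z + t \<le> a" "z \<le> a" using assms(2-5) unfolding d_def[symmetric] by linarith+
  then show ?thesis by (simp add: K_def P_def min_def)
qed

text \<open>If \<open>\<xi>\<close> exceeded the sum of the upper endpoints, some slope below
  \<open>\<xi>\<close> would be valid on a window, contradicting the bound at a finer scale
  \<open>1 / Suc m\<close>; likewise below. The interval between the sums of endpoints is exactly
  the sum of the two gradients.\<close>

lemma clarke_inclusion:
  assumes \<delta>: "\<delta> < a" and s: "s \<le> \<delta>"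
    and up: "\<And>m r. (\<And>z t. \<bar>z - s\<bar> < 1 / Suc m \<Longrightarrow> 0 < t \<Longrightarrow> t < 1 / Suc m \<Longrightarrow> K (z + t) - K z \<le> r * t) \<Longrightarrow> \<xi> \<le> r"
    and lo: "\<And>m r. (\<And>z t. \<bar>z - s\<bar> < 1 / Suc m \<Longrightarrow> 0 < t \<Longrightarrow> t < 1 / Suc m \<Longrightarrow> r * t \<le> K (z + t) - K z) \<Longrightarrow> r \<le> \<xi>"
  shows "\<exists>a b. \<xi> = a + l * b \<and> a \<in> clarke_gradient F s \<and> b \<in> clarke_gradient G s"
proof -
  have "\<xi> \<le> clarke_upper F s + l * clarke_upper G s"
  proof (rule ccontr)
    assume "\<not> ?thesis"
    then obtain e r where e: "e > 0" "r < \<xi>" "\<And>z t. \<bar>z - s\<bar> < e \<Longrightarrow> 0 < t \<Longrightarrow> t < e \<Longrightarrow>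
        (F (z + t) + l * G (z + t)) - (F z + l * G z) \<le> r * t"
      using sum_clarke_upper[OF F G l, of s \<xi>] unfolding not_le by blast
    obtain m :: nat where m: "1 / Suc m < min e ((a - \<delta>) / 2)"
      using exists_small_inverse[of "min e ((a - \<delta>) / 2)"] e(1) \<delta> by auto
    have "\<xi> \<le> r"
    proof (rule up[of m])
      fix z t :: real assume zt: "\<bar>z - s\<bar> < 1 / Suc m" "0 < t" "t < 1 / Suc m"
      have z: "\<bar>z - s\<bar> < e" "t < e" "\<bar>z - s\<bar> < (a - \<delta>) / 2" "t < (a - \<delta>) / 2"
        using zt m by (auto intro: less_trans)
      show "K (z + t) - K z \<le> r * t"
        using e(3)[OF z(1) zt(2) z(2)] K_increment[OF \<delta> s z(3) zt(2) z(4)] by simp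
    qed
    with e(2) show False by simp
  qed
  moreover have "clarke_lower F s + l * clarke_lower G s \<le> \<xi>"
  proof (rule ccontr)
    assume "\<not> ?thesis"
    then obtain e r where e: "e > 0" "r > \<xi>" "\<And>z t. \<bar>z - s\<bar> < e \<Longrightarrow> 0 < t \<Longrightarrow> t < e \<Longrightarrow>
        r * t \<le> (F (z + t) + l * G (z + t)) - (F z + l * G z)"
      using sum_clarke_lower[OF F G l, of \<xi> s] unfolding not_le by blast
    obtain m :: nat where m: "1 / Suc m < min e ((a - \<delta>) / 2)"
      using exists_small_inverse[of "min e ((a - \<delta>) / 2)"] e(1) \<delta> by auto
    have "r \<le> \<xi>"
    proof (rule lo[of m])
      fix z t :: real assume zt: "\<bar>z - s\<bar> < 1 / Suc m" "0 < t" "t < 1 / Suc m"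
      have z: "\<bar>z - s\<bar> < e" "t < e" "\<bar>z - s\<bar> < (a - \<delta>) / 2" "t < (a - \<delta>) / 2"
        using zt m by (auto intro: less_trans)
      show "r * t \<le> K (z + t) - K z"
        using e(3)[OF z(1) zt(2) z(2)] K_increment[OF \<delta> s z(3) zt(2) z(4)] by simp
    qed
    with e(2) show False by simp
  qed
  ultimately show ?thesis
    unfolding clarke_gradient_eq[OF F] clarke_gradient_eq[OF G]
    using interval_sum_decompose[OF clarke_lower_le_upper[OF F] clarke_lower_le_upper[OF G] l] by blast
qed

text \<open>The competitor is \<open>t * w\<close> truncated at height \<open>t\<close>: it equals
  \<open>t\<close> on a set of fixed positive measure, where the potential is at least
  \<open>N * t\<^sup>2\<close>, and elsewhere the potential is at least
  \<open>- C * t\<^sup>2\<close>. All terms scale like \<open>t\<^sup>2\<close>, so a large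
  \<open>N\<close> decides the sign.\<close>

lemma minimizer_energy_negative:
  assumes m: "energy_minimizer \<delta> u g" and ne: "\<Omega> \<noteq> {}" and \<delta>: "0 < \<delta>" "\<delta> < a"
    and \<rho>: "0 < \<rho>" "\<And>t. 0 \<le> t \<Longrightarrow> t < \<rho> \<Longrightarrow> - C * t\<^sup>2 \<le> P t" and C: "0 \<le> C"
    and large: "\<And>N \<epsilon>. 0 < \<epsilon> \<Longrightarrow> \<exists>t. 0 < t \<and> t < \<epsilon> \<and> N * t\<^sup>2 \<le> P t"
  shows "(LINT x|M. (norm (g x))\<^sup>2) / 2 - (LINT x|M. K (u x)) < 0"
proof -
  obtain x0 where x0: "x0 \<in> \<Omega>" using ne by blast
  obtain c d where cd: "cbox c d \<subseteq> \<Omega>" "x0 \<in> box c d"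
    by (rule open_contains_cbox[OF open_dom x0])
  obtain \<phi> where \<phi>: "test \<phi>" "\<And>x. \<phi> x \<ge> 0" "\<phi> x0 > 0"
    using bump_function[OF cd(1)] cd(2) by blast
  \<comment> \<open>Normalized to the value 2 at \<open>x0\<close>, so that \<open>w > 1\<close>
    holds on a nonempty open set, the plateau of the truncated bump.\<close>
  define w where "w x = (2 / \<phi> x0) * \<phi> x" for x
  have w: "test w" unfolding w_def by (rule test_function_cmult[OF \<phi>(1)])
  have w0: "0 \<le> w x" for x using \<phi> by (simp add: w_def)
  define U where "U = {x. 1 < w x}"
  have U: "open U" unfolding U_def
    by (intro open_Collect_less test_function_continuous[OF w] continuous_on_const)
  have "w x0 = 2" using \<phi>(3) by (simp add: w_def)
  then have "x0 \<in> U" by (simp add: U_def)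
  have "U \<subseteq> \<Omega>" using test_function_eq_0[OF w] by (force simp: U_def)
  then have Um: "U \<in> lmeasurable" using U bounded_dom bounded_subset lmeasurable_open by blast
  have "\<not> negligible U" using open_not_negligible[OF U] \<open>x0 \<in> U\<close> by blast
  then have "measure lebesgue U \<noteq> 0" using Um by (simp add: negligible_iff_measure)
  then have b0: "measure lebesgue U > 0" using measure_nonneg[of lebesgue U] by linarith
  define b where "b = measure M U"
  have "b = measure lebesgue U"
    unfolding b_def using \<open>U \<subseteq> \<Omega>\<close> dom_sets by (intro measure_restrict_space) auto
  then have b: "b > 0" using b0 by simp
  have UM: "U \<in> sets M" using U \<open>U \<subseteq> \<Omega>\<close> dom_sets by (simp add: sets_restrict_space_iff)
  define V where "V = (LINT x|M. (norm (gradient w x))\<^sup>2)"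
  \<comment> \<open>Chosen so that \<open>N * b\<close> minus \<open>C\<close> times the measure is
    \<open>V / 2 + 1 / 2\<close>: this beats the Dirichlet term \<open>V / 2\<close> by a fixed
    amount.\<close>
  define N where "N = (V + 2 * (C * measure M (space M)) + 1) / (2 * b)"
  have V: "0 \<le> V" unfolding V_def by simp
  have N: "0 \<le> N" using V C b by (simp add: N_def)
  obtain t where t: "0 < t" "t < min \<delta> \<rho>" "N * t\<^sup>2 \<le> P t"
    using large[of "min \<delta> \<rho>" N] \<delta> \<rho> by auto
  have ta: "t \<le> a" using t \<delta> by simp
  have low: "N * t\<^sup>2 * indicator U x - C * t\<^sup>2 \<le> K (clip t (t * w x))" for x
  proof (cases "1 < w x")
    case True
    then have "t * 1 \<le> t * w x" using t by (intro mult_left_mono) simp_all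
    then have "clip t (t * w x) = t" using t by (simp add: clip_def)
    then have "N * t\<^sup>2 \<le> K (clip t (t * w x))" using t(3) ta by (simp add: K_def)
    moreover have "0 \<le> C * t\<^sup>2" using C by simp
    moreover have "indicator U x = (1::real)" using True by (simp add: U_def)
    ultimately show ?thesis by simp
  next
    case False
    define q where "q = t * w x"
    have q: "0 \<le> q" "q \<le> t" unfolding q_def using False t w0[of x] by (simp_all add: mult_left_le)
    have "clip t q = q" using q by (simp add: clip_def)
    then have "K (clip t (t * w x)) = P q" using q ta by (simp add: K_def q_def[symmetric])
    moreover have "- C * q\<^sup>2 \<le> P q" using q t \<rho>(2)[of q] by simp
    moreover have "C * q\<^sup>2 \<le> C * t\<^sup>2" using q C by (intro mult_left_mono power_mono)
    moreover have "indicator U x = (0::real)" using False by (simp add: U_def)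
    ultimately show ?thesis by simp
  qed
  have tw: "test (\<lambda>x. t * w x)" by (rule test_function_cmult[OF w])
  have grad: "(LINT x|M. (norm (gradient (\<lambda>x. t * w x) x))\<^sup>2) = t\<^sup>2 * V"
    unfolding gradient_cmult[OF w] V_def by (simp add: power_mult_distrib)
  let ?E = "(LINT x|M. (norm (g x))\<^sup>2) / 2 - (LINT x|M. K (u x))"
  let ?J = "LINT x|M. K (clip t (t * w x))"
  have clipL2: "L2 M (\<lambda>x. clip t (t * w x))"
    using t(1) by (intro L2_clip test_function_measurable[OF tw]) simp
  \<comment> \<open>The sharp truncation is not a test function; its smooth version is admissible at
    an error proportional to \<open>\<epsilon>\<close>, which then tends to 0.\<close>
  have bound: "?E \<le> t\<^sup>2 * V / 2 - ?J + \<epsilon> * (L * measure M (space M))" if eps: "\<epsilon> > 0" for \<epsilon>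
  proof -
    obtain \<psi> where \<psi>: "test \<psi>" "energy \<psi> \<le> (LINT x|M. (norm (gradient (\<lambda>x. t * w x) x))\<^sup>2) / 2 - ?J + L * measure M (space M) * \<epsilon>"
      by (rule energy_clip[OF tw t(1) eps]) blast
    have "?E \<le> energy \<psi>" using m \<psi>(1) by (simp add: energy_minimizer_def)
    with \<psi>(2) show ?thesis unfolding grad by (simp add: mult.commute)
  qed
  have E: "?E \<le> t\<^sup>2 * V / 2 - ?J" by (rule le_of_le_add_small[of 1, OF _ bound]) simp_all
  have ind: "integrable M (indicator U :: _ \<Rightarrow> real)"
    using UM by (intro integrable_real_indicator) (simp_all add: emeasure_eq_measure)
  have IU: "(LINT x|M. indicator U x) = b"
    unfolding b_def using \<open>U \<subseteq> \<Omega>\<close> by (simp add: Int_absorb2)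
  have "t\<^sup>2 * (N * b - C * measure M (space M)) = N * t\<^sup>2 * (LINT x|M. indicator U x) - (LINT x|M. C * t\<^sup>2)"
    unfolding IU by (simp add: algebra_simps)
  also have "\<dots> = (LINT x|M. N * t\<^sup>2 * indicator U x - C * t\<^sup>2)"
    using ind by (subst Bochner_Integration.integral_diff) simp_all
  also have "\<dots> \<le> ?J"
    using ind K_integrable[OF clipL2] low by (intro integral_mono) simp_all
  finally have J: "t\<^sup>2 * (N * b - C * measure M (space M)) \<le> ?J" .
  have "N * b = (V + 2 * (C * measure M (space M)) + 1) / 2" using b by (simp add: N_def)
  then have Nb: "N * b - C * measure M (space M) = V / 2 + 1 / 2" by (simp add: field_simps)
  have "t\<^sup>2 * (N * b - C * measure M (space M)) = t\<^sup>2 * V / 2 + t\<^sup>2 / 2"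
    unfolding Nb by (simp add: distrib_left)
  moreover have "t\<^sup>2 > 0" using t by simp
  ultimately show ?thesis using E J by linarith
qed

theorem frozen_solution:
  assumes ne: "\<Omega> \<noteq> {}"
    and \<rho>: "0 < \<rho>" "\<And>t. 0 \<le> t \<Longrightarrow> t < \<rho> \<Longrightarrow> - C * t\<^sup>2 \<le> P t" and C: "0 \<le> C"
    and large: "\<And>N \<epsilon>. 0 < \<epsilon> \<Longrightarrow> \<exists>t. 0 < t \<and> t < \<epsilon> \<and> N * t\<^sup>2 \<le> P t"
  shows "\<exists>u \<xi>. u \<in> H01 \<Omega> \<and> (AE x in M. 0 \<le> u x \<and> u x \<le> a) \<and> \<not> (AE x in M. u x = 0) \<and>
    (H01_norm \<Omega> u)\<^sup>2 \<le> 2 * L * a * measure M (space M) \<and> L2 M \<xi> \<and>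
    (AE x in M. \<exists>a b. \<xi> x = a + l * b \<and> a \<in> clarke_gradient F (u x) \<and> b \<in> clarke_gradient G (u x)) \<and>
    (\<forall>v\<in>H01 \<Omega>. integrable M (\<lambda>x. \<xi> x * v x) \<and>
      (LINT x|M. weak_gradient \<Omega> u x \<bullet> weak_gradient \<Omega> v x) = (LINT x|M. \<xi> x * v x))"
proof -
  obtain \<delta> where \<delta>: "0 < \<delta>" "\<delta> < a" "\<And>s. K s \<le> K (clip \<delta> s)" using K_clip by blast
  obtain u g where m: "energy_minimizer \<delta> u g"
    using energy_minimizer_exists[OF K_bounded \<delta>(3) \<delta>(1)] by blast
  have pair: "H01_pair u g" and range: "AE x in M. 0 \<le> u x \<and> u x \<le> \<delta>"
    using m by (simp_all add: energy_minimizer_def)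
  have u: "L2 M u" and g: "L2 M g" using pair by (simp_all add: H01_pair_def)
  have [measurable]: "u \<in> borel_measurable M" "g \<in> borel_measurable M" using u g by (simp_all add: L2_def)
  have neg_energy: "(LINT x|M. (norm (g x))\<^sup>2) / 2 - (LINT x|M. K (u x)) < 0"
    by (rule minimizer_energy_negative[OF m ne \<delta>(1,2) \<rho> C large])
  have grad: "AE x in M. weak_gradient \<Omega> u x = g x" and wg: "weak_gradient \<Omega> u \<in> borel_measurable M"
    using weak_gradient_AE[OF H01_pair_weak_gradient[OF pair]] by (simp_all add: has_weak_gradient_iff L2_def)
  obtain \<xi> where \<xi>: "L2 M \<xi>" and eq: "\<And>v. test v \<Longrightarrow> (LINT x|M. g x \<bullet> gradient v x) = (LINT x|M. \<xi> x * v x)"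
    and incl: "AE x in M. \<forall>m::nat. \<forall>r.
      ((\<forall>z t. \<bar>z - u x\<bar> < 1 / Suc m \<longrightarrow> 0 < t \<longrightarrow> t < 1 / Suc m \<longrightarrow> K (z + t) - K z \<le> r * t) \<longrightarrow> \<xi> x \<le> r) \<and>
      ((\<forall>z t. \<bar>z - u x\<bar> < 1 / Suc m \<longrightarrow> 0 < t \<longrightarrow> t < 1 / Suc m \<longrightarrow> r * t \<le> K (z + t) - K z) \<longrightarrow> r \<le> \<xi> x)"
    using energy_minimizer_inclusion[OF m] by blast
  have "\<not> (AE x in M. u x = 0)"
  proof
    assume "AE x in M. u x = 0"
    then have "AE x in M. K (u x) = 0" by (rule eventually_mono) (simp add: K_nonpos_arg)
    then have "(LINT x|M. K (u x)) = 0" by (rule integral_eq_zero_AE)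
    moreover have "0 \<le> (LINT x|M. (norm (g x))\<^sup>2)" by simp
    ultimately show False using neg_energy by simp
  qed
  moreover have "(H01_norm \<Omega> u)\<^sup>2 \<le> 2 * L * a * measure M (space M)"
  proof -
    have "AE x in M. (norm (weak_gradient \<Omega> u x))\<^sup>2 = (norm (g x))\<^sup>2"
      using grad by (rule eventually_mono) simp
    then have "(H01_norm \<Omega> u)\<^sup>2 = (LINT x|M. (norm (g x))\<^sup>2)"
      unfolding H01_norm_def using wg by (simp add: integral_cong_AE)
    \<comment> \<open>Negative energy says that the Dirichlet integral is less than twice the
      potential term, which is at most \<open>L * a\<close> times the measure.\<close>
    also have "\<dots> \<le> 2 * (LINT x|M. K (u x))" using neg_energy by simp
    also have "(LINT x|M. K (u x)) \<le> (LINT x|M. L * a)"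
      using K_bounded K_integrable[OF u] by (intro integral_mono) simp_all
    finally show ?thesis by (simp add: mult.assoc mult.left_commute mult.commute)
  qed
  moreover have "AE x in M. \<exists>a b. \<xi> x = a + l * b \<and> a \<in> clarke_gradient F (u x) \<and> b \<in> clarke_gradient G (u x)"
    using eventually_conj[OF incl range]
  proof (rule eventually_mono, elim conjE)
    fix x
    assume *: "\<forall>m::nat. \<forall>r.
      ((\<forall>z t. \<bar>z - u x\<bar> < 1 / Suc m \<longrightarrow> 0 < t \<longrightarrow> t < 1 / Suc m \<longrightarrow> K (z + t) - K z \<le> r * t) \<longrightarrow> \<xi> x \<le> r) \<and>
      ((\<forall>z t. \<bar>z - u x\<bar> < 1 / Suc m \<longrightarrow> 0 < t \<longrightarrow> t < 1 / Suc m \<longrightarrow> r * t \<le> K (z + t) - K z) \<longrightarrow> r \<le> \<xi> x)"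
      and "u x \<le> \<delta>"
    show "\<exists>a b. \<xi> x = a + l * b \<and> a \<in> clarke_gradient F (u x) \<and> b \<in> clarke_gradient G (u x)"
      by (rule clarke_inclusion[OF \<delta>(2) \<open>u x \<le> \<delta>\<close>]) (use * in blast)+
  qed
  moreover have "\<forall>v\<in>H01 \<Omega>. integrable M (\<lambda>x. \<xi> x * v x) \<and>
      (LINT x|M. weak_gradient \<Omega> u x \<bullet> weak_gradient \<Omega> v x) = (LINT x|M. \<xi> x * v x)"
  proof
    fix v assume "v \<in> H01 \<Omega>"
    then obtain h where h: "H01_pair v h" unfolding H01_iff by blast
    note hw = weak_gradient_AE[OF H01_pair_weak_gradient[OF h]]
    have vL: "L2 M v" and hL: "L2 M h" using h by (simp_all add: H01_pair_def)
    have [measurable]: "h \<in> borel_measurable M" "weak_gradient \<Omega> v \<in> borel_measurable M"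
      using hL hw(1) by (simp_all add: has_weak_gradient_iff L2_def)
    have "AE x in M. weak_gradient \<Omega> u x \<bullet> weak_gradient \<Omega> v x = g x \<bullet> h x"
      using eventually_conj[OF grad hw(2)] by (rule eventually_mono) simp
    then have "(LINT x|M. weak_gradient \<Omega> u x \<bullet> weak_gradient \<Omega> v x) = (LINT x|M. g x \<bullet> h x)"
      using wg by (intro integral_cong_AE) simp_all
    also have "\<dots> = (LINT x|M. \<xi> x * v x)" by (rule H01_pair_inner_extend[OF g \<xi> eq h])
    finally show "integrable M (\<lambda>x. \<xi> x * v x) \<and>
      (LINT x|M. weak_gradient \<Omega> u x \<bullet> weak_gradient \<Omega> v x) = (LINT x|M. \<xi> x * v x)"
      using L2_integrable_mult[OF \<xi> vL] by simp
  qed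
  moreover have "AE x in M. 0 \<le> u x \<and> u x \<le> a"
    using range by (rule eventually_mono) (use \<delta>(2) in simp)
  moreover have "u \<in> H01 \<Omega>" using pair H01_iff by blast
  ultimately show ?thesis using \<xi> by (intro exI[of _ u] exI[of _ \<xi>]) simp
qed

end

section \<open>Arbitrarily small solutions\<close>

lemma exists_small_of_frequently:
  assumes "\<exists>\<^sub>F s in at_right (0::real). Q s" "\<epsilon> > 0"
  shows "\<exists>s. 0 < s \<and> s < \<epsilon> \<and> Q s"
proof -
  have "\<forall>\<^sub>F s in at_right 0. 0 < s \<and> s < \<epsilon>"
    unfolding eventually_at_right_field using assms(2) by blast
  then have "\<forall>\<^sub>F s in at_right 0. Q s \<longrightarrow> 0 < s \<and> s < \<epsilon> \<and> Q s" by (rule eventually_mono) simp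
  from frequently_ex[OF frequently_rev_mp[OF assms(1) this]] show ?thesis .
qed

lemma frequently_less_Liminf:
  assumes "Liminf F X < (y::ereal)"
  shows "\<exists>\<^sub>F s in F. X s < y"
proof (rule ccontr)
  assume "\<not> ?thesis"
  then have "\<forall>\<^sub>F s in F. y \<le> X s" by (simp add: not_frequently not_less)
  then have "y \<le> Liminf F X" by (rule Liminf_bounded)
  with assms show False by simp
qed

lemma frequently_greater_Limsup:
  assumes "(y::ereal) < Limsup F X"
  shows "\<exists>\<^sub>F s in F. y < X s"
proof (rule ccontr)
  assume "\<not> ?thesis"
  then have "\<forall>\<^sub>F s in F. X s \<le> y" by (simp add: not_frequently not_less)
  then have "Limsup F X \<le> y" by (rule Limsup_bounded)
  with assms show False by simp
qed

lemma eventually_positive_at_right: "\<forall>\<^sub>F s in at_right (0::real). 0 < s"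
  unfolding eventually_at_right_field by (intro exI[of _ 1]) simp

text \<open>It suffices to find \<open>r\<close> above \<open>l\<^sub>0\<close> and
  \<open>c'\<close> above \<open>c\<close> such that \<open>r * s + l * (c' * s powr p)\<close> is
  eventually nonpositive: the first summand dominates \<open>\<Phi>\<close> frequently, and
  \<open>c' * s powr p\<close> dominates \<open>\<Gamma>\<close> eventually.\<close>

lemma frequently_negative_gradient:
  fixes \<Phi> \<Gamma> :: "real \<Rightarrow> real" and l\<^sub>0 :: ereal
  assumes \<Phi>: "l\<^sub>0 = Liminf (at_right 0) (\<lambda>s. ereal (\<Phi> s / s))" "l\<^sub>0 < 0"
    and \<Gamma>: "Limsup (at_right 0) (\<lambda>s. ereal (\<Gamma> s / s powr p)) = ereal c"
    and cases: "(p = 1 \<and> l \<ge> 0 \<and> ereal (l * c) < - l\<^sub>0) \<or> (p > 1 \<and> l \<ge> 0)"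
  shows "\<exists>\<^sub>F s in at_right 0. \<Phi> s + l * \<Gamma> s < 0"
proof -
  have l: "l \<ge> 0" using cases by auto
  have "\<exists>r c'. l\<^sub>0 < ereal r \<and> c < c' \<and> (\<forall>\<^sub>F s in at_right 0. r * s + l * (c' * s powr p) \<le> 0)"
    using cases
  proof
    assume p: "p = 1 \<and> l \<ge> 0 \<and> ereal (l * c) < - l\<^sub>0"
    have "\<exists>r c'. l\<^sub>0 < ereal r \<and> c < c' \<and> r + l * c' \<le> 0"
    proof (cases "l = 0")
      case True
      obtain r where "l\<^sub>0 < ereal r" "r < 0" using ereal_dense2[OF \<Phi>(2)] by auto
      then show ?thesis using True by (intro exI[of _ r] exI[of _ "c + 1"]) simp
    next
      case False
      have "l\<^sub>0 < ereal (- (l * c))" using p ereal_less_uminus_reorder[of "ereal (l * c)" l\<^sub>0] by simp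
      then obtain r where r: "l\<^sub>0 < ereal r" "r < - (l * c)"
        using ereal_dense2 by (metis less_ereal.simps(1))
      have "l > 0" using False l by simp
      \<comment> \<open>The choice \<open>c' = - r / l\<close> makes \<open>r + l * c'\<close>
        vanish; \<open>r < - (l * c)\<close> is what places it above \<open>c\<close>.\<close>
      then have "c < - r / l" using r(2) by (simp add: pos_less_divide_eq[of l c "- r"] mult.commute del: minus_divide_left[symmetric])
      moreover have "r + l * (- r / l) \<le> 0" using False by simp
      ultimately show ?thesis using r(1) by blast
    qed
    then obtain r c' where rc: "l\<^sub>0 < ereal r" "c < c'" "r + l * c' \<le> 0" by blast
    have "\<forall>\<^sub>F s in at_right 0. r * s + l * (c' * s powr p) \<le> 0"
      using eventually_positive_at_right
    proof (rule eventually_mono)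
      fix s :: real assume s: "0 < s"
      have "r * s + l * (c' * s powr p) = (r + l * c') * s" using p s by (simp add: algebra_simps)
      also have "\<dots> \<le> 0" using rc(3) s by (intro mult_nonpos_nonneg) simp_all
      finally show "r * s + l * (c' * s powr p) \<le> 0" .
    qed
    with rc show ?thesis by blast
  next
    assume p: "p > 1 \<and> l \<ge> 0"
    obtain r where r: "l\<^sub>0 < ereal r" "r < 0" using ereal_dense2[OF \<Phi>(2)] by auto
    \<comment> \<open>For \<open>p > 1\<close> the \<open>\<Gamma>\<close> term is of higher order
      than \<open>s\<close>, so any negative \<open>r\<close> absorbs it near 0.\<close>
    have "((\<lambda>s. s powr (p - 1)) \<longlongrightarrow> 0) (at_right (0::real))"
    proof (rule tendsto_zero_powrI)
      show "((\<lambda>s. s) \<longlongrightarrow> 0) (at_right (0::real))" by (rule tendsto_ident_at)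
      show "\<forall>\<^sub>F s in at_right (0::real). 0 \<le> s" using eventually_positive_at_right by (rule eventually_mono) simp
    qed (use p in auto)
    then have "((\<lambda>s. l * ((c + 1) * s powr (p - 1))) \<longlongrightarrow> l * ((c + 1) * 0)) (at_right (0::real))"
      by (intro tendsto_mult_left)
    then have "\<forall>\<^sub>F s in at_right (0::real). l * ((c + 1) * s powr (p - 1)) < - r"
      by (rule order_tendstoD(2)) (use r in simp)
    from eventually_conj[OF this eventually_positive_at_right]
    have "\<forall>\<^sub>F s in at_right 0. r * s + l * ((c + 1) * s powr p) \<le> 0"
    proof (rule eventually_mono, elim conjE)
      fix s :: real assume s: "0 < s" and lt: "l * ((c + 1) * s powr (p - 1)) < - r"
      have "s powr p = s powr (p - 1) * s" using s by (simp add: powr_diff)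
      then have "r * s + l * ((c + 1) * s powr p) = (r + l * ((c + 1) * s powr (p - 1))) * s"
        by (simp add: algebra_simps)
      also have "\<dots> \<le> 0" using lt s by (intro mult_nonpos_nonneg) simp_all
      finally show "r * s + l * ((c + 1) * s powr p) \<le> 0" .
    qed
    with r(1) show ?thesis by (intro exI[of _ r] exI[of _ "c + 1"]) simp
  qed
  then obtain r c' where rc: "l\<^sub>0 < ereal r" "c < c'" and le: "\<forall>\<^sub>F s in at_right 0. r * s + l * (c' * s powr p) \<le> 0"
    by blast
  have 1: "\<exists>\<^sub>F s in at_right 0. ereal (\<Phi> s / s) < ereal r"
    using rc(1) unfolding \<Phi>(1) by (rule frequently_less_Liminf)
  have 2: "\<forall>\<^sub>F s in at_right 0. ereal (\<Gamma> s / s powr p) < ereal c'"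
    by (rule Limsup_lessD) (use \<Gamma> rc(2) in simp)
  from eventually_conj[OF eventually_conj[OF 2 le] eventually_positive_at_right]
  have "\<forall>\<^sub>F s in at_right 0. ereal (\<Phi> s / s) < ereal r \<longrightarrow> \<Phi> s + l * \<Gamma> s < 0"
  proof (rule eventually_mono, elim conjE, intro impI)
    fix s :: real
    assume s: "0 < s" and r: "r * s + l * (c' * s powr p) \<le> 0"
      and \<Gamma>s: "ereal (\<Gamma> s / s powr p) < ereal c'" and \<Phi>s: "ereal (\<Phi> s / s) < ereal r"
    have "\<Phi> s < r * s" using \<Phi>s s by (simp add: divide_less_eq)
    moreover have "\<Gamma> s \<le> c' * s powr p" using \<Gamma>s s by (simp add: divide_less_eq)
    then have "l * \<Gamma> s \<le> l * (c' * s powr p)" using l by (rule mult_left_mono)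
    ultimately show "\<Phi> s + l * \<Gamma> s < 0" using r by linarith
  qed
  from frequently_rev_mp[OF 1 this] show ?thesis .
qed

text \<open>Near 0 the lower slope at \<open>x\<close> exceeds \<open>- k * x powr p\<close>, and
  \<open>x powr p \<le> t\<close> for \<open>x \<le> t < 1\<close> since \<open>p \<ge> 1\<close>.
  The mean value inequality on \<open>[0, t]\<close> supplies the second factor
  \<open>t\<close>.\<close>

lemma clarke_lower_quadratic_bound:
  assumes g: "locally_lipschitz_on UNIV g" and g0: "g 0 = 0" and p: "p \<ge> 1"
    and lim: "ereal c = Liminf (at_right 0) (\<lambda>s. ereal (clarke_lower g s / s powr p))"
  shows "\<exists>k\<ge>0. \<exists>\<rho>>0. \<forall>t. 0 \<le> t \<longrightarrow> t < \<rho> \<longrightarrow> - k * t\<^sup>2 \<le> g t"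
proof -
  have "ereal (c - 1) < Liminf (at_right 0) (\<lambda>s. ereal (clarke_lower g s / s powr p))"
    unfolding lim[symmetric] by simp
  then have "\<forall>\<^sub>F s in at_right 0. ereal (c - 1) < ereal (clarke_lower g s / s powr p)" by (rule less_LiminfD)
  then obtain b where b: "b > 0" "\<And>s. 0 < s \<Longrightarrow> s < b \<Longrightarrow> c - 1 < clarke_lower g s / s powr p"
    unfolding eventually_at_right_field by auto
  define k where "k = \<bar>c - 1\<bar>"
  have "- k * t\<^sup>2 \<le> g t" if t: "0 \<le> t" "t < min b 1" for t
  proof (cases "t = 0")
    case False
    with t have t0: "0 < t" "t < b" "t < 1" by simp_all
    have "- k * t \<le> clarke_lower g x" if x: "0 < x" "x \<le> t" for x
    proof -
      have "(c - 1) * x powr p < clarke_lower g x"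
        using b(2)[of x] x t0 by (simp add: less_divide_eq)
      moreover have "- k * x powr p \<le> (c - 1) * x powr p"
        by (intro mult_right_mono) (simp_all add: k_def)
      moreover have "x powr p \<le> t"
      proof -
        have "x powr p \<le> t powr p" using x p by (intro powr_mono2) simp_all
        also have "\<dots> \<le> t powr 1" using t0 p by (intro powr_mono') simp_all
        finally show ?thesis using t0 by simp
      qed
      then have "k * x powr p \<le> k * t" by (intro mult_left_mono) (simp_all add: k_def)
      ultimately show ?thesis by simp
    qed
    then have "- k * t * (t - 0) \<le> g t - g 0" by (intro clarke_lower_increment[OF g t0(1)])
    then show ?thesis using g0 by (simp add: power2_eq_square mult.assoc)
  qed (simp add: g0)
  then show ?thesis using b(1) by (intro exI[of _ k] conjI exI[of _ "min b 1"]) (simp_all add: k_def)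
qed

lemma quotient_quadratic_bound:
  fixes F :: "real \<Rightarrow> real"
  assumes "Liminf (at_right 0) (\<lambda>s. ereal (F s / s\<^sup>2)) > -\<infinity>" "F 0 = 0"
  shows "\<exists>k\<ge>0. \<exists>\<rho>>0. \<forall>t. 0 \<le> t \<longrightarrow> t < \<rho> \<longrightarrow> - k * t\<^sup>2 \<le> F t"
proof -
  obtain c :: real where "ereal c < Liminf (at_right 0) (\<lambda>s. ereal (F s / s\<^sup>2))"
    using ereal_dense2[OF assms(1)] by blast
  then have "\<forall>\<^sub>F s in at_right 0. ereal c < ereal (F s / s\<^sup>2)" by (rule less_LiminfD)
  then obtain b where b: "b > 0" "\<And>s. 0 < s \<Longrightarrow> s < b \<Longrightarrow> c < F s / s\<^sup>2"
    unfolding eventually_at_right_field by auto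
  have "- \<bar>c\<bar> * t\<^sup>2 \<le> F t" if t: "0 \<le> t" "t < b" for t
  proof (cases "t = 0")
    case False
    then have "c * t\<^sup>2 < F t" using b(2)[of t] t by (simp add: less_divide_eq)
    moreover have "- \<bar>c\<bar> * t\<^sup>2 \<le> c * t\<^sup>2" by (intro mult_right_mono) simp_all
    ultimately show ?thesis by simp
  qed (simp add: assms(2))
  then show ?thesis using b(1) by (intro exI[of _ "\<bar>c\<bar>"] conjI exI[of _ b]) simp_all
qed

text \<open>Requiring the quotient of \<open>F\<close> to exceed \<open>N + l * k\<close>
  compensates the possible loss \<open>l * k * t\<^sup>2\<close> from \<open>g\<close>.\<close>

lemma exists_large_quotient:
  fixes F g :: "real \<Rightarrow> real"
  assumes F: "Limsup (at_right 0) (\<lambda>s. ereal (F s / s\<^sup>2)) = \<infinity>" and l: "l \<ge> 0"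
    and g: "k \<ge> 0" "\<rho> > 0" "\<And>t. 0 \<le> t \<Longrightarrow> t < \<rho> \<Longrightarrow> - k * t\<^sup>2 \<le> g t" and "\<epsilon> > 0"
  shows "\<exists>t. 0 < t \<and> t < \<epsilon> \<and> N * t\<^sup>2 \<le> F t + l * g t"
proof -
  have "\<exists>\<^sub>F s in at_right 0. ereal (N + l * k) < ereal (F s / s\<^sup>2)"
    by (rule frequently_greater_Limsup) (simp add: F)
  from exists_small_of_frequently[OF this, of "min \<epsilon> \<rho>"]
  obtain t where t: "0 < t" "t < \<epsilon>" "t < \<rho>" "N + l * k < F t / t\<^sup>2"
    using assms by auto
  have "(N + l * k) * t\<^sup>2 < F t" using t by (simp add: less_divide_eq)
  moreover have "l * (- k * t\<^sup>2) \<le> l * g t" using g(3)[of t] t l by (intro mult_left_mono) simp_all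
  ultimately have "N * t\<^sup>2 \<le> F t + l * g t" by (simp add: algebra_simps)
  with t show ?thesis by blast
qed

section \<open>Sup norms and one small solution\<close>

lemma zero_extension_nonneg: "0 \<le> s \<Longrightarrow> zero_extension F s = F s"
  by (simp add: zero_extension_def)

lemma (in bounded_open) H01_measurable: "u \<in> H01 \<Omega> \<Longrightarrow> u \<in> borel_measurable M"
  unfolding H01_iff H01_pair_def L2_def by blast

lemma (in bounded_open) Linf_norm_cong:
  assumes "u \<in> H01 \<Omega>" "v \<in> H01 \<Omega>" "AE x in M. u x = v x"
  shows "Linf_norm \<Omega> u = Linf_norm \<Omega> v"
proof -
  have [measurable]: "u \<in> borel_measurable M" "v \<in> borel_measurable M"
    using assms H01_measurable by auto
  have "AE x in M. ereal \<bar>u x\<bar> = ereal \<bar>v x\<bar>" using assms(3) by (rule eventually_mono) simp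
  then show ?thesis unfolding Linf_norm_def by (intro esssup_AE_cong) simp_all
qed

lemma (in bounded_open) Linf_norm_bounds:
  assumes u: "u \<in> H01 \<Omega>" and range: "AE x in M. 0 \<le> u x \<and> u x \<le> a" and nz: "\<not> (AE x in M. u x = 0)"
  shows "0 < Linf_norm \<Omega> u" "Linf_norm \<Omega> u \<le> ereal a"
proof -
  have [measurable]: "u \<in> borel_measurable M" by (rule H01_measurable[OF u])
  show "Linf_norm \<Omega> u \<le> ereal a"
    unfolding Linf_norm_def
  proof (rule esssup_I)
    show "AE x in M. ereal \<bar>u x\<bar> \<le> ereal a" using range by (rule eventually_mono) simp
  qed measurable
  show "0 < Linf_norm \<Omega> u"
  proof (rule ccontr)
    assume "\<not> 0 < Linf_norm \<Omega> u"
    then have le: "esssup M (\<lambda>x. ereal \<bar>u x\<bar>) \<le> 0" by (simp add: Linf_norm_def not_less)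
    have "AE x in M. u x = 0"
      using esssup_AE[of "\<lambda>x. ereal \<bar>u x\<bar>" M]
    proof (rule eventually_mono)
      fix x assume "ereal \<bar>u x\<bar> \<le> esssup M (\<lambda>x. ereal \<bar>u x\<bar>)"
      then have "ereal \<bar>u x\<bar> \<le> 0" using le by (rule order_trans)
      then show "u x = 0" by simp
    qed
    with nz show False ..
  qed
qed

lemma arbitrarily_small_solution:
  fixes \<Omega> :: "(real^'n) set" and F G :: "real \<Rightarrow> real"
  assumes domain: "open \<Omega>" "\<Omega> \<noteq> {}" "bounded \<Omega>"
    and lip: "locally_lipschitz_on {0..} F" "locally_lipschitz_on {0..} G" and F0: "F 0 = 0" and G0: "G 0 = 0"
    and l: "0 \<le> l"
    and neg: "\<exists>\<^sub>F s in at_right 0. clarke_upper (zero_extension F) s + l * clarke_upper (zero_extension G) s < 0"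
    and Fq: "Liminf (at_right 0) (\<lambda>s. ereal (F s / s\<^sup>2)) > -\<infinity>" "Limsup (at_right 0) (\<lambda>s. ereal (F s / s\<^sup>2)) = \<infinity>"
    and G_lower: "k \<ge> 0" "\<rho> > 0" "\<And>t. 0 \<le> t \<Longrightarrow> t < \<rho> \<Longrightarrow> - k * t\<^sup>2 \<le> zero_extension G t"
    and \<epsilon>: "\<epsilon> > 0"
  shows "\<exists>u. weak_solution \<Omega> F G l u \<and> 0 < Linf_norm \<Omega> u \<and> Linf_norm \<Omega> u < ereal \<epsilon> \<and> H01_norm \<Omega> u < \<epsilon>"
proof -
  interpret bounded_open \<Omega> using domain by unfold_locales
  let ?f = "zero_extension F" and ?g = "zero_extension G" and ?m = "measure M (space M)"
  obtain \<rho>F LF where LF: "\<rho>F > 0" "LF \<ge> 0" "\<And>s t. s \<le> \<rho>F \<Longrightarrow> t \<le> \<rho>F \<Longrightarrow> \<bar>?f s - ?f t\<bar> \<le> LF * \<bar>s - t\<bar>"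
    by (rule zero_extension_lipschitz_near[OF lip(1) F0]) blast
  obtain \<rho>G LG where LG: "\<rho>G > 0" "LG \<ge> 0" "\<And>s t. s \<le> \<rho>G \<Longrightarrow> t \<le> \<rho>G \<Longrightarrow> \<bar>?g s - ?g t\<bar> \<le> LG * \<bar>s - t\<bar>"
    by (rule zero_extension_lipschitz_near[OF lip(2) G0]) blast
  define L where "L = LF + l * LG"
  have L: "0 \<le> L" using LF LG l by (simp add: L_def)
  \<comment> \<open>The summand 1 keeps \<open>D\<close> positive even when \<open>L\<close> is 0.
    With \<open>a < \<epsilon>\<^sup>2 / D\<close> the bound for the squared norm falls below
    \<open>\<epsilon>\<^sup>2\<close>, while \<open>a < \<epsilon>\<close> handles the sup
    norm.\<close>
  define D where "D = 2 * L * ?m + 1"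
  have D: "0 < D" using L by (simp add: D_def add_nonneg_pos)
  have "0 < min (min \<rho>F \<rho>G) (min \<epsilon> (\<epsilon>\<^sup>2 / D))" using LF(1) LG(1) \<epsilon> D by simp
  from exists_small_of_frequently[OF neg this]
  obtain a where a_small: "0 < a" "a < \<rho>F" "a < \<rho>G" "a < \<epsilon>" "a < \<epsilon>\<^sup>2 / D"
    and neg_a: "clarke_upper ?f a + l * clarke_upper ?g a < 0" by auto
  interpret frozen_potential \<Omega> ?f ?g l a L
  proof
    show "locally_lipschitz_on UNIV ?f" by (rule zero_extension_locally_lipschitz[OF lip(1) F0])
    show "locally_lipschitz_on UNIV ?g" by (rule zero_extension_locally_lipschitz[OF lip(2) G0])
    show "0 \<le> l" "0 < a" by (rule l, rule a_small(1))
    show "clarke_upper ?f a + l * clarke_upper ?g a < 0" by (rule neg_a)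
    show "?f s = 0" "?g s = 0" if "s \<le> 0" for s
      using that F0 G0 by (simp_all add: zero_extension_def)
    fix s t assume st: "s \<le> a" "t \<le> a"
    have "\<bar>(?f s + l * ?g s) - (?f t + l * ?g t)\<bar> = \<bar>(?f s - ?f t) + l * (?g s - ?g t)\<bar>"
      by (simp add: algebra_simps)
    also have "\<dots> \<le> \<bar>?f s - ?f t\<bar> + l * \<bar>?g s - ?g t\<bar>"
      using abs_triangle_ineq[of "?f s - ?f t" "l * (?g s - ?g t)"] l by (simp add: abs_mult)
    also have "\<dots> \<le> LF * \<bar>s - t\<bar> + l * (LG * \<bar>s - t\<bar>)"
      using st a_small l by (intro add_mono mult_left_mono LF(3) LG(3)) simp_all
    also have "\<dots> = L * \<bar>s - t\<bar>" by (simp add: L_def algebra_simps)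
    finally show "\<bar>(?f s + l * ?g s) - (?f t + l * ?g t)\<bar> \<le> L * \<bar>s - t\<bar>" .
  qed
  obtain k' \<rho>' where Fl: "k' \<ge> 0" "\<rho>' > 0" "\<And>t. 0 \<le> t \<Longrightarrow> t < \<rho>' \<Longrightarrow> - k' * t\<^sup>2 \<le> F t"
    using quotient_quadratic_bound[OF Fq(1) F0] by blast
  have "\<exists>u \<xi>. u \<in> H01 \<Omega> \<and> (AE x in M. 0 \<le> u x \<and> u x \<le> a) \<and> \<not> (AE x in M. u x = 0) \<and>
    (H01_norm \<Omega> u)\<^sup>2 \<le> 2 * L * a * ?m \<and> L2 M \<xi> \<and>
    (AE x in M. \<exists>a b. \<xi> x = a + l * b \<and> a \<in> clarke_gradient ?f (u x) \<and> b \<in> clarke_gradient ?g (u x)) \<and>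
    (\<forall>v\<in>H01 \<Omega>. integrable M (\<lambda>x. \<xi> x * v x) \<and>
      (LINT x|M. weak_gradient \<Omega> u x \<bullet> weak_gradient \<Omega> v x) = (LINT x|M. \<xi> x * v x))"
  proof (rule frozen_solution)
    show "\<Omega> \<noteq> {}" by (rule domain(2))
    show "0 < min \<rho>' \<rho>" using Fl(2) G_lower(2) by simp
    show "0 \<le> k' + l * k" using Fl(1) G_lower(1) l by simp
    show "- (k' + l * k) * t\<^sup>2 \<le> P t" if t: "0 \<le> t" "t < min \<rho>' \<rho>" for t
    proof -
      have "l * (- k * t\<^sup>2) \<le> l * ?g t" using G_lower(3)[of t] t l by (intro mult_left_mono) simp_all
      with Fl(3)[of t] t show ?thesis by (simp add: P_def zero_extension_nonneg algebra_simps)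
    qed
    show "\<exists>t. 0 < t \<and> t < e \<and> N * t\<^sup>2 \<le> P t" if e: "0 < e" for N e
    proof -
      obtain t where "0 < t" "t < e" "N * t\<^sup>2 \<le> F t + l * ?g t"
        using exists_large_quotient[OF Fq(2) l G_lower e] by blast
      then show ?thesis by (intro exI[of _ t]) (simp add: P_def zero_extension_nonneg)
    qed
  qed
  then obtain u \<xi> where u: "u \<in> H01 \<Omega>" and range: "AE x in M. 0 \<le> u x \<and> u x \<le> a"
    and nz: "\<not> (AE x in M. u x = 0)" and norm: "(H01_norm \<Omega> u)\<^sup>2 \<le> 2 * L * a * ?m" and \<xi>: "L2 M \<xi>"
    and incl: "AE x in M. \<exists>a b. \<xi> x = a + l * b \<and> a \<in> clarke_gradient ?f (u x) \<and> b \<in> clarke_gradient ?g (u x)"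
    and eq: "\<forall>v\<in>H01 \<Omega>. integrable M (\<lambda>x. \<xi> x * v x) \<and>
      (LINT x|M. weak_gradient \<Omega> u x \<bullet> weak_gradient \<Omega> v x) = (LINT x|M. \<xi> x * v x)"
    by (elim exE conjE) (rule that)
  have "weak_solution \<Omega> F G l u"
    unfolding weak_solution_def
  proof (intro conjI bexI[of _ \<xi>] u eq)
    show "AE x in M. 0 \<le> u x" using range by (rule eventually_mono) simp
    show "AE x in M. \<xi> x \<in> {a + l * b | a b. a \<in> clarke_gradient ?f (u x) \<and> b \<in> clarke_gradient ?g (u x)}"
      using incl by (rule eventually_mono) simp
    show "\<xi> \<in> borel_measurable M" by (rule L2_measurable[OF \<xi>])
  qed
  moreover have "0 < Linf_norm \<Omega> u" by (rule Linf_norm_bounds(1)[OF u range nz])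
  moreover have "Linf_norm \<Omega> u < ereal \<epsilon>"
    using Linf_norm_bounds(2)[OF u range nz] by (rule le_less_trans) (simp add: a_small(4))
  moreover have "H01_norm \<Omega> u < \<epsilon>"
  proof (rule power2_less_imp_less)
    have "2 * L * a * ?m \<le> a * D" using a_small(1) by (simp add: D_def algebra_simps)
    also have "\<dots> < \<epsilon>\<^sup>2" using a_small(5) D by (simp add: less_divide_eq)
    finally show "(H01_norm \<Omega> u)\<^sup>2 < \<epsilon>\<^sup>2" using norm by simp
  qed (use \<epsilon> in simp)
  ultimately show ?thesis by blast
qed

theorem theorem2p1:
  fixes \<Omega> :: "(real^'n) set"
    and F G :: "real \<Rightarrow> real"
    and p l c_lower c_upper :: real
    and l\<^sub>0 :: ereal
  assumes dim: "CARD('n) \<ge> 2"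
    and domain: "open \<Omega>" "connected \<Omega>" "\<Omega> \<noteq> {}" "bounded \<Omega>"
    and p: "p \<ge> 1"
    and lipschitz: "locally_lipschitz_on {0..} F" "locally_lipschitz_on {0..} G"
    and F_zero: "F 0 = 0"
    and F_quotient: "Liminf (at_right 0) (\<lambda>s. ereal (F s / s\<^sup>2)) > -\<infinity>"
      "Limsup (at_right 0) (\<lambda>s. ereal (F s / s\<^sup>2)) = \<infinity>"
    and F_gradient: "l\<^sub>0 = Liminf (at_right 0) (\<lambda>s. ereal (clarke_max (zero_extension F) s / s))"
      "l\<^sub>0 < 0"
    and G_zero: "G 0 = 0"
    and G_gradient:
      "ereal c_lower = Liminf (at_right 0) (\<lambda>s. ereal (clarke_min (zero_extension G) s / s powr p))"
      "Limsup (at_right 0) (\<lambda>s. ereal (clarke_max (zero_extension G) s / s powr p)) = ereal c_upper"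
    and cases: "(p = 1 \<and> l \<ge> 0 \<and> ereal (l * c_upper) < - l\<^sub>0) \<or> (p > 1 \<and> l \<ge> 0)"
  shows "\<exists>u :: nat \<Rightarrow> real^'n \<Rightarrow> real.
    (\<forall>i. weak_solution \<Omega> F G l (u i)) \<and>
    (\<forall>i j. i \<noteq> j \<longrightarrow> \<not> (AE x in lebesgue_on \<Omega>. u i x = u j x)) \<and>
    (\<lambda>i. H01_norm \<Omega> (u i)) \<longlonglongrightarrow> 0 \<and>
    (\<lambda>i. Linf_norm \<Omega> (u i)) \<longlonglongrightarrow> 0"
proof -
  let ?f = "zero_extension F" and ?g = "zero_extension G"
  interpret bounded_open \<Omega> using domain by unfold_locales
  have ll: "locally_lipschitz_on UNIV ?f" "locally_lipschitz_on UNIV ?g"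
    by (rule zero_extension_locally_lipschitz[OF lipschitz(1) F_zero], rule zero_extension_locally_lipschitz[OF lipschitz(2) G_zero])
  have l: "0 \<le> l" using cases by auto
  have neg: "\<exists>\<^sub>F s in at_right 0. clarke_upper ?f s + l * clarke_upper ?g s < 0"
    using F_gradient G_gradient(2) cases
    unfolding clarke_max_eq[OF ll(1)] clarke_max_eq[OF ll(2)]
    by (rule frequently_negative_gradient)
  obtain k \<rho> where G_lower: "k \<ge> 0" "\<rho> > 0" "\<And>t. 0 \<le> t \<Longrightarrow> t < \<rho> \<Longrightarrow> - k * t\<^sup>2 \<le> ?g t"
    using clarke_lower_quadratic_bound[OF ll(2) _ p G_gradient(1)[unfolded clarke_min_eq[OF ll(2)]]] G_zero
    by (auto simp: zero_extension_def)
  define Q where "Q \<epsilon> u \<longleftrightarrow> weak_solution \<Omega> F G l u \<and> 0 < Linf_norm \<Omega> u \<and> Linf_norm \<Omega> u < ereal \<epsilon> \<and> H01_norm \<Omega> u < \<epsilon>"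
    for \<epsilon> u
  have small: "\<exists>u. Q \<epsilon> u" if "\<epsilon> > 0" for \<epsilon>
    unfolding Q_def
    by (rule arbitrarily_small_solution[OF domain(1,3,4) lipschitz F_zero G_zero l neg F_quotient G_lower that])
  \<comment> \<open>Dependent choice: each solution is taken below a level \<open>r\<close> strictly
    between 0 and the sup norm of its predecessor. Strict decrease of the sup norms excludes
    equality almost everywhere between any two members.\<close>
  have "\<exists>u. \<forall>i. Q (1 / Suc i) (u i) \<and> Linf_norm \<Omega> (u (Suc i)) < Linf_norm \<Omega> (u i)"
  proof (rule dependent_nat_choice)
    show "\<exists>u. Q (1 / Suc 0) u" by (rule small) simp
    fix u i assume "Q (1 / Suc i) u"
    then have "0 < Linf_norm \<Omega> u" by (simp add: Q_def)
    then obtain r :: real where r: "0 < r" "ereal r < Linf_norm \<Omega> u"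
      using ereal_dense2[of 0 "Linf_norm \<Omega> u"] by auto
    obtain v where v: "Q (min r (1 / Suc (Suc i))) v" using small[of "min r (1 / Suc (Suc i))"] r(1) by auto
    then have "Linf_norm \<Omega> v < ereal (min r (1 / Suc (Suc i)))" by (simp add: Q_def)
    also have "\<dots> \<le> ereal r" by simp
    finally have "Linf_norm \<Omega> v < Linf_norm \<Omega> u" using r(2) by simp
    moreover have "Q (1 / Suc (Suc i)) v" using v by (simp add: Q_def)
    ultimately show "\<exists>v. Q (1 / Suc (Suc i)) v \<and> Linf_norm \<Omega> v < Linf_norm \<Omega> u" by blast
  qed
  then obtain u where Q: "\<And>i. Q (1 / Suc i) (u i)" and dec: "\<And>i. Linf_norm \<Omega> (u (Suc i)) < Linf_norm \<Omega> (u i)"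
    by blast
  have H01: "u i \<in> H01 \<Omega>" for i using Q[of i] by (simp add: Q_def weak_solution_def)
  have less: "Linf_norm \<Omega> (u j) < Linf_norm \<Omega> (u i)" if "i < j" for i j
    \<comment> \<open>The lifting rule is for increasing sequences, so it is applied to the negated
      norms.\<close>
    using that dec by (rule lift_Suc_mono_less[of "\<lambda>i. - Linf_norm \<Omega> (u i)", simplified, rotated])
  have inv: "(\<lambda>i. 1 / real (Suc i)) \<longlonglongrightarrow> 0" using LIMSEQ_inverse_real_of_nat by (simp add: inverse_eq_divide)
  show ?thesis
  proof (intro exI[of _ u] conjI allI impI)
    show "weak_solution \<Omega> F G l (u i)" for i using Q[of i] by (simp add: Q_def)
    show "\<not> (AE x in M. u i x = u j x)" if "i \<noteq> j" for i j
    proof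
      assume "AE x in M. u i x = u j x"
      then have "Linf_norm \<Omega> (u i) = Linf_norm \<Omega> (u j)" by (rule Linf_norm_cong[OF H01 H01])
      with less[of i j] less[of j i] that show False by (cases i j rule: linorder_cases) simp_all
    qed
    show "(\<lambda>i. H01_norm \<Omega> (u i)) \<longlonglongrightarrow> 0"
    proof (rule tendsto_sandwich[OF _ _ tendsto_const inv])
      show "\<forall>\<^sub>F i in sequentially. 0 \<le> H01_norm \<Omega> (u i)" by (simp add: H01_norm_def)
      show "\<forall>\<^sub>F i in sequentially. H01_norm \<Omega> (u i) \<le> 1 / real (Suc i)"
        using Q by (simp add: Q_def less_imp_le always_eventually)
    qed
    show "(\<lambda>i. Linf_norm \<Omega> (u i)) \<longlonglongrightarrow> 0"
    proof (rule tendsto_sandwich[OF _ _ tendsto_const])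
      show "(\<lambda>i. ereal (1 / real (Suc i))) \<longlonglongrightarrow> 0" using inv by (simp add: zero_ereal_def)
      show "\<forall>\<^sub>F i in sequentially. 0 \<le> Linf_norm \<Omega> (u i)"
        using Q by (simp add: Q_def less_imp_le always_eventually)
      show "\<forall>\<^sub>F i in sequentially. Linf_norm \<Omega> (u i) \<le> ereal (1 / real (Suc i))"
        using Q by (intro always_eventually allI less_imp_le) (simp add: Q_def)
    qed
  qed
qed

end
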